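(* Let $k$ be a finite field of characteristic $p$ and let $R$ be a complete noetherian local commutative ring with residue field $k$ and $\operatorname{char} R = 0$. Suppose that there exist a finite group $G$, an integer $n\ge 1$ and a representation $\bar\rho: G \to \mathrm{GL}_n(k)$ such that $R$ is the universal deformation ring of $\bar\rho$. Then the ring $R/R[p^\infty]$ is reduced and has Krull dimension $1$, where $R[p^\infty]=\bigcup_{r\ge 1}\{a\in R : p^r a=0\}$ is the $p$-torsion ideal of $R$.
   Context: $W(k)$ denotes the ring of Witt vectors over $k$. $\hat{\mathcal C}$ is the category of complete noetherian local commutative rings with residue field $k$; each is naturally a $W(k)$-algebra and morphisms are local $W(k)$-algebra homomorphisms. For $R\in\hat{\mathcal C}$ with maximal ideal $\mathfrak m_R$ and reduction map $\pi: \mathrm{GL}_n(R)\to \mathrm{GL}_n(k)$, a lift of $\bar\rho$ to $R$ is a homomorphism $\rho: G\to \mathrm{GL}_n(R)$ with $\pi\circ\rho=\bar\rho$; two lifts $\rho,\rho'$ are strictly equivalent if $\rho'=K\rho K^{-1}$ for some $K\in \ker\pi = I_n+M_n(\mathfrak m_R)$. $\mathrm{Def}_{\bar\rho}(R)$ is the set of strict equivalence classes of lifts to $R$; this defines a functor $\mathrm{Def}_{\bar\rho}:\hat{\mathcal C}\to\mathrm{Sets}$, and $R$ is the universal deformation ring of $\bar\rho$ if it represents this functor. *)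

theory Defs
  imports
    "HOL-Algebra.Algebra"
    "HOL-Library.Poly_Mapping"
    "HOL-Library.Extended_Nat"
    "Jordan_Normal_Form.Matrix"
begin

section \<open>Commutative rings\<close>

definition has_char :: "('a, 'm) ring_scheme \<Rightarrow> nat \<Rightarrow> bool" where
  "has_char A c \<longleftrightarrow> (\<forall>n::nat. add_pow A n \<one>\<^bsub>A\<^esub> = \<zero>\<^bsub>A\<^esub> \<longleftrightarrow> c dvd n)"

definition local_cring :: "('a, 'm) ring_scheme \<Rightarrow> bool" where
  "local_cring A \<longleftrightarrow> cring A \<and> (\<exists>!M. maximalideal M A)"

definition max_ideal :: "('a, 'm) ring_scheme \<Rightarrow> 'a set" where
  "max_ideal A = (THE M. maximalideal M A)"

definition max_ideal_pow :: "('a, 'm) ring_scheme \<Rightarrow> nat \<Rightarrow> 'a set" where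
  "max_ideal_pow A n = max_ideal A [^]\<^bsub>ideals_set A\<^esub> n"

text \<open>Completeness of a local ring with maximal ideal \<open>m\<close> means that the map from the ring to the
  inverse limit of its quotients by the powers of \<open>m\<close> is bijective. A compatible family of
  residue classes is given here by representatives \<open>x n\<close>; uniqueness of \<open>y\<close> is separatedness.\<close>

definition complete_local :: "('a, 'm) ring_scheme \<Rightarrow> bool" where
  "complete_local A \<longleftrightarrow>
    (\<forall>x :: nat \<Rightarrow> 'a.
      (\<forall>n. x n \<in> carrier A \<and> x (Suc n) \<ominus>\<^bsub>A\<^esub> x n \<in> max_ideal_pow A n) \<longrightarrow>
      (\<exists>!y. y \<in> carrier A \<and> (\<forall>n. y \<ominus>\<^bsub>A\<^esub> x n \<in> max_ideal_pow A n)))"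

definition reduced_ring :: "('a, 'm) ring_scheme \<Rightarrow> bool" where
  "reduced_ring A \<longleftrightarrow>
    (\<forall>a \<in> carrier A. (\<exists>n::nat. a [^]\<^bsub>A\<^esub> n = \<zero>\<^bsub>A\<^esub>) \<longrightarrow> a = \<zero>\<^bsub>A\<^esub>)"

text \<open>With this definition the zero ring, which has no prime ideals, gets dimension \<open>0\<close>.\<close>

definition krull_dim :: "('a, 'm) ring_scheme \<Rightarrow> enat" where
  "krull_dim A =
    (SUP n \<in> {n. \<exists>P :: nat \<Rightarrow> 'a set.
        (\<forall>i \<le> n. primeideal (P i) A) \<and> (\<forall>i < n. P i \<subset> P (Suc i))}. enat n)"

definition p_power_torsion :: "nat \<Rightarrow> ('a, 'm) ring_scheme \<Rightarrow> 'a set" where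
  "p_power_torsion p A =
    (\<Union>r \<in> {1..}. {a \<in> carrier A. add_pow A (p ^ r) a = \<zero>\<^bsub>A\<^esub>})"


section \<open>Witt vectors\<close>

text \<open>Integer polynomials in the variables \<open>X i\<close> (index \<open>Inl i\<close>) and \<open>Y i\<close> (index \<open>Inr i\<close>):
  finitely supported maps from monomials to coefficients.\<close>

type_synonym witt_poly = "((nat + nat) \<Rightarrow>\<^sub>0 nat) \<Rightarrow>\<^sub>0 int"

definition witt_var :: "nat + nat \<Rightarrow> witt_poly" where
  "witt_var v = Poly_Mapping.single (Poly_Mapping.single v 1) 1"

definition ghost :: "nat \<Rightarrow> nat \<Rightarrow> (nat \<Rightarrow> witt_poly) \<Rightarrow> witt_poly" where
  "ghost p n Z = (\<Sum>i\<le>n. of_nat (p ^ i) * Z i ^ (p ^ (n - i)))"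

text \<open>For a prime \<open>p\<close>, the existence of these polynomials is Witt's theorem; uniqueness holds
  because the integer polynomial ring is torsion-free.\<close>

definition witt_sum_poly :: "nat \<Rightarrow> nat \<Rightarrow> witt_poly" where
  "witt_sum_poly p = (THE S. \<forall>n. ghost p n S =
     ghost p n (\<lambda>i. witt_var (Inl i)) + ghost p n (\<lambda>i. witt_var (Inr i)))"

definition witt_prod_poly :: "nat \<Rightarrow> nat \<Rightarrow> witt_poly" where
  "witt_prod_poly p = (THE S. \<forall>n. ghost p n S =
     ghost p n (\<lambda>i. witt_var (Inl i)) * ghost p n (\<lambda>i. witt_var (Inr i)))"

definition eval_witt_poly ::
    "('k, 'm) ring_scheme \<Rightarrow> (nat \<Rightarrow> 'k) \<Rightarrow> (nat \<Rightarrow> 'k) \<Rightarrow> witt_poly \<Rightarrow> 'k" where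
  "eval_witt_poly k a b P =
    (\<Oplus>\<^bsub>k\<^esub>m \<in> Poly_Mapping.keys P. add_pow k (Poly_Mapping.lookup P m)
      (\<Otimes>\<^bsub>k\<^esub>v \<in> Poly_Mapping.keys m. case_sum a b v [^]\<^bsub>k\<^esub> Poly_Mapping.lookup m v))"

definition witt_ring :: "nat \<Rightarrow> ('k, 'm) ring_scheme \<Rightarrow> (nat \<Rightarrow> 'k) ring" where
  "witt_ring p k =
    \<lparr> carrier = {a. \<forall>i. a i \<in> carrier k},
      monoid.mult = (\<lambda>a b n. eval_witt_poly k a b (witt_prod_poly p n)),
      one = (\<lambda>n. if n = 0 then \<one>\<^bsub>k\<^esub> else \<zero>\<^bsub>k\<^esub>),
      ring.zero = (\<lambda>n. \<zero>\<^bsub>k\<^esub>),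
      ring.add = (\<lambda>a b n. eval_witt_poly k a b (witt_sum_poly p n)) \<rparr>"


section \<open>Complete noetherian local rings with residue field \<open>k\<close>\<close>

text \<open>The identification of the residue field with \<open>k\<close> is carried as a surjection onto \<open>k\<close> whose
  kernel is the maximal ideal. The natural \<open>W(k)\<close>-algebra structure is carried as its structure
  map; for perfect \<open>k\<close> it exists and is uniquely determined by being compatible with the
  projections to \<open>k\<close>, so it is not an additional choice.\<close>

record ('a, 'k) coeff_ring = "'a ring" +
  residue :: "'a \<Rightarrow> 'k"
  witt_map :: "(nat \<Rightarrow> 'k) \<Rightarrow> 'a"

definition coeff_category :: "nat \<Rightarrow> 'k ring \<Rightarrow> ('a, 'k) coeff_ring set" where
  "coeff_category p k =
    {A. noetherian_ring A \<and> local_cring A \<and> complete_local A \<and>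
        residue A \<in> Ring.ring_hom A k \<and> residue A ` carrier A = carrier k \<and>
        a_kernel A k (residue A) = max_ideal A \<and>
        witt_map A \<in> Ring.ring_hom (witt_ring p k) A \<and>
        (\<forall>w \<in> carrier (witt_ring p k). residue A (witt_map A w) = w 0)}"

text \<open>Local homomorphisms of \<open>W(k)\<close>-algebras.\<close>

definition coeff_hom ::
    "nat \<Rightarrow> 'k ring \<Rightarrow> ('a, 'k) coeff_ring \<Rightarrow> ('b, 'k) coeff_ring \<Rightarrow> ('a \<Rightarrow> 'b) set" where
  "coeff_hom p k A B =
    {f \<in> Ring.ring_hom A B \<inter> extensional (carrier A).
       f ` max_ideal A \<subseteq> max_ideal B \<and>
       (\<forall>w \<in> carrier (witt_ring p k). f (witt_map A w) = witt_map B w)}"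


section \<open>Deformations\<close>

definition mat_monoid :: "('a, 'm) ring_scheme \<Rightarrow> nat \<Rightarrow> 'a mat monoid" where
  "mat_monoid A n =
    \<lparr> carrier = {M \<in> carrier_mat n n. \<forall>i<n. \<forall>j<n. M $$ (i, j) \<in> carrier A},
      monoid.mult = (\<lambda>M N. mat n n (\<lambda>(i, j). \<Oplus>\<^bsub>A\<^esub>l \<in> {..<n}. M $$ (i, l) \<otimes>\<^bsub>A\<^esub> N $$ (l, j))),
      one = mat n n (\<lambda>(i, j). if i = j then \<one>\<^bsub>A\<^esub> else \<zero>\<^bsub>A\<^esub>) \<rparr>"

definition GL :: "nat \<Rightarrow> ('a, 'm) ring_scheme \<Rightarrow> 'a mat monoid" where
  "GL n A = units_of (mat_monoid A n)"

definition lifts ::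
    "'k ring \<Rightarrow> 'g monoid \<Rightarrow> nat \<Rightarrow> ('g \<Rightarrow> 'k mat) \<Rightarrow> ('a, 'k) coeff_ring \<Rightarrow> ('g \<Rightarrow> 'a mat) set" where
  "lifts k G n \<rho>bar A =
    {\<rho> \<in> hom G (GL n A) \<inter> extensional (carrier G).
       \<forall>g \<in> carrier G. map_mat (residue A) (\<rho> g) = \<rho>bar g}"

definition strict_equivalence ::
    "'k ring \<Rightarrow> 'g monoid \<Rightarrow> nat \<Rightarrow> ('g \<Rightarrow> 'k mat) \<Rightarrow> ('a, 'k) coeff_ring \<Rightarrow>
     (('g \<Rightarrow> 'a mat) \<times> ('g \<Rightarrow> 'a mat)) set" where
  "strict_equivalence k G n \<rho>bar A =
    {(\<rho>, \<rho>'). \<rho> \<in> lifts k G n \<rho>bar A \<and> \<rho>' \<in> lifts k G n \<rho>bar A \<and>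
       (\<exists>K \<in> kernel (GL n A) (GL n k) (map_mat (residue A)).
          \<forall>g \<in> carrier G. \<rho>' g = K \<otimes>\<^bsub>GL n A\<^esub> \<rho> g \<otimes>\<^bsub>GL n A\<^esub> inv\<^bsub>GL n A\<^esub> K)}"

definition Def ::
    "'k ring \<Rightarrow> 'g monoid \<Rightarrow> nat \<Rightarrow> ('g \<Rightarrow> 'k mat) \<Rightarrow> ('a, 'k) coeff_ring \<Rightarrow> ('g \<Rightarrow> 'a mat) set set" where
  "Def k G n \<rho>bar A = lifts k G n \<rho>bar A // strict_equivalence k G n \<rho>bar A"

text \<open>The action of the functor on a morphism \<open>f\<close> with target \<open>B\<close>: the class of \<open>\<rho>\<close> goes to the
  class of the entrywise image of \<open>\<rho>\<close> under \<open>f\<close>.\<close>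

definition Def_map ::
    "'k ring \<Rightarrow> 'g monoid \<Rightarrow> nat \<Rightarrow> ('g \<Rightarrow> 'k mat) \<Rightarrow> ('b, 'k) coeff_ring \<Rightarrow> ('a \<Rightarrow> 'b) \<Rightarrow>
     ('g \<Rightarrow> 'a mat) set \<Rightarrow> ('g \<Rightarrow> 'b mat) set" where
  "Def_map k G n \<rho>bar B f c =
    strict_equivalence k G n \<rho>bar B `` ((\<lambda>\<rho>. \<lambda>g \<in> carrier G. map_mat f (\<rho> g)) ` c)"

text \<open>Representability: a natural bijection between the morphisms out of \<open>R\<close> and the values of the
  functor. HOL cannot quantify over the carrier type inside a formula, so the objects \<open>A\<close> and \<open>B\<close>
  have carriers of type \<^typ>\<open>nat set\<close>. For finite \<open>k\<close> this loses nothing: the quotients of a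
  complete noetherian local ring by the powers of its maximal ideal are then finite, so the ring has
  at most the cardinality of the continuum and is isomorphic to one of these objects. The ring \<open>R\<close>
  itself may have any carrier type.\<close>

definition universal_deformation_ring ::
    "nat \<Rightarrow> 'k ring \<Rightarrow> 'g monoid \<Rightarrow> nat \<Rightarrow> ('g \<Rightarrow> 'k mat) \<Rightarrow> ('a, 'k) coeff_ring \<Rightarrow> bool" where
  "universal_deformation_ring p k G n \<rho>bar R \<longleftrightarrow>
    R \<in> coeff_category p k \<and>
    (\<exists>\<eta> :: (nat set, 'k) coeff_ring \<Rightarrow> ('a \<Rightarrow> nat set) \<Rightarrow> ('g \<Rightarrow> nat set mat) set.
      (\<forall>A \<in> coeff_category p k. bij_betw (\<eta> A) (coeff_hom p k R A) (Def k G n \<rho>bar A)) \<and>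
      (\<forall>A \<in> coeff_category p k. \<forall>B \<in> coeff_category p k.
         \<forall>f \<in> coeff_hom p k A B. \<forall>\<phi> \<in> coeff_hom p k R A.
           \<eta> B (compose (carrier R) f \<phi>) = Def_map k G n \<rho>bar B f (\<eta> A \<phi>)))"

end

theory Submission
  imports Defs "HOL-Computational_Algebra.Primes" "Jordan_Normal_Form.Determinant"
begin

text \<open>
  Let \<open>N = |G|\<close> and let \<open>q\<close> be an ideal of \<open>R\<close> between a power of \<open>m\<close> and \<open>m\<close>. Put \<open>A = R/q\<close> and let \<open>I\<close>
  be the kernel of the multiplication \<open>A \<otimes> A \<rightarrow> A\<close>. The maps \<open>x \<mapsto> 1 \<otimes> x\<close> and
  \<open>x \<mapsto> 1 \<otimes> x + N (x \<otimes> 1 - 1 \<otimes> x)\<close> from \<open>R\<close> to \<open>(A \<otimes> A)/I\<^sup>2\<close> are morphisms: the Witt vectors cause no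
  obstruction since a derivation kills them. A lift to \<open>A\<close> has strictly equivalent images under the
  two maps, because \<open>N\<close> kills \<open>H\<^sup>1(G, -)\<close>. Universality then forces \<open>N I \<subseteq> I\<^sup>2\<close>, and the determinant
  trick gives \<open>z \<in> A \<otimes> A\<close> that annihilates \<open>I\<close> and is \<open>N\<^sup>d\<close> on the diagonal, with \<open>d\<close> independent of
  \<open>q\<close>. So \<open>z = \<Sum> a \<otimes> t\<close> is a Casimir element: \<open>\<Sum> a h(b t) = b \<Sum> a h(t)\<close> for additive \<open>h\<close>.

  Applying \<open>z\<close> to additive functions with values in \<open>\<int>/p\<^sup>M\<close> yields two consequences. First,
  some power of \<open>m\<close> lies in \<open>R[p\<^sup>\<infinity>] + p R\<close>. Second, for every \<open>x\<close> some \<open>p\<^sup>r N\<^sup>d x\<close> is a multiple of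
  \<open>x\<^sup>2\<close>. In \<open>R/R[p\<^sup>\<infinity>]\<close>, where \<open>N\<close> is not a zero divisor, the second fact excludes nilpotents and
  makes every prime ideal not containing \<open>p\<close> minimal; by the first fact the only prime ideal
  containing \<open>p\<close> is the maximal one.

  All ideals are pulled back to the integer polynomial ring on the elements of \<open>R\<close>.
\<close>

section \<open>Integer polynomials and Witt vectors\<close>

text \<open>\<open>R \<otimes> R\<close> need be neither noetherian nor complete, hence is no test
  object; for finite \<open>A\<close> the ring \<open>A \<otimes> A\<close> is finite. Only the
  exponent \<open>d\<close> has to be uniform in \<open>q\<close>: it is the number of topological
  generators of \<open>R\<close>, whose differentials generate \<open>I\<close> at every level. The
  factor \<open>N\<close> in the second map is dictated by cohomology: the two copies of a lift
  differ by a cocycle with values in matrices over \<open>I/I^2\<close>, and its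
  \<open>N\<close>-fold is a coboundary. Functions to \<open>\<int>/p^M\<close> serve as a
  substitute for a dual basis. On a quotient of \<open>R\<close> without \<open>p\<close>-torsion
  they lift from \<open>p^M\<close> to \<open>p^(M+1)\<close>, and finitely many of them write the
  identity of a finite level as a sum \<open>\<Sum> u(_) d\<close>. Inserted into \<open>z\<close>,
  this yields elements \<open>w\<close> with \<open>\<Sum> w d\<close> close to \<open>N^d\<close>,
  and whatever kills \<open>u\<close> kills \<open>w\<close>. Compactness of \<open>R\<close>
  carries the result from finite levels to \<open>R\<close>. Integer polynomials are used because
  their tensor square is again a polynomial ring and all ideals are plain sets. With the ring as a
  module over itself, \<open>cr.subspace\<close> means ideal and \<open>cr.span\<close> is the
  generated ideal.\<close>

interpretation cr: Modules.module "(*) :: 'r::comm_ring_1 \<Rightarrow> 'r \<Rightarrow> 'r"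
  by standard (auto simp: algebra_simps)

declare cr.scale_scale [simp del]

section \<open>Evaluation of integer polynomials\<close>

type_synonym 'v int_poly = "('v \<Rightarrow>\<^sub>0 nat) \<Rightarrow>\<^sub>0 int"

definition poly_var :: "'v \<Rightarrow> 'v int_poly" where
  "poly_var v = Poly_Mapping.single (Poly_Mapping.single v 1) 1"

definition mon_eval :: "('b, 'm) ring_scheme \<Rightarrow> ('v \<Rightarrow> 'b) \<Rightarrow> ('v \<Rightarrow>\<^sub>0 nat) \<Rightarrow> 'b" where
  "mon_eval B c m = (\<Otimes>\<^bsub>B\<^esub>v \<in> Poly_Mapping.keys m. c v [^]\<^bsub>B\<^esub> Poly_Mapping.lookup m v)"

text \<open>The form of \<open>eval_witt_poly\<close> with an arbitrary type of variables, so that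
  the operations on Witt vectors are instances of it. It is also the presentation map used for
  \<open>R\<close> in the end.\<close>

definition poly_eval :: "('b, 'm) ring_scheme \<Rightarrow> ('v \<Rightarrow> 'b) \<Rightarrow> 'v int_poly \<Rightarrow> 'b" where
  "poly_eval B c P =
    (\<Oplus>\<^bsub>B\<^esub>m \<in> Poly_Mapping.keys P. add_pow B (Poly_Mapping.lookup P m) (mon_eval B c m))"

lemma single_induct [case_names single add]:
  fixes f :: "'k \<Rightarrow>\<^sub>0 'b::comm_monoid_add"
  assumes "\<And>k v. Q (Poly_Mapping.single k v)"
    and "\<And>f g. Q f \<Longrightarrow> Q g \<Longrightarrow> Q (f + g)"
  shows "Q f"
proof (induction f rule: update_induct)
  case const
  show ?case using assms(1)[of undefined 0] by simp
next
  case (update f a b)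
  have "Poly_Mapping.update a b f = f + Poly_Mapping.single a b"
    using update(1) by (intro poly_mapping_eqI)
      (auto simp: lookup_add lookup_update lookup_single when_def in_keys_iff)
  then show ?case using assms update by simp
qed

lemma single_eq_prod_vars:
  "Poly_Mapping.single m (1::'r::comm_ring_1)
    = (\<Prod>v\<in>Poly_Mapping.keys m. Poly_Mapping.single (Poly_Mapping.single v 1) 1 ^ Poly_Mapping.lookup m v)"
proof -
  have var_pow: "Poly_Mapping.single (Poly_Mapping.single v 1) (1::'r) ^ i = Poly_Mapping.single (Poly_Mapping.single v i) 1" for v :: 'a and i :: nat
    by (induction i) (simp_all add: mult_single single_add[symmetric] flip: single_one)
  have "(\<Prod>v\<in>A. Poly_Mapping.single (Poly_Mapping.single v 1) (1::'r) ^ Poly_Mapping.lookup m v)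
      = Poly_Mapping.single (\<Sum>v\<in>A. Poly_Mapping.single v (Poly_Mapping.lookup m v)) 1" if "finite A" for A
    using that by (induction A) (simp_all add: var_pow mult_single del: One_nat_def flip: single_one)
  moreover have "(\<Sum>v\<in>Poly_Mapping.keys m. Poly_Mapping.single v (Poly_Mapping.lookup m v)) = m"
    by (intro poly_mapping_eqI)
      (auto simp: lookup_sum lookup_single when_def in_keys_iff sum.If_cases)
  ultimately show ?thesis by simp
qed

text \<open>Integer constants and monomials arise from \<open>1\<close> and the variables by ring
  operations. Identities between ring homomorphisms out of a polynomial ring are proved in this
  form.\<close>

lemma int_poly_induct [case_names one var add uminus mult]:
  fixes P :: "'v int_poly"
  assumes one: "Q 1" and var: "\<And>v. Q (poly_var v)"
    and add: "\<And>x y. Q x \<Longrightarrow> Q y \<Longrightarrow> Q (x + y)"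
    and uminus: "\<And>x. Q x \<Longrightarrow> Q (- x)"
    and mult: "\<And>x y. Q x \<Longrightarrow> Q y \<Longrightarrow> Q (x * y)"
  shows "Q P"
proof (induction P rule: single_induct)
  case (single m z)
  have zero: "Q 0" using add[OF one uminus[OF one]] by simp
  have n: "Q (of_nat i)" for i by (induction i) (auto intro: zero one add)
  have z: "Q (of_int z)" by (cases z) (auto intro: n uminus simp del: of_nat_Suc)
  have pow: "Q (x ^ i)" if "Q x" for x i using that by (induction i) (auto intro: one mult)
  have prod: "Q (\<Prod>v\<in>A. g v)" if "\<And>v. Q (g v)" for g and A :: "'v set"
    using that by (induction A rule: infinite_finite_induct) (auto intro: one mult)
  have "Poly_Mapping.single m z = of_int z * Poly_Mapping.single m 1"
    by (simp add: mult_single flip: single_of_int)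
  then show ?case unfolding single_eq_prod_vars[of m] poly_var_def[symmetric] by (auto intro!: mult z prod pow var)
qed (rule add)

context cring
begin

lemma mon_eval_closed:
  assumes "\<And>v. c v \<in> carrier R" shows "mon_eval R c m \<in> carrier R"
  unfolding mon_eval_def using assms by (intro finprod_closed) auto

lemma mon_eval_superset:
  assumes "\<And>v. c v \<in> carrier R" "finite A" "Poly_Mapping.keys m \<subseteq> A"
  shows "mon_eval R c m = (\<Otimes>v\<in>A. c v [^] Poly_Mapping.lookup m v)"
  unfolding mon_eval_def using assms
  by (intro finprod_mono_neutral_cong_left) (auto simp: in_keys_iff)

lemma mon_eval_add:
  assumes "\<And>v. c v \<in> carrier R"
  shows "mon_eval R c (m + m') = mon_eval R c m \<otimes> mon_eval R c m'"
proof -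
  let ?A = "Poly_Mapping.keys m \<union> Poly_Mapping.keys m'"
  have "mon_eval R c (m + m') = (\<Otimes>v\<in>?A. c v [^] Poly_Mapping.lookup (m + m') v)"
    using assms Poly_Mapping.keys_add[of m m'] by (intro mon_eval_superset) auto
  also have "\<dots> = (\<Otimes>v\<in>?A. c v [^] Poly_Mapping.lookup m v \<otimes> c v [^] Poly_Mapping.lookup m' v)"
    using assms by (intro finprod_cong') (auto simp: lookup_add nat_pow_mult)
  also have "\<dots> = (\<Otimes>v\<in>?A. c v [^] Poly_Mapping.lookup m v) \<otimes> (\<Otimes>v\<in>?A. c v [^] Poly_Mapping.lookup m' v)"
    using assms by (intro finprod_multf) auto
  also have "\<dots> = mon_eval R c m \<otimes> mon_eval R c m'"
    using assms by (subst (1 2) mon_eval_superset[of _ ?A]) auto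
  finally show ?thesis .
qed

lemma poly_eval_closed:
  assumes "\<And>v. c v \<in> carrier R" shows "poly_eval R c P \<in> carrier R"
  unfolding poly_eval_def using assms by (intro finsum_closed) (auto intro: mon_eval_closed)

lemma poly_eval_superset:
  assumes "\<And>v. c v \<in> carrier R" "finite A" "Poly_Mapping.keys P \<subseteq> A"
  shows "poly_eval R c P = (\<Oplus>m\<in>A. add_pow R (Poly_Mapping.lookup P m) (mon_eval R c m))"
  unfolding poly_eval_def using assms
  by (intro add.finprod_mono_neutral_cong_left) (auto simp: in_keys_iff mon_eval_closed add_pow_int_ge)

lemma poly_eval_add:
  assumes "\<And>v. c v \<in> carrier R"
  shows "poly_eval R c (P + Q) = poly_eval R c P \<oplus> poly_eval R c Q"
proof -
  let ?A = "Poly_Mapping.keys P \<union> Poly_Mapping.keys Q"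
  note [simp] = mon_eval_closed[OF assms]
  have "poly_eval R c (P + Q) = (\<Oplus>m\<in>?A. add_pow R (Poly_Mapping.lookup (P + Q) m) (mon_eval R c m))"
    using assms Poly_Mapping.keys_add[of P Q] by (intro poly_eval_superset) auto
  also have "\<dots> = (\<Oplus>m\<in>?A. add_pow R (Poly_Mapping.lookup P m) (mon_eval R c m)
      \<oplus> add_pow R (Poly_Mapping.lookup Q m) (mon_eval R c m))"
    using assms by (intro add.finprod_cong') (auto simp: lookup_add add.int_pow_mult)
  also have "\<dots> = poly_eval R c P \<oplus> poly_eval R c Q"
    using assms by (subst (1 2) poly_eval_superset[of _ ?A]) (auto intro: add.finprod_multf)
  finally show ?thesis .
qed

lemma poly_eval_single:
  assumes "\<And>v. c v \<in> carrier R"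
  shows "poly_eval R c (Poly_Mapping.single m z) = add_pow R z (mon_eval R c m)"
  using assms by (subst poly_eval_superset[of _ "{m}"]) (auto simp: mon_eval_closed)

lemma poly_eval_mult:
  assumes "\<And>v. c v \<in> carrier R"
  shows "poly_eval R c (P * Q) = poly_eval R c P \<otimes> poly_eval R c Q"
proof (induction P rule: single_induct)
  case (single m z)
  note [simp] = mon_eval_closed[OF assms]
  show ?case
  proof (induction Q rule: single_induct)
    case (single m' z')
    show ?case
      by (simp add: mult_single poly_eval_single[OF assms] mon_eval_add[OF assms] add_pow_ldistr_int add_pow_rdistr_int
          add.int_pow_pow mult.commute m_comm)
  next
    case (add f g)
    then show ?case by (simp add: poly_eval_add poly_eval_closed assms distrib_left r_distr)
  qed
next
  case (add f g)
  then show ?case by (simp add: poly_eval_add poly_eval_closed assms distrib_right l_distr)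
qed

lemma poly_eval_zero [simp]: "poly_eval R c 0 = \<zero>"
  by (simp add: poly_eval_def)

lemma poly_eval_one:
  assumes "\<And>v. c v \<in> carrier R"
  shows "poly_eval R c 1 = \<one>"
  using poly_eval_single[OF assms, where m = 0 and z = 1] by (simp add: mon_eval_def)

lemma poly_eval_var:
  assumes "\<And>v. c v \<in> carrier R"
  shows "poly_eval R c (poly_var v) = c v"
  unfolding poly_var_def using poly_eval_single[OF assms, where m = "Poly_Mapping.single v 1" and z = 1] assms
  by (simp add: mon_eval_def)

end

context cring
begin

lemma poly_eval_uminus:
  assumes "\<And>v. c v \<in> carrier R"
  shows "poly_eval R c (- P) = \<ominus> poly_eval R c P"
proof -
  have "poly_eval R c (- P) \<oplus> poly_eval R c P = \<zero>"
    using poly_eval_add[OF assms, where P = "- P" and Q = P] by simp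
  then show ?thesis using assms by (metis minus_equality poly_eval_closed)
qed

lemma poly_eval_power:
  assumes "\<And>v. c v \<in> carrier R"
  shows "poly_eval R c (P ^ i) = poly_eval R c P [^] i"
  by (induction i)
    (simp_all add: poly_eval_one poly_eval_mult assms poly_eval_closed power_Suc2 del: power_Suc)

lemma poly_eval_of_nat:
  assumes "\<And>v. c v \<in> carrier R"
  shows "poly_eval R c (of_nat i) = add_pow R i \<one>"
  using assms by (induction i) (simp_all add: poly_eval_one poly_eval_add add.m_comm)

end

text \<open>A type-class ring in the shape of a ring record: substitution of polynomials becomes a
  case of \<open>poly_eval\<close> and inherits its laws.\<close>

definition class_ring :: "'r::comm_ring_1 ring" where
  "class_ring = \<lparr>carrier = UNIV, monoid.mult = (*), one = 1, ring.zero = 0, ring.add = (+)\<rparr>"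

lemma class_ring_simps [simp]:
  "carrier class_ring = UNIV" "x \<otimes>\<^bsub>class_ring\<^esub> y = x * y" "\<one>\<^bsub>class_ring\<^esub> = 1"
  "\<zero>\<^bsub>class_ring\<^esub> = 0" "x \<oplus>\<^bsub>class_ring\<^esub> y = x + y"
  by (simp_all add: class_ring_def)

interpretation class_ring: cring "class_ring :: 'r::comm_ring_1 ring"
proof (rule cringI)
  show "abelian_group (class_ring :: 'r ring)"
  proof (rule abelian_groupI)
    fix x :: 'r assume "x \<in> carrier class_ring"
    show "\<exists>y\<in>carrier class_ring. y \<oplus>\<^bsub>class_ring\<^esub> x = \<zero>\<^bsub>class_ring\<^esub>"
      by (rule bexI[of _ "- x"]) simp_all
  qed (simp_all add: add.assoc add.commute)
  show "comm_monoid (class_ring :: 'r ring)"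
  proof (rule comm_monoidI)
    fix x y z :: 'r
    show "x \<otimes>\<^bsub>class_ring\<^esub> y \<otimes>\<^bsub>class_ring\<^esub> z = x \<otimes>\<^bsub>class_ring\<^esub> (y \<otimes>\<^bsub>class_ring\<^esub> z)"
      by (simp add: Groups.mult.assoc)
    show "x \<otimes>\<^bsub>class_ring\<^esub> y = y \<otimes>\<^bsub>class_ring\<^esub> x"
      by (simp add: Groups.mult.commute)
  qed simp_all
qed (simp add: distrib_right)

abbreviation poly_subst :: "('v \<Rightarrow> 'r::comm_ring_1) \<Rightarrow> 'v int_poly \<Rightarrow> 'r" where
  "poly_subst \<equiv> poly_eval class_ring"

lemma poly_subst_simps [simp]:
  "poly_subst c (P + Q) = poly_subst c P + poly_subst c Q"
  "poly_subst c (P * Q) = poly_subst c P * poly_subst c Q"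
  "poly_subst c 1 = 1" "poly_subst c 0 = 0"
  "poly_subst c (poly_var v) = c v"
  by (simp_all add: class_ring.poly_eval_add class_ring.poly_eval_mult class_ring.poly_eval_one
      class_ring.poly_eval_var)

lemma poly_subst_uminus [simp]: "poly_subst c (- P) = - poly_subst c P"
  using poly_subst_simps(1)[of c "- P" P] by (simp add: eq_neg_iff_add_eq_0)

lemma poly_subst_diff [simp]: "poly_subst c (P - Q) = poly_subst c P - poly_subst c Q"
  using poly_subst_simps(1)[of c P "- Q"] by simp

lemma poly_subst_of_nat [simp]: "poly_subst c (of_nat i) = of_nat i"
  by (induction i) auto

lemma poly_subst_power [simp]: "poly_subst c (P ^ i) = poly_subst c P ^ i"
  by (induction i) auto

lemma poly_subst_sum [simp]: "poly_subst c (sum f A) = (\<Sum>x\<in>A. poly_subst c (f x))"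
  by (induction A rule: infinite_finite_induct) auto

lemma (in cring) poly_eval_subst:
  assumes "\<And>v. c v \<in> carrier R"
  shows "poly_eval R c (poly_subst d Q) = poly_eval R (\<lambda>v. poly_eval R c (d v)) Q"
  by (induction Q rule: int_poly_induct)
    (simp_all add: poly_eval_one poly_eval_var poly_eval_add poly_eval_mult poly_eval_uminus
      poly_eval_closed assms)

section \<open>Congruences modulo powers of p and ghost components\<close>

lemma power_prime_cong:
  fixes x y :: "'r::comm_ring_1"
  assumes "of_nat (p ^ Suc i) dvd x - y"
  shows "of_nat (p ^ Suc (Suc i)) dvd x ^ p - y ^ p"
proof -
  have p: "of_nat p dvd x - y" using assms by (auto intro: dvd_trans[of _ "of_nat (p ^ Suc i)"])
  have pow: "of_nat p dvd x ^ j - y ^ j" for j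
    using p by (simp add: power_diff_sumr2)
  \<comment> \<open>Replacing each \<open>x ^ j\<close> by \<open>y ^ j\<close> changes the sum by a
    multiple of \<open>p\<close> and leaves \<open>p\<close> equal terms. The cofactor of
    \<open>x - y\<close> in \<open>x ^ p - y ^ p\<close> thus contributes one more factor
    \<open>p\<close>.\<close>
  have "(\<Sum>j<p. y ^ (p - Suc j) * x ^ j) = (\<Sum>j<p. y ^ (p - Suc j) * (x ^ j - y ^ j)) + of_nat p * y ^ (p - 1)"
  proof -
    have "(\<Sum>j<p. y ^ (p - Suc j) * y ^ j) = (\<Sum>j<p. y ^ (p - 1))"
      by (intro sum.cong) (auto simp flip: power_add)
    then show ?thesis by (simp add: right_diff_distrib sum_subtractf)
  qed
  moreover have "of_nat p dvd (\<Sum>j<p. y ^ (p - Suc j) * (x ^ j - y ^ j))"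
    using pow by (intro dvd_sum) auto
  ultimately have "of_nat p dvd (\<Sum>j<p. y ^ (p - Suc j) * x ^ j)" by simp
  then have "of_nat (p ^ Suc i) * of_nat p dvd (x - y) * (\<Sum>j<p. y ^ (p - Suc j) * x ^ j)"
    using assms by (rule mult_dvd_mono[rotated])
  then show ?thesis by (simp add: power_diff_sumr2 mult_ac)
qed

lemma power_prime_power_cong:
  fixes x y :: "'r::comm_ring_1"
  assumes "of_nat p dvd x - y"
  shows "of_nat (p ^ Suc i) dvd x ^ (p ^ i) - y ^ (p ^ i)"
proof (induction i)
  case (Suc i)
  then show ?case using power_prime_cong[OF Suc] by (simp add: power_mult[symmetric] mult.commute)
qed (use assms in simp)

lemma of_nat_dvd_of_nat: "m dvd n \<Longrightarrow> (of_nat m :: 'r::comm_semiring_1) dvd of_nat n"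
  by (auto elim!: dvdE)

lemma freshmans_dream_dvd:
  fixes x y :: "'r::comm_ring_1"
  assumes "Factorial_Ring.prime p"
  shows "of_nat p dvd (x + y) ^ p - (x ^ p + y ^ p)"
proof -
  have p0: "p > 0" using assms prime_gt_0_nat by blast
  have "{..p} = insert 0 (insert p {0<..<p})" using p0 by auto
  then have "(x + y) ^ p = x ^ p + y ^ p + (\<Sum>j\<in>{0<..<p}. of_nat (p choose j) * x ^ j * y ^ (p - j))"
    using p0 by (simp add: binomial_ring add.commute add.left_commute)
  moreover have "of_nat p dvd (\<Sum>j\<in>{0<..<p}. of_nat (p choose j) * x ^ j * y ^ (p - j))"
    using assms by (intro dvd_sum dvd_mult2) (auto intro!: of_nat_dvd_of_nat dvd_choose_prime simp: assms)
  ultimately show ?thesis by simp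
qed


definition frobenius_lift :: "nat \<Rightarrow> 'v int_poly \<Rightarrow> 'v int_poly" where
  "frobenius_lift p = poly_subst (\<lambda>v. poly_var v ^ p)"

text \<open>Modulo \<open>p\<close> both sides are additive and multiplicative, and they agree on
  the variables.\<close>

lemma frobenius_lift_cong:
  fixes P :: "'v int_poly"
  assumes "Factorial_Ring.prime p"
  shows "of_nat p dvd frobenius_lift p P - P ^ p"
proof (induction P rule: int_poly_induct)
  case (add x y)
  have "of_nat p dvd (frobenius_lift p x - x ^ p) + (frobenius_lift p y - y ^ p)
      - ((x + y) ^ p - (x ^ p + y ^ p))"
    using add freshmans_dream_dvd[OF assms, of x y] by (blast intro: dvd_add dvd_diff)
  then show ?case by (simp add: frobenius_lift_def algebra_simps)
next
  case (uminus x)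
  \<comment> \<open>The binomial congruence for \<open>- x + x = 0\<close> gives the sign rule for
    \<open>p\<close>-th powers, for odd \<open>p\<close> and for \<open>p = 2\<close> alike.\<close>
  have "of_nat p dvd (0::'v int_poly) ^ p - ((- x) ^ p + x ^ p)"
    using freshmans_dream_dvd[OF assms, of "- x" x] by simp
  then have "of_nat p dvd - (frobenius_lift p x - x ^ p) + (0 ^ p - ((- x) ^ p + x ^ p))"
    using uminus by (intro dvd_add) (auto simp only: dvd_minus_iff)
  moreover have "(0::'v int_poly) ^ p = 0" using prime_gt_0_nat[OF assms] by (cases p) simp_all
  moreover have "frobenius_lift p (- x) - (- x) ^ p
      = - (frobenius_lift p x - x ^ p) + (0 - ((- x) ^ p + x ^ p))"
    by (simp add: frobenius_lift_def)
  ultimately show ?case by simp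
next
  case (mult x y)
  have "of_nat p dvd (frobenius_lift p x - x ^ p) * frobenius_lift p y + x ^ p * (frobenius_lift p y - y ^ p)"
    by (rule dvd_add[OF dvd_mult2[OF mult(1)] dvd_mult[OF mult(2)]])
  then show ?case by (simp add: frobenius_lift_def algebra_simps power_mult_distrib)
qed (simp_all add: frobenius_lift_def)

lemma of_nat_mult_cancel_poly_mapping:
  fixes x y :: "'m::comm_monoid_add \<Rightarrow>\<^sub>0 int"
  assumes "of_nat n * x = of_nat n * y" "n > 0"
  shows "x = y"
proof (rule poly_mapping_eqI)
  have *: "of_nat n * z = (Poly_Mapping.map ((*) (int n)) z)" for z :: "'m \<Rightarrow>\<^sub>0 int"
    by (induction n) (auto intro!: poly_mapping_eqI simp: algebra_simps lookup_add Poly_Mapping.map.rep_eq when_def)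
  fix k
  have "Poly_Mapping.lookup (of_nat n * x) k = Poly_Mapping.lookup (of_nat n * y) k" using assms by simp
  then show "Poly_Mapping.lookup x k = Poly_Mapping.lookup y k"
    using \<open>n > 0\<close> by (auto simp: * Poly_Mapping.map.rep_eq when_def split: if_splits)
qed

lemma ghost_Suc:
  "ghost p (Suc n) Z = (\<Sum>i\<le>n. of_nat (p ^ i) * (Z i ^ p) ^ (p ^ (n - i))) + of_nat (p ^ Suc n) * Z (Suc n)"
  by (simp add: ghost_def Suc_diff_le power_mult[symmetric])

text \<open>If the components below \<open>n\<close> agree modulo \<open>p\<close>, their terms in
  the ghost sum agree modulo \<open>p ^ (n + 1)\<close>. What remains is
  \<open>p ^ n * (Y n - Z n)\<close>, and \<open>p ^ n\<close> cancels since integer polynomials are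
  torsion-free.\<close>

lemma ghost_cong_imp_cong:
  assumes "p > 0" and "\<And>n. of_nat (p ^ Suc n) dvd ghost p n Y - ghost p n Z"
  shows "of_nat p dvd Y n - Z n"
proof (induction n rule: less_induct)
  case (less n)
  have "of_nat (p ^ Suc n) dvd (\<Sum>i<n. of_nat (p ^ i) * (Y i ^ (p ^ (n - i)) - Z i ^ (p ^ (n - i))))"
  proof (intro dvd_sum)
    fix i assume i: "i \<in> {..<n}"
    then have "of_nat (p ^ i) * of_nat (p ^ Suc (n - i)) dvd of_nat (p ^ i) * (Y i ^ (p ^ (n - i)) - Z i ^ (p ^ (n - i)))"
      by (intro mult_dvd_mono power_prime_power_cong less) auto
    moreover have "p ^ i * p ^ Suc (n - i) = p ^ Suc n" using i by (simp flip: power_add)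
    ultimately show "of_nat (p ^ Suc n) dvd of_nat (p ^ i) * (Y i ^ (p ^ (n - i)) - Z i ^ (p ^ (n - i)))"
      by (metis of_nat_mult)
  qed
  moreover have "ghost p n Y - ghost p n Z
     = (\<Sum>i<n. of_nat (p ^ i) * (Y i ^ (p ^ (n - i)) - Z i ^ (p ^ (n - i)))) + of_nat (p ^ n) * (Y n - Z n)"
    unfolding ghost_def by (simp add: lessThan_Suc_atMost[symmetric] right_diff_distrib sum_subtractf)
  ultimately have "of_nat (p ^ Suc n) dvd of_nat (p ^ n) * (Y n - Z n)"
    using assms(2)[of n] by (simp only: dvd_add_right_iff)
  then obtain d where "of_nat (p ^ n) * (Y n - Z n) = of_nat (p ^ Suc n) * d" by (auto elim: dvdE)
  then have "of_nat (p ^ n) * (Y n - Z n) = of_nat (p ^ n) * (of_nat p * d)" by (simp add: mult_ac)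
  then show ?case using assms(1) of_nat_mult_cancel_poly_mapping by (metis dvd_triv_left zero_less_power)
qed

lemma ghost_inject:
  assumes "p > 0" and "\<And>n. ghost p n Y = ghost p n Z"
  shows "Y = Z"
proof
  fix n show "Y n = Z n"
  proof (induction n rule: less_induct)
    case (less n)
    have "(\<Sum>i<n. of_nat (p ^ i) * Y i ^ (p ^ (n - i))) = (\<Sum>i<n. of_nat (p ^ i) * Z i ^ (p ^ (n - i)))"
      by (intro sum.cong) (auto simp: less)
    then have "of_nat (p ^ n) * Y n = of_nat (p ^ n) * Z n"
      using assms(2)[of n] by (simp add: ghost_def lessThan_Suc_atMost[symmetric])
    then show ?case using assms(1) of_nat_mult_cancel_poly_mapping by (metis zero_less_power)
  qed
qed

text \<open>Dwork's criterion. The components of \<open>S\<close> are solved for recursively; the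
  hypothesis on \<open>w\<close>, combined with the congruence for the Frobenius lift, is the
  divisibility that the recursion needs.\<close>

lemma ghost_surj:
  assumes p: "Factorial_Ring.prime p"
    and w: "\<And>n. of_nat (p ^ Suc n) dvd w (Suc n) - frobenius_lift p (w n)"
  shows "\<exists>S. \<forall>n. ghost p n S = w n"
proof -
  let ?Q = "\<lambda>f n s. of_nat (p ^ n) * s = w n - (\<Sum>i<n. of_nat (p ^ i) * f i ^ (p ^ (n - i)))"
  have ghostI: "ghost p n f = w n" if "?Q f n (f n)" for f n
    using that by (simp add: ghost_def lessThan_Suc_atMost[symmetric])
  have "\<exists>f. \<forall>n. ?Q f n (f n)"
  proof (rule dependent_wellorder_choice)
    fix n f assume IH: "\<And>m. m < n \<Longrightarrow> ?Q f m (f m)"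
    show "\<exists>s. ?Q f n s"
    proof (cases n)
      case (Suc m)
      have "of_nat (p ^ Suc m) dvd (\<Sum>i\<le>m. of_nat (p ^ i) * (frobenius_lift p (f i) ^ (p ^ (m - i)) - (f i ^ p) ^ (p ^ (m - i))))"
      proof (intro dvd_sum)
        fix i assume i: "i \<in> {..m}"
        then have "of_nat (p ^ i) * of_nat (p ^ Suc (m - i)) dvd
            of_nat (p ^ i) * (frobenius_lift p (f i) ^ (p ^ (m - i)) - (f i ^ p) ^ (p ^ (m - i)))"
          by (intro mult_dvd_mono power_prime_power_cong frobenius_lift_cong p) auto
        moreover have "p ^ i * p ^ Suc (m - i) = p ^ Suc m" using i by (simp flip: power_add)
        ultimately show "of_nat (p ^ Suc m) dvd of_nat (p ^ i) * (frobenius_lift p (f i) ^ (p ^ (m - i)) - (f i ^ p) ^ (p ^ (m - i)))"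
          by (metis of_nat_mult)
      qed
      moreover have "(\<Sum>i\<le>m. of_nat (p ^ i) * frobenius_lift p (f i) ^ (p ^ (m - i))) = frobenius_lift p (ghost p m f)"
        by (simp add: ghost_def frobenius_lift_def flip: of_nat_power)
      ultimately have "of_nat (p ^ Suc m) dvd frobenius_lift p (w m) - (\<Sum>i<n. of_nat (p ^ i) * f i ^ (p ^ (n - i)))"
        using ghostI[OF IH, of m] Suc
        by (simp add: right_diff_distrib sum_subtractf lessThan_Suc_atMost Suc_diff_le power_mult[symmetric])
      from dvd_add[OF w[of m] this] have "of_nat (p ^ Suc m) dvd w n - (\<Sum>i<n. of_nat (p ^ i) * f i ^ (p ^ (n - i)))"
        unfolding Suc by (simp only: diff_add_cancel add_diff_eq diff_add_eq)
      then obtain d where "w n - (\<Sum>i<n. of_nat (p ^ i) * f i ^ (p ^ (n - i))) = of_nat (p ^ Suc m) * d"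
        by (rule dvdE)
      then have "?Q f n d" by (simp only: Suc)
      then show ?thesis by (rule exI)
    qed simp
  qed auto
  then show ?thesis using ghostI by blast
qed

lemma ghost_subst: "poly_subst c (ghost p n Z) = (\<Sum>i\<le>n. of_nat (p ^ i) * poly_subst c (Z i) ^ (p ^ (n - i)))"
  by (simp add: ghost_def flip: of_nat_power)

text \<open>Justifies the definite description: the ghost components of the variables satisfy
  Dwork's criterion, which is stable under sums, and \<open>ghost_inject\<close> gives
  uniqueness.\<close>

lemma ghost_witt_sum_poly:
  assumes p: "Factorial_Ring.prime p"
  shows "ghost p n (witt_sum_poly p) =
    ghost p n (\<lambda>i. poly_var (Inl i)) + ghost p n (\<lambda>i. poly_var (Inr i))"
proof -
  have "of_nat (p ^ Suc n) dvd ghost p (Suc n) (\<lambda>i. poly_var (g i)) - frobenius_lift p (ghost p n (\<lambda>i. poly_var (g i)))"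
    for g :: "nat \<Rightarrow> nat + nat" and n
    unfolding ghost_Suc frobenius_lift_def ghost_subst by simp
  from dvd_add[OF this this] have "\<exists>S. \<forall>n. ghost p n S =
      ghost p n (\<lambda>i. poly_var (Inl i)) + ghost p n (\<lambda>i. poly_var (Inr i))"
    by (intro ghost_surj p) (simp add: frobenius_lift_def algebra_simps)
  then have "\<exists>!S. \<forall>n. ghost p n S =
      ghost p n (\<lambda>i. witt_var (Inl i)) + ghost p n (\<lambda>i. witt_var (Inr i))"
    unfolding witt_var_def poly_var_def by (metis ghost_inject p prime_gt_0_nat)
  from theI'[OF this] show ?thesis
    unfolding witt_sum_poly_def witt_var_def poly_var_def by blast
qed


section \<open>Finite fields and multiplication by p on Witt vectors\<close>

lemma finite_field_char_prime:
  assumes "field k" "finite (carrier k)" "has_char k p"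
  shows "Factorial_Ring.prime p"
proof -
  interpret field k by fact
  have char: "add_pow k n \<one>\<^bsub>k\<^esub> = \<zero>\<^bsub>k\<^esub> \<longleftrightarrow> p dvd n" for n :: nat
    using assms(3) by (simp add: has_char_def)
  have "p \<noteq> 0"
  proof
    assume "p = 0"
    have "inj (\<lambda>n::nat. add_pow k n \<one>\<^bsub>k\<^esub>)"
    proof (rule linorder_injI)
      fix m n :: nat assume mn: "m < n"
      have "add_pow k n \<one>\<^bsub>k\<^esub> = add_pow k m \<one>\<^bsub>k\<^esub> \<oplus>\<^bsub>k\<^esub> add_pow k (n - m) \<one>\<^bsub>k\<^esub>"
        using mn by (simp add: add.nat_pow_mult)
      moreover have "add_pow k (n - m) \<one>\<^bsub>k\<^esub> \<noteq> \<zero>\<^bsub>k\<^esub>" using char[of "n - m"] mn \<open>p = 0\<close> by simp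
      ultimately show "add_pow k m \<one>\<^bsub>k\<^esub> \<noteq> add_pow k n \<one>\<^bsub>k\<^esub>"
        by (metis add.nat_pow_closed add.l_cancel_one' one_closed)
    qed
    moreover have "finite (range (\<lambda>n::nat. add_pow k n \<one>\<^bsub>k\<^esub>))"
      by (rule finite_subset[OF _ assms(2)]) auto
    ultimately show False using finite_imageD by blast
  qed
  moreover have "p \<noteq> 1" using char[of 1] by auto
  moreover have "p dvd a \<or> p dvd b" if "p dvd a * b" for a b
  proof -
    have "add_pow k a \<one>\<^bsub>k\<^esub> \<otimes>\<^bsub>k\<^esub> add_pow k b \<one>\<^bsub>k\<^esub> = add_pow k (a * b) \<one>\<^bsub>k\<^esub>"
      by (simp add: add_pow_ldistr add.nat_pow_pow mult.commute)
    then show ?thesis using that char[of "a * b"] char[of a] char[of b] integral by (metis add.nat_pow_closed one_closed)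
  qed
  ultimately show ?thesis by (auto intro!: Factorial_Ring.primeI Factorial_Ring.prime_elemI)
qed

lemma add_pow_closed_char:
  assumes "cring k" "has_char k p" "x \<in> carrier k"
  shows "add_pow k p x = \<zero>\<^bsub>k\<^esub>"
proof -
  interpret cring k by fact
  have "add_pow k p x = add_pow k p \<one>\<^bsub>k\<^esub> \<otimes>\<^bsub>k\<^esub> x"
    using assms(3) by (simp add: add_pow_ldistr)
  moreover have "add_pow k p \<one>\<^bsub>k\<^esub> = \<zero>\<^bsub>k\<^esub>" using assms(2) by (simp add: has_char_def)
  ultimately show ?thesis using assms(3) by simp
qed

lemma poly_eval_cong_char:
  assumes "cring k" "has_char k p" "\<And>v. c v \<in> carrier k" "of_nat p dvd P - Q"
  shows "poly_eval k c P = poly_eval k c Q"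
proof -
  interpret cring k by fact
  obtain d where "P - Q = of_nat p * d" using assms(4) by (rule dvdE)
  then have "P = Q + of_nat p * d" by (simp add: algebra_simps)
  then have "poly_eval k c P = poly_eval k c Q \<oplus>\<^bsub>k\<^esub> poly_eval k c (of_nat p) \<otimes>\<^bsub>k\<^esub> poly_eval k c d"
    using assms(3) by (simp add: poly_eval_add poly_eval_mult)
  then show ?thesis
    using assms add_pow_closed_char[OF assms(1,2) one_closed]
    by (simp add: poly_eval_of_nat poly_eval_closed)
qed

lemma finite_field_frobenius_surj:
  assumes "field k" "finite (carrier k)" "has_char k p" "x \<in> carrier k"
  shows "\<exists>y\<in>carrier k. y [^]\<^bsub>k\<^esub> p = x"
proof -
  interpret field k by fact
  have p: "Factorial_Ring.prime p" using finite_field_char_prime assms by blast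
  have "inj_on (\<lambda>y. y [^]\<^bsub>k\<^esub> p) (carrier k)"
  proof (rule inj_onI)
    fix x y assume xy: "x \<in> carrier k" "y \<in> carrier k" "x [^]\<^bsub>k\<^esub> p = y [^]\<^bsub>k\<^esub> p"
    \<comment> \<open>The binomial congruence is available in type-class rings. Evaluating
      polynomials in two variables indexed by \<open>bool\<close> carries it over to
      \<open>k\<close>.\<close>
    define c where "c b = (if b then x else y)" for b :: bool
    have c: "c v \<in> carrier k" for v using xy by (simp add: c_def)
    have "poly_eval k c (((poly_var True - poly_var False) + poly_var False) ^ p)
        = poly_eval k c ((poly_var True - poly_var False) ^ p + poly_var False ^ p)"
      by (intro poly_eval_cong_char[OF cring_axioms assms(3) c] freshmans_dream_dvd p)
    then have "x [^]\<^bsub>k\<^esub> p = poly_eval k c (poly_var True - poly_var False) [^]\<^bsub>k\<^esub> p \<oplus>\<^bsub>k\<^esub> y [^]\<^bsub>k\<^esub> p"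
      using c by (simp add: poly_eval_add poly_eval_power poly_eval_var) (simp add: c_def)
    moreover have e: "poly_eval k c (poly_var True - poly_var False) = x \<ominus>\<^bsub>k\<^esub> y"
      using c poly_eval_add[OF c, where P = "poly_var True" and Q = "- poly_var False"]
      by (simp add: poly_eval_uminus poly_eval_var a_minus_def) (simp add: c_def)
    ultimately have "(x \<ominus>\<^bsub>k\<^esub> y) [^]\<^bsub>k\<^esub> p = \<zero>\<^bsub>k\<^esub>"
      using xy add.r_cancel_one'[of "y [^]\<^bsub>k\<^esub> p" "(x \<ominus>\<^bsub>k\<^esub> y) [^]\<^bsub>k\<^esub> p"] by simp
    moreover have "z = \<zero>\<^bsub>k\<^esub>" if "z \<in> carrier k" "z [^]\<^bsub>k\<^esub> i = \<zero>\<^bsub>k\<^esub>" for z and i :: nat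
      using that by (induction i) (auto simp: integral_iff)
    ultimately have "x \<ominus>\<^bsub>k\<^esub> y = \<zero>\<^bsub>k\<^esub>" using xy by blast
    then show "x = y" using xy by simp
  qed
  then have "(\<lambda>y. y [^]\<^bsub>k\<^esub> p) ` carrier k = carrier k"
    using assms(2) by (intro endo_inj_surj) auto
  then show ?thesis using assms(4) by (metis imageE)
qed

lemma eval_witt_poly_eq: "eval_witt_poly k a b = poly_eval k (case_sum a b)"
  by (simp add: eval_witt_poly_def poly_eval_def mon_eval_def fun_eq_iff)

text \<open>Multiplication by \<open>p\<close> on Witt vectors over a field of characteristic \<open>p\<close> is the shift
  composed with the Frobenius, so over a perfect field the vectors with vanishing first component
  are the multiples of \<open>p\<close>.\<close>

lemma witt_hom_multiple_of_char:
  fixes k :: "'k ring"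
  assumes k: "field k" "finite (carrier k)" "has_char k p"
    and A: "cring A" and h: "h \<in> Ring.ring_hom (witt_ring p k) A"
    and x: "x \<in> carrier (witt_ring p k)" "x 0 = \<zero>\<^bsub>k\<^esub>"
  shows "\<exists>b\<in>carrier (witt_ring p k). h x = add_pow A p (h b)"
proof -
  interpret k: field k by fact
  interpret A: cring A by fact
  have p: "Factorial_Ring.prime p" using finite_field_char_prime k by blast
  have "\<exists>y\<in>carrier k. y [^]\<^bsub>k\<^esub> p = x (Suc i)" for i
    using finite_field_frobenius_surj[OF k] x(1) by (auto simp: witt_ring_def)
  then obtain b where b: "\<And>i. b i \<in> carrier k" "\<And>i. b i [^]\<^bsub>k\<^esub> p = x (Suc i)" by metis
  have c: "case_sum b b v \<in> carrier k" for v using b by (cases v) auto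
  define vx where "vx i = (poly_var (Inl i) :: witt_poly)" for i
  define S where "S = witt_sum_poly p"
  \<comment> \<open>\<open>T j\<close> is the universal vector of polynomials for the sum of
    \<open>j + 1\<close> copies of one Witt vector; its ghost components are therefore
    \<open>j + 1\<close> times those of \<open>vx\<close>.\<close>
  define T where "T = rec_nat vx (\<lambda>_ U i. poly_subst (case_sum U vx) (S i))"
  have T_Suc: "T (Suc j) = (\<lambda>i. poly_subst (case_sum (T j) vx) (S i))" and T_0: "T 0 = vx" for j
    by (simp_all add: T_def)
  have ghost_T: "ghost p n (T j) = of_nat (Suc j) * ghost p n vx" for n j
  proof (induction j)
    case (Suc j)
    have "ghost p n (T (Suc j)) = poly_subst (case_sum (T j) vx) (ghost p n S)"
      by (simp add: ghost_subst T_Suc ghost_def)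
    also have "\<dots> = ghost p n (T j) + ghost p n vx"
      by (simp add: S_def ghost_witt_sum_poly[OF p] ghost_subst) (simp add: ghost_def)
    finally show ?case using Suc by (simp add: algebra_simps)
  qed (simp add: T_0)
  define t where "t j i = poly_eval k (case_sum b b) (T j i)" for i j
  have t_closed: "t j i \<in> carrier k" for i j
    unfolding t_def by (intro k.poly_eval_closed c)
  have t_W: "t j \<in> carrier (witt_ring p k)" for j
    using t_closed by (simp add: witt_ring_def)
  have b_W: "b \<in> carrier (witt_ring p k)" using b by (simp add: witt_ring_def)
  have h_t: "h (t j) = add_pow A (Suc j) (h b)" for j
  proof (induction j)
    case 0
    have "t 0 = b" using c by (auto simp: t_def T_0 vx_def k.poly_eval_var)
    then show ?case using h b_W by (simp add: ring_hom_closed)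
  next
    case (Suc j)
    have "t (Suc j) = t j \<oplus>\<^bsub>witt_ring p k\<^esub> b"
    proof
      fix i
      have "(\<lambda>v. poly_eval k (case_sum b b) (case_sum (T j) vx v)) = case_sum (t j) b"
      proof
        fix v show "poly_eval k (case_sum b b) (case_sum (T j) vx v) = case_sum (t j) b v"
          using c by (cases v) (simp_all add: t_def vx_def k.poly_eval_var)
      qed
      then show "t (Suc j) i = (t j \<oplus>\<^bsub>witt_ring p k\<^esub> b) i"
        using c by (simp add: t_def[of "Suc j"] T_Suc k.poly_eval_subst witt_ring_def eval_witt_poly_eq S_def)
    qed
    then have "h (t (Suc j)) = h (t j) \<oplus>\<^bsub>A\<^esub> h b"
      using ring_hom_add[OF h t_W b_W] by simp
    then show ?case using Suc by simp
  qed
  \<comment> \<open>Frobenius followed by the shift. Its ghost components differ from those of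
    \<open>T (p - 1)\<close> by \<open>p ^ (n + 1)\<close> times a variable, so the two vectors
    agree modulo \<open>p\<close>, that is, after evaluation in \<open>k\<close>.\<close>
  define Z where "Z i = (case i of 0 \<Rightarrow> 0 | Suc i \<Rightarrow> vx i ^ p)" for i
  have "ghost p n Z = of_nat p * ghost p n vx - of_nat (p ^ Suc n) * vx n" for n
  proof (cases n)
    case (Suc m)
    have "p * p ^ m = Suc (p * p ^ m - 1)" using prime_gt_0_nat[OF p] by simp
    then have z: "(0::witt_poly) ^ (p * p ^ m) = 0" by (metis mult_zero_left power_Suc)
    have "ghost p (Suc m) Z = (\<Sum>i\<le>m. of_nat (p ^ Suc i) * (vx i ^ p) ^ p ^ (m - i))"
      unfolding ghost_def by (subst sum.atMost_Suc_shift) (simp add: Z_def z)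
    then show ?thesis unfolding Suc ghost_Suc by (simp add: sum_distrib_left algebra_simps)
  qed (simp add: ghost_def Z_def)
  moreover have "Suc (p - 1) = p" using prime_gt_0_nat[OF p] by simp
  ultimately have "of_nat (p ^ Suc n) dvd ghost p n (T (p - 1)) - ghost p n Z" for n
    using ghost_T[of n "p - 1"] by (simp only:) simp
  then have cong: "of_nat p dvd T (p - 1) n - Z n" for n
    using ghost_cong_imp_cong prime_gt_0_nat[OF p] by blast
  have "t (p - 1) = x"
  proof
    fix i
    have "t (p - 1) i = poly_eval k (case_sum b b) (Z i)"
      unfolding t_def by (rule poly_eval_cong_char[OF k.cring_axioms k(3) c cong])
    also have "\<dots> = x i"
      using c by (cases i) (simp_all add: Z_def x(2) vx_def k.poly_eval_power k.poly_eval_var b)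
    finally show "t (p - 1) i = x i" .
  qed
  then show ?thesis using h_t[of "p - 1"] \<open>Suc (p - 1) = p\<close> b_W by auto
qed

section \<open>Ideals and additive functions\<close>

definition ideal_sum :: "'r::comm_ring_1 set \<Rightarrow> 'r set \<Rightarrow> 'r set" where
  "ideal_sum A B = {x. \<exists>a\<in>A. x - a \<in> B}"

lemma subspace_mult_left: "cr.subspace I \<Longrightarrow> x \<in> I \<Longrightarrow> c * x \<in> I"
  and subspace_mult_right: "cr.subspace I \<Longrightarrow> x \<in> I \<Longrightarrow> x * c \<in> I"
  using cr.subspace_scale[of I x c] by (auto simp: mult.commute)

lemma ideal_sum_subspace:
  assumes "cr.subspace A" "cr.subspace B"
  shows "cr.subspace (ideal_sum A B)"
proof (rule cr.subspaceI)
  show "0 \<in> ideal_sum A B"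
    unfolding ideal_sum_def using assms by (auto intro!: bexI[of _ 0] simp: cr.subspace_0)
next
  fix x y assume "x \<in> ideal_sum A B" "y \<in> ideal_sum A B"
  then obtain a b where "a \<in> A" "x - a \<in> B" "b \<in> A" "y - b \<in> B" by (auto simp: ideal_sum_def)
  then have "a + b \<in> A" "(x - a) + (y - b) \<in> B" using assms by (auto intro: cr.subspace_add)
  then show "x + y \<in> ideal_sum A B"
    unfolding ideal_sum_def by (auto intro!: bexI[of _ "a + b"] simp: algebra_simps)
next
  fix c x assume "x \<in> ideal_sum A B"
  then obtain a where "a \<in> A" "x - a \<in> B" by (auto simp: ideal_sum_def)
  then have "c * a \<in> A" "c * (x - a) \<in> B" using assms by (auto intro: subspace_mult_left)
  then show "c * x \<in> ideal_sum A B"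
    unfolding ideal_sum_def by (auto intro!: bexI[of _ "c * a"] simp: algebra_simps)
qed

lemma ideal_sum_left: "cr.subspace B \<Longrightarrow> A \<subseteq> ideal_sum A B"
  unfolding ideal_sum_def using cr.subspace_0 by force

lemma ideal_sum_right: "cr.subspace A \<Longrightarrow> B \<subseteq> ideal_sum A B"
  unfolding ideal_sum_def using cr.subspace_0 by force

lemma ideal_sum_least:
  "cr.subspace C \<Longrightarrow> A \<subseteq> C \<Longrightarrow> B \<subseteq> C \<Longrightarrow> ideal_sum A B \<subseteq> C"
  unfolding ideal_sum_def using cr.subspace_add[of C] by fastforce

lemma ideal_sum_mono: "A \<subseteq> A' \<Longrightarrow> B \<subseteq> B' \<Longrightarrow> ideal_sum A B \<subseteq> ideal_sum A' B'"
  unfolding ideal_sum_def by auto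

lemma ideal_sumI: "a \<in> A \<Longrightarrow> b \<in> B \<Longrightarrow> a + b \<in> ideal_sum A B"
  unfolding ideal_sum_def by (auto intro!: bexI[of _ a])

lemma span_Un_finite_repr:
  assumes "finite F" "cr.subspace K" "x \<in> cr.span (F \<union> K)"
  shows "\<exists>c. x - (\<Sum>f\<in>F. c f * f) \<in> K"
  using assms(1,3)
proof (induction F arbitrary: x rule: finite_induct)
  case empty
  then show ?case using assms(2) by (simp add: cr.span_eq_iff[THEN iffD2])
next
  case (insert a F)
  from insert.prems obtain k where "x - k * a \<in> cr.span (F \<union> K)"
    by (auto simp: cr.span_breakdown_eq)
  then obtain c where "x - k * a - (\<Sum>f\<in>F. c f * f) \<in> K" using insert.IH by blast
  moreover have "(\<Sum>f\<in>F. (if f = a then k else c f) * f) = (\<Sum>f\<in>F. c f * f)"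
    using insert.hyps by (intro sum.cong) auto
  ultimately show ?case using insert.hyps
    by (intro exI[of _ "\<lambda>f. if f = a then k else c f"]) (simp add: algebra_simps)
qed

section \<open>Additive functions modulo an integer\<close>

definition add_subgroup :: "'r::ab_group_add set \<Rightarrow> bool" where
  "add_subgroup B \<longleftrightarrow> 0 \<in> B \<and> (\<forall>x\<in>B. \<forall>y\<in>B. x - y \<in> B)"

lemma add_subgroup_0: "add_subgroup B \<Longrightarrow> 0 \<in> B"
  and add_subgroup_diff: "add_subgroup B \<Longrightarrow> x \<in> B \<Longrightarrow> y \<in> B \<Longrightarrow> x - y \<in> B"
  by (auto simp: add_subgroup_def)

lemma add_subgroup_uminus: "add_subgroup B \<Longrightarrow> x \<in> B \<Longrightarrow> - x \<in> B"
  using add_subgroup_diff[of B 0 x] by (simp add: add_subgroup_0)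

lemma add_subgroup_add: "add_subgroup B \<Longrightarrow> x \<in> B \<Longrightarrow> y \<in> B \<Longrightarrow> x + y \<in> B"
  using add_subgroup_diff[of B x "- y"] by (simp add: add_subgroup_uminus)

lemma add_subgroup_of_nat_mult:
  "add_subgroup B \<Longrightarrow> x \<in> B \<Longrightarrow> of_nat n * (x::'r::comm_ring_1) \<in> B"
  by (induction n) (auto simp: algebra_simps intro: add_subgroup_add add_subgroup_0)

lemma add_subgroup_of_int_mult:
  "add_subgroup B \<Longrightarrow> x \<in> B \<Longrightarrow> of_int n * (x::'r::comm_ring_1) \<in> B"
  by (cases n) (auto simp del: of_nat_Suc intro: add_subgroup_of_nat_mult add_subgroup_uminus)

lemma subspace_imp_add_subgroup: "cr.subspace B \<Longrightarrow> add_subgroup B"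
  by (auto simp: add_subgroup_def cr.subspace_0 cr.subspace_diff)

text \<open>An additive map to \<open>\<int>/q\<close> is given by integer representatives of its
  values. Integers can serve as coefficients in every ring, and equality of maps becomes
  divisibility of differences.\<close>

definition additive_mod :: "int \<Rightarrow> 'r::ab_group_add set \<Rightarrow> ('r \<Rightarrow> int) \<Rightarrow> bool" where
  "additive_mod q B u \<longleftrightarrow> (\<forall>x\<in>B. \<forall>y\<in>B. q dvd u (x + y) - (u x + u y))"

lemma additive_modD: "additive_mod q B u \<Longrightarrow> x \<in> B \<Longrightarrow> y \<in> B \<Longrightarrow> q dvd u (x + y) - (u x + u y)"
  by (simp add: additive_mod_def)

lemma dvd_diff_trans: "q dvd (a - b) \<Longrightarrow> q dvd b - c \<Longrightarrow> q dvd a - (c::int)"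
  using dvd_add by fastforce

lemma dvd_diff_add_trans:
  assumes "q dvd s - (a + b)" "q dvd b - (c::int)" shows "q dvd s - (a + c)"
proof -
  have "s - (a + c) = (s - (a + b)) + (b - c)" by simp
  then show ?thesis using assms dvd_add by metis
qed

lemma dvd_diff_sym: "q dvd (a - b) \<Longrightarrow> q dvd b - (a::int)"
  using dvd_minus_iff[of q "a - b"] by simp

lemma additive_mod_0:
  assumes "additive_mod q B u" "add_subgroup B" shows "q dvd u 0"
  using additive_modD[OF assms(1), of 0 0] add_subgroup_0[OF assms(2)] by simp

lemma additive_mod_uminus:
  assumes "additive_mod q B u" "add_subgroup B" "x \<in> B" shows "q dvd u (- x) + u x"
  using dvd_diff[OF additive_mod_0[OF assms(1,2)]
      additive_modD[OF assms(1), of "- x" x, OF add_subgroup_uminus[OF assms(2,3)] assms(3)]]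
  by simp

lemma additive_mod_diff:
  assumes "additive_mod q B u" "add_subgroup B" "x \<in> B" "y \<in> B"
  shows "q dvd u (x - y) - (u x - u y)"
proof -
  have "q dvd u (x - y + y) - (u (x - y) + u y)"
    using assms by (intro additive_modD) (auto intro: add_subgroup_diff)
  then show ?thesis using dvd_diff_sym by (fastforce simp: algebra_simps)
qed

lemma additive_mod_of_nat:
  fixes x :: "'r::comm_ring_1"
  assumes "additive_mod q B u" "add_subgroup B" "x \<in> B"
  shows "q dvd u (of_nat n * x) - int n * u x"
proof (induction n)
  case 0
  then show ?case using additive_mod_0[OF assms(1,2)] by simp
next
  case (Suc n)
  have "q dvd u (x + of_nat n * x) - (u x + u (of_nat n * x))"
    using assms by (intro additive_modD) (auto intro: add_subgroup_of_nat_mult)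
  from dvd_add[OF this Suc] show ?case by (simp add: algebra_simps)
qed

lemma additive_mod_of_int:
  fixes x :: "'r::comm_ring_1"
  assumes "additive_mod q B u" "add_subgroup B" "x \<in> B"
  shows "q dvd u (of_int n * x) - n * u x"
proof (cases "n \<ge> 0")
  case True
  then show ?thesis using additive_mod_of_nat[OF assms, of "nat n"] by simp
next
  case False
  then obtain m where m: "n = - int m" by (metis int_cases2 neg_0_le_iff_le of_nat_0_le_iff linear)
  have "of_nat m * x \<in> B" using assms by (intro add_subgroup_of_nat_mult)
  from dvd_diff[OF additive_mod_uminus[OF assms(1,2) this] additive_mod_of_nat[OF assms, of m]]
  show ?thesis by (simp add: m algebra_simps)
qed

lemma additive_mod_sum:
  assumes "additive_mod q UNIV u"
  shows "q dvd u (sum f A) - (\<Sum>i\<in>A. u (f i))"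
proof (induction A rule: infinite_finite_induct)
  case (insert x F)
  from insert(1,2) dvd_add[OF additive_modD[OF assms, of "f x" "sum f F"] insert(3)] show ?case
    by (simp add: algebra_simps)
qed (use additive_mod_0[OF assms] in \<open>auto simp: add_subgroup_def\<close>)

text \<open>Self-injectivity of \<open>\<int>/q\<close>. The group generated by \<open>B\<close> and the finite set \<open>F\<close> is the whole
  ring, which replaces the assumption that \<open>B\<close> has finite index.\<close>

lemma additive_mod_extend:
  fixes B :: "'r::comm_ring_1 set" and q :: nat
  assumes q: "q > 0" and B: "add_subgroup B" and qB: "\<And>x. of_nat q * x \<in> B"
    and b: "additive_mod q B b" and b0: "\<And>x. int q dvd b (of_nat q * x)"
    and F: "finite F" "\<And>G. add_subgroup G \<Longrightarrow> B \<union> F \<subseteq> G \<Longrightarrow> G = UNIV"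
  shows "\<exists>u. additive_mod q UNIV u \<and> (\<forall>x\<in>B. int q dvd u x - b x)"
proof -
  have "\<exists>G u. add_subgroup G \<and> B \<union> F \<subseteq> G \<and> additive_mod q G u \<and> (\<forall>x\<in>B. int q dvd u x - b x)"
    using F(1)
  proof (induction F rule: finite_induct)
    case empty
    then show ?case using B b by (intro exI[of _ B] exI[of _ b]) auto
  next
    case (insert v F)
    then obtain G u where G: "add_subgroup G" "B \<union> F \<subseteq> G" and u: "additive_mod q G u"
      and ub: "\<And>x. x \<in> B \<Longrightarrow> int q dvd u x - b x" by auto
    \<comment> \<open>The order of \<open>v\<close> modulo \<open>G\<close>; it divides
      \<open>q\<close>.\<close>
    define n where "n = (LEAST n. n > 0 \<and> of_nat n * v \<in> G)"
    have "q > 0 \<and> of_nat q * v \<in> G" using q qB G by auto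
    then have n: "n > 0" "of_nat n * v \<in> G" unfolding n_def by (metis (mono_tags, lifting) LeastI)+
    have least: "\<not> (0 < j \<and> of_nat j * v \<in> G)" if "j < n" for j
      using that unfolding n_def by (rule not_less_Least)
    have n_dvd: "int n dvd m" if "of_int m * v \<in> G" for m
    proof -
      have "m = int n * (m div int n) + m mod int n" by simp
      then have "(of_int m :: 'r) = of_nat n * of_int (m div int n) + of_int (m mod int n)"
        by (metis of_int_add of_int_mult of_int_of_nat_eq)
      then have "of_int (m mod int n) * v = of_int m * v - of_int (m div int n) * (of_nat n * v)"
        by (simp add: algebra_simps)
      then have "of_int (m mod int n) * v \<in> G"
        using that n G by (simp add: add_subgroup_diff add_subgroup_of_int_mult)
      moreover have "of_int (m mod int n) = (of_nat (nat (m mod int n)) :: 'r)" using n by simp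
      moreover have "nat (m mod int n) < n" using n by (simp add: nat_less_iff)
      ultimately have "nat (m mod int n) = 0"
        using least[of "nat (m mod int n)"] by (metis gr0I)
      moreover have "0 \<le> m mod int n" using n by simp
      ultimately have "m mod int n = 0" by linarith
      then show ?thesis by presburger
    qed
    have "of_int (int q) * v \<in> G" using qB[of v] G by auto
    then have "n dvd q" using n_dvd by (metis of_nat_dvd_iff)
    then obtain r where r: "q = n * r" by (rule dvdE)
    \<comment> \<open>The value \<open>w\<close> at \<open>v\<close> has to satisfy
      \<open>n * w = u (n * v)\<close>. It exists because \<open>r * u (n * v)\<close> is congruent
      to \<open>u (q * v)\<close>, hence to \<open>0\<close>, modulo
      \<open>q = n * r\<close>.\<close>
    have "of_nat r * (of_nat n * v) = of_nat q * v" by (simp add: r mult_ac)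
    then have 1: "int q dvd u (of_nat q * v) - int r * u (of_nat n * v)"
      using additive_mod_of_nat[OF u G(1) n(2), of r] by simp
    have 2: "int q dvd u (of_nat q * v)" using dvd_add[OF ub[OF qB[of v]] b0[of v]] by simp
    have "int q dvd int r * u (of_nat n * v)" using dvd_diff[OF 2 1] by simp
    then have "int r * int n dvd int r * u (of_nat n * v)" by (simp add: r mult.commute)
    then have "int n dvd u (of_nat n * v)" using q r by simp
    then obtain w where w: "u (of_nat n * v) = int n * w" by (rule dvdE)
    define G' where "G' = {x. \<exists>m. x - of_int m * v \<in> G}"
    define e where "e x = (SOME m. x - of_int m * v \<in> G)" for x
    define u' where "u' x = u (x - of_int (e x) * v) + e x * w" for x
    \<comment> \<open>Independence of the chosen multiple of \<open>v\<close>: two choices differ by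
      a multiple of \<open>n\<close>, and \<open>u (n * v) = n * w\<close>.\<close>
    have u': "int q dvd u' x - (u (x - of_int m * v) + m * w)" if "x - of_int m * v \<in> G" for x m
    proof -
      have e: "x - of_int (e x) * v \<in> G" unfolding e_def using that by (rule someI)
      have "of_int (m - e x) * v = (x - of_int (e x) * v) - (x - of_int m * v)" by (simp add: algebra_simps)
      then have "of_int (m - e x) * v \<in> G" using e that add_subgroup_diff[OF G(1)] by metis
      then have "int n dvd m - e x" by (rule n_dvd)
      then obtain t where t: "m - e x = int n * t" by (rule dvdE)
      have eq: "x - of_int (e x) * v = (x - of_int m * v) + of_int t * (of_nat n * v)"
      proof -
        have "(of_int (m - e x) :: 'r) = of_nat n * of_int t" by (simp add: t)
        then have "of_int m * v = of_int (e x) * v + of_int t * (of_nat n * v)"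
          by (simp add: algebra_simps)
        then show ?thesis by simp
      qed
      have 1: "int q dvd u ((x - of_int m * v) + of_int t * (of_nat n * v)) - (u (x - of_int m * v) + u (of_int t * (of_nat n * v)))"
        using u that n G by (intro additive_modD[OF u] add_subgroup_of_int_mult) auto
      have 2: "int q dvd u (of_int t * (of_nat n * v)) - t * (int n * w)"
        using additive_mod_of_int[OF u G(1) n(2), of t] w by simp
      have "int q dvd u (x - of_int (e x) * v) - (u (x - of_int m * v) + t * (int n * w))"
        unfolding eq by (rule dvd_diff_add_trans[OF 1 2])
      moreover have "t * (int n * w) = m * w - e x * w" using t by (metis left_diff_distrib mult.assoc mult.commute)
      ultimately have "int q dvd u (x - of_int (e x) * v) - (u (x - of_int m * v) + (m * w - e x * w))"
        by simp
      then show ?thesis unfolding u'_def by (simp only: diff_add_eq add_diff_eq diff_diff_eq2)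
    qed
    have "add_subgroup G'"
      unfolding add_subgroup_def
    proof (intro conjI ballI)
      show "0 \<in> G'" unfolding G'_def using add_subgroup_0[OF G(1)] by (auto intro: exI[of _ 0])
      fix x y assume "x \<in> G'" "y \<in> G'"
      then obtain m m' where "x - of_int m * v \<in> G" "y - of_int m' * v \<in> G" by (auto simp: G'_def)
      from add_subgroup_diff[OF G(1) this] show "x - y \<in> G'"
        unfolding G'_def by (auto intro!: exI[of _ "m - m'"] simp: algebra_simps)
    qed
    moreover have GG': "x \<in> G'" if "x \<in> G" for x
      unfolding G'_def using that by (auto intro: exI[of _ 0])
    moreover have "v \<in> G'"
      unfolding G'_def using add_subgroup_0[OF G(1)] by (auto intro: exI[of _ 1])
    moreover have "additive_mod q G' u'"
      unfolding additive_mod_def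
    proof (intro ballI)
      fix x y assume "x \<in> G'" "y \<in> G'"
      then obtain m m' where m: "x - of_int m * v \<in> G" "y - of_int m' * v \<in> G" by (auto simp: G'_def)
      have eq: "x + y - of_int (m + m') * v = (x - of_int m * v) + (y - of_int m' * v)"
        by (simp add: algebra_simps)
      have "x + y - of_int (m + m') * v \<in> G" unfolding eq by (rule add_subgroup_add[OF G(1) m])
      note 1 = u'[OF this, unfolded eq] additive_modD[OF u m] u'[OF m(1)] u'[OF m(2)]
      from dvd_diff[OF dvd_diff[OF dvd_add[OF 1(1,2)] 1(3)] 1(4)] show "int q dvd u' (x + y) - (u' x + u' y)" by (simp add: algebra_simps)
    qed
    moreover have "int q dvd u' x - b x" if "x \<in> B" for x
      using u'[of x 0] ub[OF that] that G by (auto intro: dvd_diff_trans)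
    ultimately show ?case using G by (intro exI[of _ G'] exI[of _ u']) blast
  qed
  then show ?thesis using F(2) by blast
qed

text \<open>The quotient by \<open>D\<close> is a finite vector space over the field with
  \<open>p\<close> elements; the \<open>c j\<close> generate it and the \<open>w j\<close> are
  coordinate functions. The induction moves one generator at a time from \<open>F\<close> into
  \<open>D\<close>.\<close>

lemma elementary_quotient_basis:
  fixes D :: "'r::comm_ring_1 set" and p :: nat
  assumes p: "Factorial_Ring.prime p" and D: "add_subgroup D" and pD: "\<And>x. of_nat p * x \<in> D"
    and F: "finite F" "\<And>G. add_subgroup G \<Longrightarrow> D \<union> F \<subseteq> G \<Longrightarrow> G = UNIV"
  shows "\<exists>(n::nat) c w. (\<forall>j<n. additive_mod p UNIV (w j) \<and> (\<forall>x\<in>D. int p dvd w j x)) \<and>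
      (\<forall>r. r - (\<Sum>j<n. of_int (w j r) * c j) \<in> D)"
  using F D pD
proof (induction F arbitrary: D rule: finite_induct)
  case empty
  then have "D = UNIV" by auto
  then show ?case by (intro exI[of _ 0]) auto
next
  case (insert v F)
  show ?case
  proof (cases "v \<in> D")
    case True
    show ?thesis by (rule insert.IH) (use insert.prems True in auto)
  next
    case False
    define D' where "D' = {x. \<exists>m. x - of_int m * v \<in> D}"
    have D': "add_subgroup D'"
      unfolding add_subgroup_def
    proof (intro conjI ballI)
      show "0 \<in> D'" unfolding D'_def using add_subgroup_0[OF insert.prems(2)] by (auto intro: exI[of _ 0])
      fix x y assume "x \<in> D'" "y \<in> D'"
      then obtain m m' where "x - of_int m * v \<in> D" "y - of_int m' * v \<in> D" by (auto simp: D'_def)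
      from add_subgroup_diff[OF insert.prems(2) this] show "x - y \<in> D'"
        unfolding D'_def by (auto intro!: exI[of _ "m - m'"] simp: algebra_simps)
    qed
    have DD': "D \<subseteq> D'" unfolding D'_def by (auto intro: exI[of _ 0])
    have v: "v \<in> D'" unfolding D'_def using add_subgroup_0[OF insert.prems(2)] by (auto intro!: exI[of _ 1])
    have gen: "G = UNIV" if "add_subgroup G" "D' \<union> F \<subseteq> G" for G
      using insert.prems(1)[OF that(1)] that(2) DD' v by blast
    from insert.IH[OF gen D'] insert.prems(3) DD'
    obtain n :: nat and c w where w: "\<And>j. j < n \<Longrightarrow> additive_mod p UNIV (w j)"
        "\<And>j x. j < n \<Longrightarrow> x \<in> D' \<Longrightarrow> int p dvd w j x"
      and c: "\<And>r. r - (\<Sum>j<n. of_int (w j r) * c j) \<in> D'"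
      by (metis subsetD)
    have dvd: "int p dvd m" if "of_int m * v \<in> D" for m
    proof (rule ccontr)
      assume "\<not> int p dvd m"
      then have "coprime (int p) m" using p by (simp add: prime_imp_coprime)
      then obtain a b where ab: "a * int p + b * m = 1" using bezout_int by (metis coprime_iff_gcd_eq_1)
      have "v = of_int (a * int p + b * m) * v" by (simp add: ab)
      also have "\<dots> = of_int a * (of_nat p * v) + of_int b * (of_int m * v)" by (simp add: algebra_simps)
      finally have "v \<in> D" using that insert.prems
        by (metis add_subgroup_add add_subgroup_of_int_mult)
      then show False using False by simp
    qed
    \<comment> \<open>The coordinate along \<open>v\<close> on \<open>D'\<close> modulo
      \<open>D\<close>. Its extension \<open>u\<close> to the whole ring will be the new coordinate
      function.\<close>
    define b where "b x = (SOME m. x - of_int m * v \<in> D)" for x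
    have b: "x - of_int (b x) * v \<in> D" if "x \<in> D'" for x
      using that unfolding D'_def b_def by (auto intro: someI)
    have b_eq: "int p dvd b x - m" if "x \<in> D'" "x - of_int m * v \<in> D" for x m
    proof -
      have "of_int (b x - m) * v = (x - of_int m * v) - (x - of_int (b x) * v)" by (simp add: algebra_simps)
      then show ?thesis using add_subgroup_diff[OF insert.prems(2) that(2) b[OF that(1)]] dvd by metis
    qed
    have "additive_mod p D' b"
      unfolding additive_mod_def
    proof (intro ballI)
      fix x y assume xy: "x \<in> D'" "y \<in> D'"
      have eq: "x + y - of_int (b x + b y) * v = (x - of_int (b x) * v) + (y - of_int (b y) * v)"
        by (simp add: algebra_simps)
      have "x + y - of_int (b x + b y) * v \<in> D"
        unfolding eq by (rule add_subgroup_add[OF insert.prems(2) b[OF xy(1)] b[OF xy(2)]])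
      then show "int p dvd b (x + y) - (b x + b y)"
        using b_eq add_subgroup_add[OF D' xy] by blast
    qed
    moreover have b0: "int p dvd b x" if "x \<in> D" for x
      using b_eq[of x 0] that DD' by auto
    ultimately obtain u where u: "additive_mod p UNIV u" "\<And>x. x \<in> D' \<Longrightarrow> int p dvd u x - b x"
      using additive_mod_extend[of p D' b F] gen insert.prems(3) insert.hyps D' DD' prime_gt_0_nat[OF p]
      by (metis subsetD)
    have uv: "int p dvd u v - 1"
      using dvd_add[OF u(2)[OF v] b_eq[of v 1]] v add_subgroup_0[OF insert.prems(2)] by simp
    have u0: "int p dvd u x" if "x \<in> D" for x
      using dvd_add[OF u(2)[of x] b0[OF that]] that DD' by auto
    \<comment> \<open>The old vectors are corrected by multiples of \<open>v\<close> so that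
      \<open>u\<close> vanishes on them modulo \<open>p\<close>, as \<open>u v\<close> is congruent
      to \<open>1\<close>.\<close>
    define c' where "c' j = (if j < n then c j - of_int (u (c j)) * v else v)" for j
    define w' where "w' j = (if j < n then w j else u)" for j
    have "r - (\<Sum>j<Suc n. of_int (w' j r) * c' j) \<in> D" for r
    proof -
      define r' where "r' = r - (\<Sum>j<n. of_int (w j r) * c j)"
      have r': "r' \<in> D'" unfolding r'_def by (rule c)
      define m where "m = u r - (\<Sum>j<n. w j r * u (c j))"
      have sub: "add_subgroup (UNIV :: 'r set)" by (simp add: add_subgroup_def)
      have 1: "int p dvd u (\<Sum>j<n. of_int (w j r) * c j) - (\<Sum>j<n. u (of_int (w j r) * c j))"
        by (rule additive_mod_sum[OF u(1)])
      have 2: "int p dvd (\<Sum>j<n. u (of_int (w j r) * c j) - w j r * u (c j))"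
        by (intro dvd_sum additive_mod_of_int[OF u(1) sub]) auto
      have 3: "int p dvd u r' - (u r - u (\<Sum>j<n. of_int (w j r) * c j))"
        unfolding r'_def by (rule additive_mod_diff[OF u(1) sub]) auto
      have "int p dvd u r' - m"
        using dvd_diff[OF 3 dvd_add[OF 1 2]] by (simp add: m_def sum_subtractf algebra_simps)
      then have "int p dvd m - b r'" using u(2)[OF r'] dvd_diff_trans dvd_diff_sym by blast
      then obtain t where "m - b r' = int p * t" by (rule dvdE)
      then have "m = b r' + int p * t" by simp
      then have "r' - of_int m * v = (r' - of_int (b r') * v) - of_int t * (of_nat p * v)"
        by (simp add: algebra_simps)
      then have "r' - of_int m * v \<in> D"
        using b[OF r'] insert.prems add_subgroup_diff add_subgroup_of_int_mult by metis
      moreover have "r - (\<Sum>j<Suc n. of_int (w' j r) * c' j) = r' - of_int m * v"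
        by (simp add: w'_def c'_def r'_def m_def algebra_simps sum_subtractf sum_distrib_left)
      ultimately show ?thesis by simp
    qed
    moreover have "additive_mod p UNIV (w' j) \<and> (\<forall>x\<in>D. int p dvd w' j x)" if "j < Suc n" for j
      using w u u0 DD' that by (auto simp: w'_def)
    ultimately show ?thesis by blast
  qed
qed

section \<open>Complete local rings\<close>

text \<open>A complete noetherian local ring with finite residue field, presented as the quotient of a
  commutative ring \<open>'r\<close> by the ideal \<open>K\<close>; \<open>M n\<close> is the preimage of the \<open>n\<close>-th power of the
  maximal ideal.\<close>

locale adic_ring =
  fixes M :: "nat \<Rightarrow> 'r::comm_ring_1 set" and K :: "'r set"
  assumes M_ideal: "cr.subspace (M n)"
    and K_eq: "K = (\<Inter>n. M n)"
    and M_0: "M 0 = UNIV"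
    and M_mult: "x \<in> M 1 \<Longrightarrow> y \<in> M n \<Longrightarrow> x * y \<in> M (Suc n)"
    and M_Suc_gen: "M (Suc n) \<subseteq> cr.span ({x * y |x y. x \<in> M 1 \<and> y \<in> M n} \<union> K)"
    and complete: "(\<And>n. s (Suc n) - s n \<in> M n) \<Longrightarrow> \<exists>y. \<forall>n. y - s n \<in> M n"
    and fin_gen: "cr.subspace I \<Longrightarrow> K \<subseteq> I \<Longrightarrow> \<exists>F. finite F \<and> I = cr.span (F \<union> K)"
    and residue_finite: "\<exists>F. finite F \<and> (\<forall>x. \<exists>y\<in>F. x - y \<in> M 1)"
begin

lemma K_ideal: "cr.subspace K"
  unfolding K_eq by (intro cr.subspace_Int M_ideal)

lemma K_le: "K \<subseteq> M n" by (auto simp: K_eq)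

lemma M_diff: "x \<in> M n \<Longrightarrow> y \<in> M n \<Longrightarrow> x - y \<in> M n"
  by (rule cr.subspace_diff[OF M_ideal])

lemma M_Suc_le: "M (Suc n) \<subseteq> M n"
proof -
  have "{x * y |x y. x \<in> M 1 \<and> y \<in> M n} \<union> K \<subseteq> M n"
    using subspace_mult_left[OF M_ideal] K_le by auto
  then show ?thesis using M_Suc_gen[of n] cr.span_minimal[OF _ M_ideal] by blast
qed

lemma M_antimono: "m \<le> n \<Longrightarrow> M n \<subseteq> M m"
  by (rule lift_Suc_antimono_le[of M]) (rule M_Suc_le)

text \<open>One finite set of generators of \<open>M 1\<close> serves all \<open>n\<close>: a
  product \<open>x * y\<close> generating \<open>M (Suc n)\<close> is expanded in its factor
  \<open>x\<close>, which leaves coefficients in \<open>M n\<close>.\<close>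

lemma M_Suc_repr:
  "\<exists>F. finite F \<and> (\<forall>n. \<forall>x\<in>M (Suc n). \<exists>c. (\<forall>f\<in>F. c f \<in> M n) \<and> x - (\<Sum>f\<in>F. c f * f) \<in> K) \<and> F \<subseteq> M 1"
proof -
  obtain F where F: "finite F" "M 1 = cr.span (F \<union> K)"
    using fin_gen[OF M_ideal K_le, of 1] by auto
  have "\<exists>c. (\<forall>f\<in>F. c f \<in> M n) \<and> x - (\<Sum>f\<in>F. c f * f) \<in> K" if "x \<in> M (Suc n)" for n x
  proof -
    let ?S = "{x. \<exists>c. (\<forall>f\<in>F. c f \<in> M n) \<and> x - (\<Sum>f\<in>F. c f * f) \<in> K}"
    have "cr.subspace ?S"
    proof (rule cr.subspaceI)
      show "0 \<in> ?S" by (auto intro!: exI[of _ "\<lambda>_. 0"] simp: cr.subspace_0 M_ideal K_ideal)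
    next
      fix x y assume "x \<in> ?S" "y \<in> ?S"
      then obtain c d where c: "\<And>f. f \<in> F \<Longrightarrow> c f \<in> M n" "x - (\<Sum>f\<in>F. c f * f) \<in> K"
        and d: "\<And>f. f \<in> F \<Longrightarrow> d f \<in> M n" "y - (\<Sum>f\<in>F. d f * f) \<in> K" by auto
      have "x + y - (\<Sum>f\<in>F. (c f + d f) * f) = (x - (\<Sum>f\<in>F. c f * f)) + (y - (\<Sum>f\<in>F. d f * f))"
        by (simp add: algebra_simps sum.distrib)
      then have "x + y - (\<Sum>f\<in>F. (c f + d f) * f) \<in> K" using cr.subspace_add[OF K_ideal c(2) d(2)] by metis
      then show "x + y \<in> ?S"
        using c d by (auto intro!: exI[of _ "\<lambda>f. c f + d f"] cr.subspace_add[OF M_ideal])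
    next
      fix a x assume "x \<in> ?S"
      then obtain c where c: "\<And>f. f \<in> F \<Longrightarrow> c f \<in> M n" "x - (\<Sum>f\<in>F. c f * f) \<in> K" by auto
      have "a * x - (\<Sum>f\<in>F. (a * c f) * f) = a * (x - (\<Sum>f\<in>F. c f * f))"
        by (simp add: algebra_simps sum_distrib_left)
      then have "a * x - (\<Sum>f\<in>F. (a * c f) * f) \<in> K" using subspace_mult_left[OF K_ideal c(2)] by metis
      then show "a * x \<in> ?S"
        using c by (auto intro!: exI[of _ "\<lambda>f. a * c f"] subspace_mult_left[OF M_ideal])
    qed
    moreover have "x * y \<in> ?S" if "x \<in> M 1" "y \<in> M n" for x y
    proof -
      have "x \<in> cr.span (F \<union> K)" using that(1) unfolding F(2) .
      then obtain c where "x - (\<Sum>f\<in>F. c f * f) \<in> K"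
        using span_Un_finite_repr[OF F(1) K_ideal] by blast
      then have "(x - (\<Sum>f\<in>F. c f * f)) * y \<in> K" by (rule subspace_mult_right[OF K_ideal])
      moreover have "(x - (\<Sum>f\<in>F. c f * f)) * y = x * y - (\<Sum>f\<in>F. (c f * y) * f)"
        by (simp add: algebra_simps sum_distrib_left)
      ultimately show ?thesis
        using that by (auto intro!: exI[of _ "\<lambda>f. c f * y"] subspace_mult_left[OF M_ideal])
    qed
    moreover have "K \<subseteq> ?S" by (auto intro!: exI[of _ "\<lambda>_. 0"] simp: cr.subspace_0 M_ideal)
    ultimately have "cr.span ({x * y |x y. x \<in> M 1 \<and> y \<in> M n} \<union> K) \<subseteq> ?S"
      by (intro cr.span_minimal) auto
    then show ?thesis using M_Suc_gen that by blast
  qed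
  moreover have "F \<subseteq> M 1" using F(2) cr.span_superset by blast
  ultimately show ?thesis using F(1) by blast
qed

lemma M_le_1_mult: "y \<in> M n \<Longrightarrow> x \<in> M 1 \<Longrightarrow> y * x \<in> M (Suc n)"
  using M_mult by (simp add: mult.commute)

text \<open>An element is a representative of its residue class plus a combination of generators of
  \<open>M 1\<close>, and modulo \<open>M (Suc n)\<close> the coefficients matter only modulo
  \<open>M n\<close>.\<close>

lemma finite_quotient: "\<exists>F. finite F \<and> (\<forall>x. \<exists>y\<in>F. x - y \<in> M n)"
proof (induction n)
  case 0
  then show ?case by (auto simp: M_0)
next
  case (Suc n)
  then obtain A where A: "finite A" "\<And>x. \<exists>y\<in>A. x - y \<in> M n" by auto
  obtain B where B: "finite B" "\<And>x. \<exists>y\<in>B. x - y \<in> M 1" using residue_finite by auto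
  obtain F where F: "finite F" "F \<subseteq> M 1"
    and repr: "\<And>n x. x \<in> M (Suc n) \<Longrightarrow> \<exists>c. (\<forall>f\<in>F. c f \<in> M n) \<and> x - (\<Sum>f\<in>F. c f * f) \<in> K"
    using M_Suc_repr by blast
  let ?C = "(\<lambda>(b, c). b + (\<Sum>f\<in>F. c f * f)) ` (B \<times> PiE F (\<lambda>_. A))"
  have "finite ?C" using A B F by (auto intro!: finite_PiE)
  moreover have "\<exists>y\<in>?C. x - y \<in> M (Suc n)" for x
  proof -
    obtain b where b: "b \<in> B" "x - b \<in> M 1" using B by blast
    then obtain c where c: "x - b - (\<Sum>f\<in>F. c f * f) \<in> K" using repr[of "x - b" 0] by auto
    have "\<exists>d. \<forall>f. d f \<in> A \<and> c f - d f \<in> M n" by (rule choice) (use A(2) in blast)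
    then obtain d where d: "\<And>f. d f \<in> A" "\<And>f. c f - d f \<in> M n" by blast
    let ?d = "restrict d F"
    have "x - (b + (\<Sum>f\<in>F. ?d f * f)) = (x - b - (\<Sum>f\<in>F. c f * f)) + (\<Sum>f\<in>F. (c f - d f) * f)"
      by (simp add: algebra_simps sum_subtractf)
    also have "\<dots> \<in> M (Suc n)"
      using c d F(2) by (intro cr.subspace_add[OF M_ideal] cr.subspace_sum[OF M_ideal] M_le_1_mult)
        (auto intro: subsetD[OF K_le])
    finally have "x - (b + (\<Sum>f\<in>F. ?d f * f)) \<in> M (Suc n)" .
    moreover have "b + (\<Sum>f\<in>F. ?d f * f) \<in> ?C"
      using b d by (intro image_eqI[of _ _ "(b, ?d)"]) auto
    ultimately show ?thesis by blast
  qed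
  ultimately show ?case by blast
qed

text \<open>The ring is compact, being complete with finite quotients by the \<open>M k\<close>; the
  sets \<open>C k\<close> are unions of cosets of \<open>M k\<close>, hence closed.\<close>

lemma compactness:
  assumes ne: "\<And>k. C k \<noteq> {}" and dec: "\<And>k. C (Suc k) \<subseteq> C k"
    and cos: "\<And>k x y. x \<in> C k \<Longrightarrow> y - x \<in> M k \<Longrightarrow> y \<in> C k"
  shows "\<exists>x. \<forall>k. x \<in> C k"
proof -
  have "\<exists>x. \<forall>k. x k \<in> C k" by (rule choice) (use ne in blast)
  then obtain x where x: "\<And>k. x k \<in> C k" by blast
  \<comment> \<open>Koenig's argument: a coset of \<open>M k\<close> with infinitely many of the
    \<open>x j\<close> contains a coset of \<open>M (Suc k)\<close> with infinitely many of them.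
    Completeness then provides the limit.\<close>
  have "\<exists>y. \<forall>k. infinite {j. x j - y k \<in> M k} \<and> y (Suc k) - y k \<in> M k"
  proof (rule dependent_nat_choice)
    show "\<exists>y. infinite {j. x j - y \<in> M 0}" by (simp add: M_0)
    fix y k assume y: "infinite {j. x j - y \<in> M k}"
    obtain F where F: "finite F" "\<And>x. \<exists>y\<in>F. x - y \<in> M (Suc k)" using finite_quotient by blast
    have "{j. x j - y \<in> M k} = (\<Union>f\<in>F. {j. x j - y \<in> M k \<and> x j - f \<in> M (Suc k)})" using F(2) by blast
    then obtain f where f: "infinite {j. x j - y \<in> M k \<and> x j - f \<in> M (Suc k)}"
      using y F(1) by (metis (no_types, lifting) finite_UN_I)
    then obtain j where "x j - y \<in> M k" "x j - f \<in> M (Suc k)"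
      by (metis (no_types, lifting) finite.emptyI mem_Collect_eq subsetI subset_empty)
    then have "(x j - y) - (x j - f) \<in> M k" using M_Suc_le[of k] M_diff by blast
    moreover have "infinite {j. x j - f \<in> M (Suc k)}" using f by (rule contrapos_nn) (auto elim: rev_finite_subset)
    ultimately show "\<exists>z. infinite {j. x j - z \<in> M (Suc k)} \<and> z - y \<in> M k" by auto
  qed
  then obtain y where y: "\<And>k. infinite {j. x j - y k \<in> M k}" "\<And>k. y (Suc k) - y k \<in> M k" by blast
  then obtain z where z: "\<And>k. z - y k \<in> M k" using complete[of y] by blast
  have "z \<in> C k" for k
  proof -
    obtain j where j: "j \<ge> k" "x j - y k \<in> M k"
      using y(1)[of k] by (metis (mono_tags, lifting) infinite_nat_iff_unbounded_le mem_Collect_eq)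
    have "x j \<in> C k" using x[of j] lift_Suc_antimono_le[of C, OF dec j(1)] by blast
    moreover have "(z - y k) - (x j - y k) \<in> M k" using j z M_diff by blast
    ultimately show ?thesis using cos[of "x j" k z] by simp
  qed
  then show ?thesis by blast
qed

text \<open>Generators are split off one by one. The coefficients of a generator that are admissible
  modulo \<open>M n\<close> form decreasing sets, and \<open>compactness\<close> finds one
  coefficient admissible for all \<open>n\<close>.\<close>

lemma ideal_closed:
  assumes I: "cr.subspace I" "K \<subseteq> I" and x: "\<And>n. x \<in> ideal_sum I (M n)"
  shows "x \<in> I"
proof -
  obtain F where F: "finite F" "I = cr.span (F \<union> K)" using fin_gen[OF I] by blast
  have "x \<in> cr.span (F \<union> K)" if "\<And>n. x \<in> ideal_sum (cr.span (F \<union> K)) (M n)"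
    using F(1) that
  proof (induction F arbitrary: x rule: finite_induct)
    case empty
    have span: "cr.span K = K" using K_ideal by simp
    have "x \<in> M n" for n
    proof -
      obtain a where "a \<in> K" "x - a \<in> M n" using empty[of n] by (auto simp: ideal_sum_def span)
      then have "a + (x - a) \<in> M n" using K_le by (intro cr.subspace_add[OF M_ideal]) auto
      then show ?thesis by simp
    qed
    then show ?case by (simp add: span) (simp add: K_eq)
  next
    case (insert g F)
    let ?I = "cr.span (F \<union> K)"
    let ?C = "\<lambda>n. {c. x - c * g \<in> ideal_sum ?I (M n)}"
    have "\<exists>c. \<forall>n. c \<in> ?C n"
    proof (rule compactness)
      fix k
      obtain a where a: "a \<in> cr.span (insert g F \<union> K)" "x - a \<in> M k"
        using insert.prems[of k] by (auto simp: ideal_sum_def)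
      then obtain c where "a - c * g \<in> ?I" by (auto simp: cr.span_breakdown_eq)
      then have "c \<in> ?C k" using a(2) unfolding ideal_sum_def by (auto intro!: bexI[of _ "a - c * g"])
      then show "?C k \<noteq> {}" by blast
      show "?C (Suc k) \<subseteq> ?C k" using ideal_sum_mono[OF order_refl M_Suc_le] by blast
      fix c d assume c: "c \<in> ?C k" "d - c \<in> M k"
      then have "(d - c) * g \<in> ideal_sum ?I (M k)"
        using ideal_sum_right[of ?I "M k"] by (auto intro: subspace_mult_right[OF M_ideal])
      then have "(x - c * g) - (d - c) * g \<in> ideal_sum ?I (M k)"
        using c by (auto intro: cr.subspace_diff[OF ideal_sum_subspace[OF cr.subspace_span M_ideal]])
      then show "d \<in> ?C k" by (simp add: algebra_simps)
    qed
    then obtain c where "\<And>n. x - c * g \<in> ideal_sum ?I (M n)" by auto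
    then have "x - c * g \<in> ?I" by (rule insert.IH)
    then show ?case by (auto simp: cr.span_breakdown_eq)
  qed
  then show ?thesis using x F(2) by simp
qed

text \<open>Chevalley's theorem. If no \<open>Q k\<close> were contained in \<open>P + M l\<close>,
  compactness would give a point of all \<open>Q k\<close> outside \<open>P + M l\<close>, hence
  outside \<open>P\<close>.\<close>

lemma chevalley:
  assumes Q: "\<And>k. cr.subspace (Q k)" "\<And>k. Q (Suc k) \<subseteq> Q k" "\<And>k. M k \<subseteq> Q k"
    and sub: "(\<Inter>k. Q k) \<subseteq> P"
  shows "\<exists>i. \<forall>j\<ge>i. Q j \<subseteq> ideal_sum P (M l)"
proof -
  have Q_anti: "Q j \<subseteq> Q i" if "i \<le> j" for i j using lift_Suc_antimono_le[of Q, OF Q(2) that] .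
  have "\<exists>i. Q i \<subseteq> ideal_sum P (M l)"
  proof (rule ccontr)
    assume neg: "\<not> ?thesis"
    \<comment> \<open>The difference is sure to be a union of cosets of \<open>M k\<close> only for
      \<open>k \<ge> l\<close>; smaller indices get the whole ring.\<close>
    let ?C = "\<lambda>k. if k < l then UNIV else Q k - ideal_sum P (M l)"
    have "\<exists>x. \<forall>k. x \<in> ?C k"
    proof (rule compactness)
      fix k
      show "?C k \<noteq> {}" using neg by auto
      show "?C (Suc k) \<subseteq> ?C k" using Q(2)[of k] by auto
      fix x y assume xy: "x \<in> ?C k" "y - x \<in> M k"
      show "y \<in> ?C k"
      proof (cases "k < l")
        case False
        then have "x \<in> Q k" "x \<notin> ideal_sum P (M l)" using xy by auto
        moreover have "y - x \<in> Q k" using xy Q(3) by auto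
        ultimately have "y \<in> Q k" using cr.subspace_add[OF Q(1), of "y - x" k x] by simp
        moreover have "y \<notin> ideal_sum P (M l)"
        proof
          assume "y \<in> ideal_sum P (M l)"
          then obtain a where a: "a \<in> P" "y - a \<in> M l" by (auto simp: ideal_sum_def)
          have "y - x \<in> M l" using xy False M_antimono[of l k] by auto
          then have "(y - a) - (y - x) \<in> M l" using a cr.subspace_diff[OF M_ideal] by blast
          then show False using a(1) \<open>x \<notin> _\<close> by (auto simp: ideal_sum_def)
        qed
        ultimately show ?thesis using False by simp
      qed simp
    qed
    then obtain x where x: "\<And>k. x \<in> ?C k" by blast
    have "x \<in> Q k" for k using x[of "max k l"] Q_anti[of k "max k l"] by (auto simp: max_def split: if_splits)
    moreover have "x \<notin> ideal_sum P (M l)" using x[of l] by simp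
    moreover have "P \<subseteq> ideal_sum P (M l)" by (rule ideal_sum_left[OF M_ideal])
    ultimately show False using sub by blast
  qed
  then show ?thesis using Q_anti by blast
qed

text \<open>Supplies the finite set that \<open>additive_mod_extend\<close> and
  \<open>elementary_quotient_basis\<close> ask for.\<close>

lemma finite_generates:
  assumes "M n \<subseteq> B"
  obtains F where "finite F" "\<And>G. add_subgroup G \<Longrightarrow> B \<union> F \<subseteq> G \<Longrightarrow> G = UNIV"
proof -
  obtain F where F: "finite F" "\<And>x. \<exists>y\<in>F. x - y \<in> M n" using finite_quotient by blast
  have "G = UNIV" if "add_subgroup G" "B \<union> F \<subseteq> G" for G
  proof -
    have "x \<in> G" for x
    proof -
      obtain y where "y \<in> F" "x - y \<in> M n" using F by blast
      then have "(x - y) + y \<in> G" using that assms by (intro add_subgroup_add) auto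
      then show ?thesis by simp
    qed
    then show ?thesis by blast
  qed
  then show thesis using F(1) that by blast
qed

end

section \<open>Functions with values in the integers modulo powers of p\<close>

locale adic_ring_prime = adic_ring +
  fixes p :: nat
  assumes p: "Factorial_Ring.prime p" and p_in_M: "of_nat p \<in> M 1"
begin

lemma p_power_in_M: "of_nat (p ^ n) \<in> M n"
  by (induction n) (auto simp: M_0 intro: M_mult[OF p_in_M])

lemma span_p_power_le: "cr.span {of_nat (p ^ n)} \<subseteq> M n"
  using p_power_in_M by (intro cr.span_minimal M_ideal) auto

lemma in_span_p_power:
  assumes "int (p ^ n) dvd z" shows "of_int z * x \<in> cr.span {of_nat (p ^ n)}"
proof -
  obtain k where "z = int (p ^ n) * k" using assms by (rule dvdE)
  then have "of_int z * x = (of_int k * x) * of_nat (p ^ n)" by (simp add: mult_ac)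
  then show ?thesis using cr.span_scale[OF cr.span_base[of "of_nat (p ^ n)" "{of_nat (p ^ n)}"]] by simp
qed

text \<open>On \<open>p R + P + M i\<close> let \<open>b\<close> send \<open>p r + s\<close> to
  \<open>p * u r\<close>. If \<open>p r\<close> lies in \<open>P + M i\<close>, then
  \<open>r\<close> lies in \<open>P + M l\<close>, where \<open>u\<close> vanishes; so
  \<open>b\<close> is well defined modulo \<open>p ^ (m + 1)\<close>. Its extension
  \<open>u'\<close> satisfies \<open>p * u' x = p * u x\<close> modulo \<open>p ^ (m + 1)\<close>,
  and \<open>p\<close> can be cancelled.\<close>

lemma additive_mod_lift:
  assumes P: "cr.subspace P" "K \<subseteq> P" and sat: "\<And>x. of_nat p * x \<in> P \<Longrightarrow> x \<in> P"
    and i: "{x. of_nat p * x \<in> ideal_sum P (M i)} \<subseteq> ideal_sum P (M l)"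
    and u: "additive_mod (p ^ m) UNIV u" "\<And>x. x \<in> P \<union> M l \<Longrightarrow> int (p ^ m) dvd u x"
  shows "\<exists>u'. additive_mod (p ^ Suc m) UNIV u' \<and> (\<forall>x\<in>P \<union> M i. int (p ^ Suc m) dvd u' x) \<and>
    (\<forall>x. int (p ^ m) dvd u' x - u x)"
proof -
  have p0: "p > 0" using p prime_gt_0_nat by blast
  have sub: "add_subgroup (UNIV :: 'a set)" by (simp add: add_subgroup_def)
  let ?S = "ideal_sum P (M i)"
  have S: "cr.subspace ?S" by (rule ideal_sum_subspace[OF P(1) M_ideal])
  define B where "B = {x. \<exists>r. x - of_nat p * r \<in> ?S}"
  define s where "s x = (SOME r. x - of_nat p * r \<in> ?S)" for x
  define b where "b x = int p * u (s x)" for x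
  have u0: "int (p ^ m) dvd u x" if x: "x \<in> ideal_sum P (M l)" for x
  proof -
    obtain a where a: "a \<in> P" "x - a \<in> M l" using x by (auto simp: ideal_sum_def)
    have "int (p ^ m) dvd u (a + (x - a)) - (u a + u (x - a))" by (rule additive_modD[OF u(1)]) auto
    from dvd_add[OF this dvd_add[OF u(2) u(2)], of a "x - a"] a show ?thesis by simp
  qed
  have b_eq: "int (p ^ Suc m) dvd b x - int p * u r" if r: "x - of_nat p * r \<in> ?S" for x r
  proof -
    have "x - of_nat p * s x \<in> ?S" unfolding s_def using r by (rule someI)
    from cr.subspace_diff[OF S r this] have "of_nat p * (s x - r) \<in> ?S" by (simp add: algebra_simps)
    then have "int (p ^ m) dvd u (s x - r)" using i u0 by blast
    from dvd_diff[OF this additive_mod_diff[OF u(1) sub, of "s x" r]]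
    have "int (p ^ m) dvd u (s x) - u r" by simp
    then have "int p * int (p ^ m) dvd int p * (u (s x) - u r)" by (rule mult_dvd_mono[OF dvd_refl])
    then show ?thesis by (simp add: b_def algebra_simps)
  qed
  have B: "add_subgroup B"
    unfolding add_subgroup_def
  proof (intro conjI ballI)
    show "0 \<in> B" unfolding B_def using cr.subspace_0[OF S] by (auto intro: exI[of _ 0])
    fix x y assume "x \<in> B" "y \<in> B"
    then obtain r r' where "x - of_nat p * r \<in> ?S" "y - of_nat p * r' \<in> ?S" by (auto simp: B_def)
    from cr.subspace_diff[OF S this] show "x - y \<in> B"
      unfolding B_def by (auto intro!: exI[of _ "r - r'"] simp: algebra_simps)
  qed
  have pB: "of_nat p * x - of_nat p * x \<in> ?S" for x using cr.subspace_0[OF S] by simp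
  have pmB: "of_nat (p ^ Suc m) * x - of_nat p * (of_nat (p ^ m) * x) \<in> ?S" for x
    using cr.subspace_0[OF S] by (simp add: mult_ac)
  have "\<exists>u'. additive_mod (p ^ Suc m) UNIV u' \<and> (\<forall>x\<in>B. int (p ^ Suc m) dvd u' x - b x)"
  proof -
    have MB: "M i \<subseteq> B" unfolding B_def using ideal_sum_right[OF P(1), of "M i"] by (auto intro!: exI[of _ 0])
    obtain F where "finite F" "\<And>G. add_subgroup G \<Longrightarrow> B \<union> F \<subseteq> G \<Longrightarrow> G = UNIV"
      using finite_generates[OF MB] by blast
    moreover have "of_nat (p ^ Suc m) * x \<in> B" for x
      unfolding B_def using pmB by blast
    moreover have "additive_mod (p ^ Suc m) B b"
      unfolding additive_mod_def
    proof (intro ballI)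
      fix x y assume "x \<in> B" "y \<in> B"
      then obtain r r' where r: "x - of_nat p * r \<in> ?S" "y - of_nat p * r' \<in> ?S" by (auto simp: B_def)
      have eq: "x + y - of_nat p * (r + r') = (x - of_nat p * r) + (y - of_nat p * r')"
        by (simp add: algebra_simps)
      have "x + y - of_nat p * (r + r') \<in> ?S" unfolding eq by (rule cr.subspace_add[OF S r])
      note 1 = b_eq[OF this] b_eq[OF r(1)] b_eq[OF r(2)]
      have "int (p ^ m) dvd u (r + r') - (u r + u r')" by (rule additive_modD[OF u(1)]) auto
      then have "int p * int (p ^ m) dvd int p * (u (r + r') - (u r + u r'))"
        by (rule mult_dvd_mono[OF dvd_refl])
      then have "int (p ^ Suc m) dvd int p * u (r + r') - (int p * u r + int p * u r')"
        by (simp add: algebra_simps)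
      from dvd_diff[OF dvd_diff[OF dvd_add[OF 1(1) this] 1(2)] 1(3)]
      show "int (p ^ Suc m) dvd b (x + y) - (b x + b y)" by (simp add: algebra_simps)
    qed
    moreover have "int (p ^ Suc m) dvd b (of_nat (p ^ Suc m) * x)" for x
    proof -
      have "int (p ^ m) dvd u (of_nat (p ^ m) * x)"
        using dvd_add[OF additive_mod_of_nat[OF u(1) sub, of x "p ^ m"] dvd_triv_left[of "int (p ^ m)" "u x"]] by simp
      then have "int p * int (p ^ m) dvd int p * u (of_nat (p ^ m) * x)"
        by (rule mult_dvd_mono[OF dvd_refl])
      then have "int (p ^ Suc m) dvd int p * u (of_nat (p ^ m) * x)" by simp
      from dvd_add[OF b_eq[OF pmB[of x]] this] show ?thesis by simp
    qed
    moreover have "p ^ Suc m > 0" using p0 by simp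
    ultimately show ?thesis using B by (intro additive_mod_extend[of "p ^ Suc m" B b F])
  qed
  then obtain u' where u': "additive_mod (p ^ Suc m) UNIV u'" "\<And>x. x \<in> B \<Longrightarrow> int (p ^ Suc m) dvd u' x - b x"
    by blast
  have "int (p ^ Suc m) dvd u' x" if "x \<in> P \<union> M i" for x
  proof -
    have "x - of_nat p * 0 \<in> ?S" using that ideal_sum_left[OF M_ideal, of P i] ideal_sum_right[OF P(1), of "M i"] by auto
    then have 1: "x \<in> B" "int (p ^ Suc m) dvd b x - int p * u 0" using b_eq unfolding B_def by blast+
    have 2: "int (p ^ Suc m) dvd int p * u 0"
      using mult_dvd_mono[OF dvd_refl additive_mod_0[OF u(1) sub], of "int p"] by simp
    from dvd_add[OF dvd_add[OF u'(2)[OF 1(1)] 1(2)] 2] show ?thesis by simp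
  qed
  moreover have "int (p ^ m) dvd u' x - u x" for x
  proof -
    have "of_nat p * x \<in> B" unfolding B_def using pB by blast
    then have 1: "int (p ^ Suc m) dvd u' (of_nat p * x) - int p * u x"
      using u'(2) b_eq[OF pB] dvd_diff_trans by blast
    from dvd_diff[OF 1 additive_mod_of_nat[OF u'(1) sub, of x p]]
    have "int p * int (p ^ m) dvd int p * (u' x - u x)" by (simp add: algebra_simps)
    then show ?thesis using p0 by simp
  qed
  ultimately show ?thesis using u'(1) by blast
qed

end

lemma subspace_colon: "cr.subspace I \<Longrightarrow> cr.subspace {x. c * x \<in> I}"
  by (rule cr.subspaceI)
    (auto simp: distrib_left mult.left_commute cr.subspace_0 cr.subspace_add subspace_mult_left)

context adic_ring_prime
begin

text \<open>A dual basis at finite level. In the step from \<open>m\<close> to \<open>m + 1\<close>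
  the functions are lifted; the error that this leaves is a multiple of \<open>p ^ m\<close>, and
  coordinates modulo \<open>p\<close> suffice to express it.\<close>

lemma approximate_identity:
  assumes P: "cr.subspace P" "K \<subseteq> P" and sat: "\<And>x. of_nat p * x \<in> P \<Longrightarrow> x \<in> P"
  shows "\<exists>(n::nat) u d l'.
    (\<forall>j<n. additive_mod (p ^ m) UNIV (u j) \<and> (\<forall>x\<in>P \<union> M l'. int (p ^ m) dvd u j x)) \<and>
    (\<forall>y. y - (\<Sum>j<n. of_int (u j y) * d j) \<in> ideal_sum (ideal_sum P (M l)) (cr.span {of_nat (p ^ m)}))"
proof (induction m)
  case 0
  have "cr.span {of_nat (p ^ 0)} = (UNIV :: 'a set)" by (auto simp: cr.span_singleton)
  then have "ideal_sum (ideal_sum P (M l)) (cr.span {of_nat (p ^ 0)}) = UNIV"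
    using ideal_sum_right[OF ideal_sum_subspace[OF P(1) M_ideal[of l]], of UNIV] by auto
  then show ?case by (intro exI[of _ 0]) simp
next
  case (Suc m)
  note [simp del] = of_nat_power power_Suc
  let ?S = "ideal_sum P (M l)" and ?p = "cr.span {of_nat (p ^ Suc m) :: 'a}"
  have S: "cr.subspace ?S" by (rule ideal_sum_subspace[OF P(1) M_ideal])
  let ?T = "ideal_sum ?S ?p"
  have T: "cr.subspace ?T" by (rule ideal_sum_subspace[OF S cr.subspace_span])
  have ST: "?S \<subseteq> ?T" by (rule ideal_sum_left[OF cr.subspace_span])
  have pT: "?p \<subseteq> ?T" by (rule ideal_sum_right[OF S])
  from Suc obtain n :: nat and u d l' where
    u: "\<And>j. j < n \<Longrightarrow> additive_mod (p ^ m) UNIV (u j)"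
       "\<And>j x. j < n \<Longrightarrow> x \<in> P \<union> M l' \<Longrightarrow> int (p ^ m) dvd u j x" and
    d: "\<And>y. y - (\<Sum>j<n. of_int (u j y) * d j) \<in> ideal_sum ?S (cr.span {of_nat (p ^ m)})"
    by blast
  \<comment> \<open>The quotient by \<open>P\<close> has no \<open>p\<close>-torsion, but the
    quotients by \<open>P + M i\<close> may have some. Chevalley's theorem confines it to
    \<open>P + M l'\<close> for large \<open>i\<close>, as lifting requires.\<close>
  let ?Q = "\<lambda>i. {x. of_nat p * x \<in> ideal_sum P (M i)}"
  have "\<exists>i. \<forall>j\<ge>i. ?Q j \<subseteq> ideal_sum P (M l')"
  proof (rule chevalley)
    fix k
    have S: "cr.subspace (ideal_sum P (M k))" by (rule ideal_sum_subspace[OF P(1) M_ideal])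
    show "cr.subspace (?Q k)"
      by (rule subspace_colon[OF S])
    show "?Q (Suc k) \<subseteq> ?Q k" using ideal_sum_mono[OF order_refl M_Suc_le] by blast
    show "M k \<subseteq> ?Q k"
      using ideal_sum_right[OF P(1), of "M k"] subspace_mult_left[OF M_ideal] by blast
    show "(\<Inter>k. ?Q k) \<subseteq> P" using ideal_closed[OF P] sat by blast
  qed
  then obtain i0 where i0: "\<And>j. j \<ge> i0 \<Longrightarrow> ?Q j \<subseteq> ideal_sum P (M l')" by blast
  define i where "i = max i0 l"
  have "\<exists>u'. additive_mod (p ^ Suc m) UNIV u' \<and> (\<forall>x\<in>P \<union> M i. int (p ^ Suc m) dvd u' x) \<and>
      (\<forall>x. int (p ^ m) dvd u' x - u j x)" if "j < n" for j
    by (rule additive_mod_lift[OF P sat, of i l']) (use i0[of i] u that in \<open>auto simp: i_def\<close>)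
  then obtain u' where u': "\<And>j. j < n \<Longrightarrow> additive_mod (p ^ Suc m) UNIV (u' j)"
     "\<And>j x. j < n \<Longrightarrow> x \<in> P \<union> M i \<Longrightarrow> int (p ^ Suc m) dvd u' j x"
     "\<And>j x. j < n \<Longrightarrow> int (p ^ m) dvd u' j x - u j x" by metis
  define E where "E y = y - (\<Sum>j<n. of_int (u' j y) * d j)" for y
  have E: "E y \<in> ideal_sum ?S (cr.span {of_nat (p ^ m)})" for y
  proof -
    have "(\<Sum>j<n. of_int (u' j y - u j y) * d j) \<in> cr.span {of_nat (p ^ m)}"
      using u'(3) by (intro cr.subspace_sum[OF cr.subspace_span] in_span_p_power) auto
    then have "(\<Sum>j<n. of_int (u' j y - u j y) * d j) \<in> ideal_sum ?S (cr.span {of_nat (p ^ m)})"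
      using ideal_sum_right[OF S] by blast
    from cr.subspace_diff[OF ideal_sum_subspace[OF S cr.subspace_span] d[of y] this]
    show ?thesis by (simp add: E_def algebra_simps sum_subtractf)
  qed
  have "\<exists>e. E y - of_nat (p ^ m) * e \<in> ?S" for y
  proof -
    obtain a where a: "a \<in> ?S" "E y - a \<in> cr.span {of_nat (p ^ m)}"
      using E[of y] unfolding ideal_sum_def[of ?S] by blast
    then obtain e where "E y - a = e * of_nat (p ^ m)" by (auto simp: cr.span_singleton)
    then have "E y - of_nat (p ^ m) * e = a" by (simp add: algebra_simps)
    then show ?thesis using a(1) by blast
  qed
  then obtain e where e: "\<And>y. E y - of_nat (p ^ m) * e y \<in> ?S" by metis
  \<comment> \<open>The cofactor \<open>e\<close> is determined, and additive, only modulo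
    \<open>D\<close>; the quotient by \<open>D\<close> is killed by \<open>p\<close>.\<close>
  define D where "D = {r. of_nat (p ^ m) * r \<in> ?T}"
  have D: "cr.subspace D"
    unfolding D_def
    by (rule subspace_colon[OF T])
  have pD: "of_nat p * x \<in> D" for x
  proof -
    have "of_nat (p ^ m) * (of_nat p * x) = x * of_nat (p ^ Suc m)" by (simp add: power_Suc mult_ac)
    then have "of_nat (p ^ m) * (of_nat p * x) \<in> ?p" by (metis cr.span_base cr.span_scale singletonI)
    then show ?thesis unfolding D_def using pT by blast
  qed
  have MlS: "M l \<subseteq> ?S" "P \<subseteq> ?S" using ideal_sum_right[OF P(1)] ideal_sum_left[OF M_ideal] by auto
  have "M l \<subseteq> D" unfolding D_def using MlS ST subspace_mult_left[OF M_ideal] by blast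
  then obtain F where F: "finite F" "\<And>G. add_subgroup G \<Longrightarrow> D \<union> F \<subseteq> G \<Longrightarrow> G = UNIV"
    using finite_generates by blast
  from elementary_quotient_basis[OF p subspace_imp_add_subgroup[OF D] pD F]
  obtain k :: nat and c w where w: "\<And>j. j < k \<Longrightarrow> additive_mod p UNIV (w j)"
      "\<And>j x. j < k \<Longrightarrow> x \<in> D \<Longrightarrow> int p dvd w j x"
    and c: "\<And>r. r - (\<Sum>j<k. of_int (w j r) * c j) \<in> D" by blast
  have e_add: "e (x + y) - (e x + e y) \<in> D" for x y
  proof -
    have "(\<Sum>j<n. of_int (u' j (x + y) - (u' j x + u' j y)) * d j) \<in> ?p"
      using additive_modD[OF u'(1)] by (intro cr.subspace_sum[OF cr.subspace_span] in_span_p_power) auto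
    moreover have "E (x + y) - (E x + E y) = - (\<Sum>j<n. of_int (u' j (x + y) - (u' j x + u' j y)) * d j)"
      by (simp add: E_def algebra_simps sum_subtractf sum.distrib)
    ultimately have 1: "E (x + y) - (E x + E y) \<in> ?T" using pT cr.subspace_neg[OF cr.subspace_span] by auto
    have "(E (x + y) - of_nat (p ^ m) * e (x + y)) - ((E x - of_nat (p ^ m) * e x) + (E y - of_nat (p ^ m) * e y)) \<in> ?S"
      using e cr.subspace_diff[OF S] cr.subspace_add[OF S] by blast
    with ST have 2: "(E (x + y) - of_nat (p ^ m) * e (x + y)) - ((E x - of_nat (p ^ m) * e x) + (E y - of_nat (p ^ m) * e y)) \<in> ?T"
      by blast
    from cr.subspace_diff[OF T 1 2] show ?thesis unfolding D_def by (simp add: algebra_simps)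
  qed
  \<comment> \<open>The factor \<open>p ^ m\<close> turns a coordinate modulo \<open>p\<close> into
    a function modulo \<open>p ^ (m + 1)\<close>.\<close>
  define v where "v j y = int (p ^ m) * w j (e y)" for j y
  have scale: "int p dvd z \<Longrightarrow> int (p ^ Suc m) dvd int (p ^ m) * z" for z
    using mult_dvd_mono[OF dvd_refl, of "int p" z "int (p ^ m)"] by (simp add: power_Suc mult.commute)
  have v_add: "additive_mod (p ^ Suc m) UNIV (v j)" if j: "j < k" for j
    unfolding additive_mod_def
  proof (intro ballI)
    fix x y :: 'a
    have sub: "add_subgroup (UNIV :: 'a set)" by (simp add: add_subgroup_def)
    note 1 = additive_mod_diff[OF w(1)[OF j] sub, of "e (x + y)" "e x + e y"]
      w(2)[OF j e_add[of x y]] additive_modD[OF w(1)[OF j], of "e x" "e y"]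
    have "int p dvd w j (e (x + y)) - (w j (e x) + w j (e y))"
      using dvd_add[OF dvd_diff[OF 1(2) 1(1)] 1(3)] by (simp add: algebra_simps)
    from scale[OF this] show "int (p ^ Suc m) dvd v j (x + y) - (v j x + v j y)"
      by (simp add: v_def algebra_simps)
  qed
  have v_0: "int (p ^ Suc m) dvd v j x" if j: "j < k" and x: "x \<in> P \<union> M i" for j x
  proof -
    have "(\<Sum>j<n. of_int (u' j x) * d j) \<in> ?p"
      using u'(2) x by (intro cr.subspace_sum[OF cr.subspace_span] in_span_p_power) auto
    moreover have "x \<in> ?S" using x MlS M_antimono[of l i] by (auto simp: i_def)
    ultimately have 1: "E x \<in> ?T" unfolding E_def using ST pT cr.subspace_diff[OF T] by blast
    have 2: "E x - of_nat (p ^ m) * e x \<in> ?T" using e ST by blast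
    have "e x \<in> D" unfolding D_def using cr.subspace_diff[OF T 1 2] by simp
    then show ?thesis unfolding v_def using w(2)[OF j] scale by blast
  qed
  have final: "E y - (\<Sum>j<k. of_int (v j y) * c j) \<in> ?T" for y
  proof -
    have 1: "E y - of_nat (p ^ m) * e y \<in> ?T" using e ST by blast
    have 2: "of_nat (p ^ m) * (e y - (\<Sum>j<k. of_int (w j (e y)) * c j)) \<in> ?T"
      using c[of "e y"] unfolding D_def by simp
    from cr.subspace_add[OF T 1 2] show ?thesis
      by (simp add: v_def algebra_simps sum_distrib_left)
  qed
  define u'' where "u'' j = (if j < n then u' j else v (j - n))" for j
  define d' where "d' j = (if j < n then d j else c (j - n))" for j
  have "(\<Sum>j<n + k. of_int (u'' j y) * d' j) = (\<Sum>j<n. of_int (u' j y) * d j) + (\<Sum>j<k. of_int (v j y) * c j)" for y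
    by (induction k) (simp_all add: u''_def d'_def add.assoc)
  then have A1: "y - (\<Sum>j<n + k. of_int (u'' j y) * d' j) \<in> ?T" for y
    using final[of y] by (simp add: E_def algebra_simps)
  have A2: "additive_mod (p ^ Suc m) UNIV (u'' j) \<and> (\<forall>x\<in>P \<union> M i. int (p ^ Suc m) dvd u'' j x)"
    if "j < n + k" for j
    using u' v_add v_0 that by (auto simp: u''_def)
  show ?case
    by (rule exI[of _ "n + k"], rule exI[of _ u''], rule exI[of _ d'], rule exI[of _ i], rule conjI)
      (use A2 in blast, use A1 in blast)
qed

end

section \<open>Casimir families\<close>

text \<open>The tensor \<open>\<Sum> a t \<otimes> t\<close> over the quotient by \<open>q\<close>,
  stored as a finite set of right-hand factors with their coefficients. An additive map of the
  quotient is represented by a function \<open>h\<close> on the ring that is additive modulo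
  \<open>q\<close> and preserves \<open>q\<close>.\<close>

definition casimir_family :: "'r::comm_ring_1 set \<Rightarrow> nat \<Rightarrow> 'r set \<Rightarrow> ('r \<Rightarrow> 'r) \<Rightarrow> bool" where
  "casimir_family q N T a \<longleftrightarrow> finite T \<and> (\<Sum>t\<in>T. a t * t) - of_nat N \<in> q \<and>
    (\<forall>b h. (\<forall>x y. h (x + y) - (h x + h y) \<in> q) \<longrightarrow> (\<forall>x\<in>q. h x \<in> q) \<longrightarrow>
      b * (\<Sum>t\<in>T. a t * h t) - (\<Sum>t\<in>T. a t * h (b * t)) \<in> q)"

lemma casimir_familyD:
  assumes "casimir_family q N T a"
  shows "finite T" "(\<Sum>t\<in>T. a t * t) - of_nat N \<in> q"
    "(\<And>x y. h (x + y) - (h x + h y) \<in> q) \<Longrightarrow> (\<And>x. x \<in> q \<Longrightarrow> h x \<in> q) \<Longrightarrow>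
      b * (\<Sum>t\<in>T. a t * h t) - (\<Sum>t\<in>T. a t * h (b * t)) \<in> q"
  using assms unfolding casimir_family_def by simp_all

text \<open>The same \<open>N\<close> serves every \<open>q\<close> and \<open>i\<close>; this
  uniformity allows the passage to the limit. It will be a power of the order of the group.\<close>

locale adic_ring_casimir = adic_ring_prime +
  fixes N :: nat
  assumes N: "N > 0"
    and casimir: "cr.subspace q \<Longrightarrow> M i \<subseteq> q \<Longrightarrow> q \<subseteq> M 1 \<Longrightarrow> \<exists>T a. casimir_family q N T a"
    and char_0: "of_nat (p ^ r) \<notin> K"
    and local: "x \<notin> M 1 \<Longrightarrow> \<exists>y. 1 - x * y \<in> M 1"
begin

definition torsion where "torsion = {x. \<exists>r. of_nat (p ^ r) * x \<in> K}"

definition saturation where "saturation I = {x. \<exists>r. of_nat (p ^ r) * x \<in> I}"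

lemma saturation_subspace:
  assumes "cr.subspace I" shows "cr.subspace (saturation I)"
proof (rule cr.subspaceI)
  show "0 \<in> saturation I" using assms by (auto simp: saturation_def cr.subspace_0)
next
  fix x y assume "x \<in> saturation I" "y \<in> saturation I"
  then obtain r s where "of_nat (p ^ r) * x \<in> I" "of_nat (p ^ s) * y \<in> I" by (auto simp: saturation_def)
  then have "of_nat (p ^ s) * (of_nat (p ^ r) * x) + of_nat (p ^ r) * (of_nat (p ^ s) * y) \<in> I"
    by (rule cr.subspace_add[OF assms subspace_mult_left[OF assms] subspace_mult_left[OF assms]])
  moreover have "of_nat (p ^ s) * (of_nat (p ^ r) * x) + of_nat (p ^ r) * (of_nat (p ^ s) * y)
      = of_nat (p ^ (r + s)) * (x + y)"
    by (simp add: power_add algebra_simps)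
  ultimately have "of_nat (p ^ (r + s)) * (x + y) \<in> I" by simp
  then show "x + y \<in> saturation I" unfolding saturation_def by blast
next
  fix c x assume "x \<in> saturation I"
  then obtain r where "of_nat (p ^ r) * x \<in> I" by (auto simp: saturation_def)
  then have "c * (of_nat (p ^ r) * x) \<in> I" by (rule subspace_mult_left[OF assms])
  then show "c * x \<in> saturation I" unfolding saturation_def by (auto simp: mult.left_commute)
qed

lemma saturation_superset: "I \<subseteq> saturation I"
  by (auto simp: saturation_def intro!: exI[of _ 0])

lemma saturation_power: "of_nat (p ^ r) * x \<in> saturation I \<Longrightarrow> x \<in> saturation I"
proof -
  assume "of_nat (p ^ r) * x \<in> saturation I"
  then obtain s where "of_nat (p ^ s) * (of_nat (p ^ r) * x) \<in> I" by (auto simp: saturation_def)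
  then have "of_nat (p ^ (s + r)) * x \<in> I" by (simp add: power_add mult.assoc)
  then show ?thesis unfolding saturation_def by blast
qed

lemma saturation_saturated: "of_nat p * x \<in> saturation I \<Longrightarrow> x \<in> saturation I"
  using saturation_power[of 1] by simp

lemma torsion_eq: "torsion = saturation K"
  by (simp add: torsion_def saturation_def)

lemma torsion_subspace: "cr.subspace torsion"
  unfolding torsion_eq by (rule saturation_subspace[OF K_ideal])

lemma K_le_torsion: "K \<subseteq> torsion"
  unfolding torsion_eq by (rule saturation_superset)

text \<open>A torsion element outside \<open>M 1\<close> is invertible modulo \<open>M 1\<close>,
  which makes \<open>p ^ r\<close> congruent to \<open>e * p ^ r\<close> modulo \<open>K\<close>
  with \<open>e\<close> in \<open>M 1\<close>. By iteration \<open>p ^ r\<close> lies in every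
  \<open>M n\<close>, which \<open>char_0\<close> forbids.\<close>

lemma torsion_le_M: "torsion \<subseteq> M 1"
proof
  fix x assume "x \<in> torsion"
  show "x \<in> M 1"
  proof (rule ccontr)
    assume "x \<notin> M 1"
    then obtain y where y: "1 - x * y \<in> M 1" using local by blast
    define e where "e = 1 - x * y"
    have "y * x \<in> torsion" by (rule subspace_mult_left[OF torsion_subspace \<open>x \<in> torsion\<close>])
    then obtain r where r: "of_nat (p ^ r) * (y * x) \<in> K" by (auto simp: torsion_def)
    have "of_nat (p ^ r) \<in> M n" for n
    proof (induction n)
      case (Suc n)
      have "e * of_nat (p ^ r) \<in> M (Suc n)" using y Suc by (auto simp: e_def intro!: M_mult)
      moreover have "of_nat (p ^ r) * (y * x) \<in> M (Suc n)" using r K_le by blast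
      ultimately have "e * of_nat (p ^ r) + of_nat (p ^ r) * (y * x) \<in> M (Suc n)"
        by (rule cr.subspace_add[OF M_ideal])
      then show ?case by (simp add: e_def algebra_simps)
    qed (simp add: M_0)
    then have "of_nat (p ^ r) \<in> K" by (simp add: K_eq)
    then show False using char_0 by blast
  qed
qed

lemma additive_mod_dvd_add:
  "additive_mod q UNIV u \<Longrightarrow> q dvd u x \<Longrightarrow> q dvd u y \<Longrightarrow> q dvd u (x + y)"
  using additive_modD[of q UNIV u x y] by (metis UNIV_I diff_add_cancel dvd_add)

text \<open>The \<open>w j\<close> arise by applying \<open>u j\<close> to the right-hand factors of
  the Casimir tensor. An approximate identity turns \<open>\<Sum> a t * t\<close> into
  \<open>\<Sum> w j * d j\<close>, and by the Casimir identity whatever kills the function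
  \<open>u j\<close> also kills \<open>w j\<close> modulo \<open>q\<close>.\<close>

lemma casimir_approximation:
  assumes q: "cr.subspace q" "M i \<subseteq> q" "q \<subseteq> M 1" "cr.span {of_nat (p ^ m)} \<subseteq> q"
    and u: "\<And>j. j < n \<Longrightarrow> additive_mod (p ^ m) UNIV (u j)"
    and uq: "\<And>j x. j < n \<Longrightarrow> x \<in> q \<Longrightarrow> int (p ^ m) dvd u j x"
    and d: "\<And>y. y - (\<Sum>j<n. of_int (u j y) * d j) \<in> E"
    and E: "cr.subspace E"
  shows "\<exists>w. (\<Sum>j<n. w j * d j) - of_nat N \<in> ideal_sum q E \<and>
    (\<forall>j<n. \<forall>b. (\<forall>t. int (p ^ m) dvd u j (b * t)) \<longrightarrow> b * w j \<in> q)"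
proof -
  obtain T a where Ta: "casimir_family q N T a" using casimir[OF q(1-3)] by blast
  note T = casimir_familyD(1,2)[OF Ta]
  define w where "w j = (\<Sum>t\<in>T. a t * of_int (u j t))" for j
  have dvd_q: "of_int z \<in> q" if "int (p ^ m) dvd z" for z
    using in_span_p_power[OF that, of 1] q(4) by auto
  have "b * w j \<in> q" if j: "j < n" and b: "\<And>t. int (p ^ m) dvd u j (b * t)" for j b
  proof -
    have "b * w j - (\<Sum>t\<in>T. a t * of_int (u j (b * t))) \<in> q"
      unfolding w_def
    proof (rule casimir_familyD(3)[OF Ta])
      fix x y
      show "of_int (u j (x + y)) - (of_int (u j x) + of_int (u j y)) \<in> q"
        using dvd_q[OF additive_modD[OF u[OF j], of x y]] by simp
    qed (use uq[OF j] dvd_q in blast)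
    moreover have "(\<Sum>t\<in>T. a t * of_int (u j (b * t))) \<in> q"
      by (intro cr.subspace_sum[OF q(1)] subspace_mult_left[OF q(1)] dvd_q b)
    ultimately have "b * w j - (\<Sum>t\<in>T. a t * of_int (u j (b * t))) + (\<Sum>t\<in>T. a t * of_int (u j (b * t))) \<in> q"
      by (rule cr.subspace_add[OF q(1)])
    then show ?thesis by simp
  qed
  moreover have "(\<Sum>j<n. w j * d j) - of_nat N \<in> ideal_sum q E"
  proof -
    have "(\<Sum>j<n. w j * d j) = (\<Sum>t\<in>T. a t * (\<Sum>j<n. of_int (u j t) * d j))"
      unfolding w_def sum_distrib_left sum_distrib_right by (subst sum.swap) (simp add: mult.assoc)
    moreover have "(\<Sum>t\<in>T. a t * (t - (\<Sum>j<n. of_int (u j t) * d j))) \<in> E"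
      by (intro cr.subspace_sum[OF E] subspace_mult_left[OF E] d)
    ultimately have "(\<Sum>t\<in>T. a t * t) - (\<Sum>j<n. w j * d j) \<in> E"
      by (simp add: algebra_simps sum_subtractf)
    from ideal_sumI[OF T(2) cr.subspace_neg[OF E this]] show ?thesis by simp
  qed
  ultimately show ?thesis by blast
qed

text \<open>Let \<open>W\<close> be the torsion plus the multiples of \<open>p ^ m\<close>, and
  \<open>H\<close> the ideal of elements killed by some \<open>M l\<close> modulo \<open>W\<close>;
  as \<open>H\<close> is finitely generated, one \<open>M J\<close> kills all of it. The functions
  of an approximate identity vanish on some \<open>M l'\<close>, so the \<open>w j\<close> lie in
  \<open>H + M l\<close>. Hence \<open>M J\<close> carries \<open>\<Sum> w j * d j\<close>, which
  approximates \<open>N\<close>, into \<open>W + M l\<close>, and closedness of \<open>W\<close>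
  removes \<open>M l\<close>.\<close>

theorem M_le_torsion_p: "\<exists>J. M J \<subseteq> ideal_sum torsion (cr.span {of_nat p})"
proof -
  obtain s u0 where su: "N = p ^ s * u0" "\<not> p dvd u0"
    using multiplicity_decompose'[of N p] N p by (metis not_prime_unit gr_implies_not0)
  \<comment> \<open>One more than the exponent of \<open>p\<close> in \<open>N\<close>: a factor
    \<open>p\<close> remains after \<open>p ^ s\<close> is cancelled modulo torsion at the
    end.\<close>
  define m where "m = Suc s"
  define W where "W = ideal_sum torsion (cr.span {of_nat (p ^ m)})"
  have W: "cr.subspace W" unfolding W_def by (intro ideal_sum_subspace torsion_subspace cr.subspace_span)
  have tW: "torsion \<subseteq> W" unfolding W_def by (rule ideal_sum_left[OF cr.subspace_span])
  have pW: "cr.span {of_nat (p ^ m)} \<subseteq> W" unfolding W_def by (rule ideal_sum_right[OF torsion_subspace])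
  have "cr.span {of_nat (p ^ m)} \<subseteq> M 1"
    using span_p_power_le[of m] M_antimono[of 1 m] by (auto simp: m_def)
  then have WM: "W \<subseteq> M 1" unfolding W_def by (intro ideal_sum_least M_ideal torsion_le_M)
  have KW: "K \<subseteq> W" using K_le_torsion tW by blast
  define A where "A l = {x. \<forall>b\<in>M l. b * x \<in> W}" for l
  have A: "cr.subspace (A l)" for l
    unfolding A_def by (rule cr.subspaceI)
      (auto simp: distrib_left mult.left_commute cr.subspace_0 cr.subspace_add W subspace_mult_left)
  have A_mono: "A l \<subseteq> A l'" if "l \<le> l'" for l l'
    unfolding A_def using M_antimono[OF that] by blast
  define H where "H = (\<Union>l. A l)"
  have "cr.subspace H"
  proof (rule cr.subspaceI)
    show "0 \<in> H" unfolding H_def using cr.subspace_0[OF A] by blast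
  next
    fix x y assume "x \<in> H" "y \<in> H"
    then obtain l l' where "x \<in> A l" "y \<in> A l'" by (auto simp: H_def)
    then have "x \<in> A (max l l')" "y \<in> A (max l l')" using A_mono by (meson max.cobounded1 max.cobounded2 subsetD)+
    then show "x + y \<in> H" unfolding H_def using cr.subspace_add[OF A] by blast
  next
    fix c x assume "x \<in> H" then show "c * x \<in> H" unfolding H_def using subspace_mult_left[OF A] by blast
  qed
  moreover have KA: "K \<subseteq> A l" for l
    unfolding A_def using KW subspace_mult_left[OF W] by blast
  then have "K \<subseteq> H" unfolding H_def by blast
  ultimately obtain F where F: "finite F" "H = cr.span (F \<union> K)" using fin_gen by blast
  have "\<exists>J. F \<subseteq> A J"
  proof -
    have "F \<subseteq> H" using F(2) cr.span_superset by blast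
    with F(1) show ?thesis
    proof (induction F rule: finite_induct)
      case (insert x F)
      then obtain J l where "F \<subseteq> A J" "x \<in> A l" by (auto simp: H_def)
      then have "insert x F \<subseteq> A (max J l)" using A_mono[of J "max J l"] A_mono[of l "max J l"] by auto
      then show ?case by blast
    qed auto
  qed
  then obtain J where "F \<subseteq> A J" by blast
  then have HJ: "H \<subseteq> A J" unfolding F(2) using KA by (intro cr.span_minimal A) auto
  have "of_nat N * x \<in> W" if x: "x \<in> M J" for x
  proof (rule ideal_closed[OF W KW])
    fix l
    obtain n :: nat and u d l' where
      u: "\<And>j. j < n \<Longrightarrow> additive_mod (p ^ m) UNIV (u j)"
         "\<And>j x. j < n \<Longrightarrow> x \<in> torsion \<union> M l' \<Longrightarrow> int (p ^ m) dvd u j x" and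
      d: "\<And>y. y - (\<Sum>j<n. of_int (u j y) * d j) \<in> ideal_sum (ideal_sum torsion (M l)) (cr.span {of_nat (p ^ m)})"
      using approximate_identity[OF torsion_subspace K_le_torsion, of m l] saturation_saturated[of _ K]
      unfolding torsion_eq by blast
    \<comment> \<open>The Casimir identity controls \<open>w j\<close> only modulo
      \<open>W + M i\<close>; Chevalley's theorem brings it into \<open>H + M l\<close> once
      \<open>i\<close> is large.\<close>
    let ?Q = "\<lambda>i. {y. \<forall>b\<in>M l'. b * y \<in> ideal_sum W (M i)}"
    have WMs: "cr.subspace (ideal_sum W (M k))" for k by (rule ideal_sum_subspace[OF W M_ideal])
    have "\<exists>i. \<forall>j\<ge>i. ?Q j \<subseteq> ideal_sum H (M l)"
    proof (rule chevalley)
      fix k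
      show "cr.subspace (?Q k)"
        by (rule cr.subspaceI) (auto simp: distrib_left mult.left_commute cr.subspace_0[OF WMs]
            cr.subspace_add[OF WMs] subspace_mult_left[OF WMs])
      show "?Q (Suc k) \<subseteq> ?Q k" using ideal_sum_mono[OF order_refl M_Suc_le] by blast
      show "M k \<subseteq> ?Q k" using ideal_sum_right[OF W, of "M k"] subspace_mult_left[OF M_ideal] by blast
      have "(\<Inter>k. ?Q k) \<subseteq> A l'" unfolding A_def using ideal_closed[OF W KW] by blast
      then show "(\<Inter>k. ?Q k) \<subseteq> H" unfolding H_def by blast
    qed
    then obtain i0 where i0: "\<And>j. j \<ge> i0 \<Longrightarrow> ?Q j \<subseteq> ideal_sum H (M l)" by blast
    define i where "i = Max {i0, l', l, 1}"
    have i: "i \<ge> i0" "i \<ge> l'" "i \<ge> l" "i \<ge> 1" unfolding i_def by auto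
    let ?q = "ideal_sum W (M i)" and ?E = "ideal_sum W (M l)"
    have q_M: "?q \<subseteq> M 1" using M_antimono[OF i(4)] WM by (intro ideal_sum_least M_ideal)
    have qE: "?q \<subseteq> ?E" using M_antimono[OF i(3)] by (intro ideal_sum_mono) auto
    have uq: "int (p ^ m) dvd u j x" if j: "j < n" and x: "x \<in> ?q" for j x
    proof -
      obtain w where w: "w \<in> W" "x - w \<in> M i" using x by (auto simp: ideal_sum_def)
      then obtain t where t: "t \<in> torsion" "w - t \<in> cr.span {of_nat (p ^ m)}" by (auto simp: W_def ideal_sum_def)
      then obtain c where c: "w - t = c * of_nat (p ^ m)" by (auto simp: cr.span_singleton)
      have sub: "add_subgroup (UNIV :: 'a set)" by (simp add: add_subgroup_def)
      have 1: "int (p ^ m) dvd u j (x - w)" using u(2)[OF j] w(2) M_antimono[OF i(2)] by blast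
      have 2: "int (p ^ m) dvd u j t" using u(2)[OF j] t by blast
      have 3: "int (p ^ m) dvd u j (of_nat (p ^ m) * c)"
        using dvd_add[OF additive_mod_of_nat[OF u(1)[OF j] sub, of c "p ^ m"] dvd_triv_left[of _ "u j c"]] by simp
      have "int (p ^ m) dvd u j ((x - w) + (t + of_nat (p ^ m) * c))"
        by (intro additive_mod_dvd_add[OF u(1)[OF j]] 1 2 3)
      moreover have "x = (x - w) + (t + of_nat (p ^ m) * c)" using c by (simp add: algebra_simps)
      ultimately show ?thesis by metis
    qed
    have E_le: "ideal_sum (ideal_sum torsion (M l)) (cr.span {of_nat (p ^ m)}) \<subseteq> ?E"
      using ideal_sum_left[OF M_ideal, of W l] ideal_sum_right[OF W, of "M l"] tW pW
      by (intro ideal_sum_least WMs) auto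
    have "\<exists>w. (\<Sum>j<n. w j * d j) - of_nat N \<in> ideal_sum ?q ?E \<and>
      (\<forall>j<n. \<forall>b. (\<forall>t. int (p ^ m) dvd u j (b * t)) \<longrightarrow> b * w j \<in> ?q)"
    proof (rule casimir_approximation[OF WMs _ q_M _ u(1) uq _ WMs])
      show "M i \<subseteq> ?q" by (rule ideal_sum_right[OF W])
      show "cr.span {of_nat (p ^ m)} \<subseteq> ?q" using ideal_sum_left[OF M_ideal, of W i] pW by blast
      show "y - (\<Sum>j<n. of_int (u j y) * d j) \<in> ?E" for y using d E_le by blast
    qed
    then obtain w where w: "(\<Sum>j<n. w j * d j) - of_nat N \<in> ideal_sum ?q ?E"
      "\<And>j b. j < n \<Longrightarrow> (\<And>t. int (p ^ m) dvd u j (b * t)) \<Longrightarrow> b * w j \<in> ?q" by blast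
    have "x * w j \<in> ?E" if j: "j < n" for j
    proof -
      have "w j \<in> ?Q i"
        using w(2)[OF j] u(2)[OF j] subspace_mult_right[OF M_ideal] by blast
      then have "w j \<in> ideal_sum H (M l)" using i0[OF i(1)] by blast
      then obtain h where h: "h \<in> H" "w j - h \<in> M l" by (auto simp: ideal_sum_def)
      have "x * h \<in> W" using HJ h(1) x by (auto simp: A_def)
      from ideal_sumI[OF this subspace_mult_left[OF M_ideal h(2), of x]] show ?thesis
        by (simp add: algebra_simps)
    qed
    then have "(\<Sum>j<n. x * w j * d j) \<in> ?E"
      by (intro cr.subspace_sum[OF WMs]) (blast intro: subspace_mult_right[OF WMs])
    moreover have "ideal_sum ?q ?E \<subseteq> ?E" by (rule ideal_sum_least[OF WMs qE order_refl])
    then have "x * ((\<Sum>j<n. w j * d j) - of_nat N) \<in> ?E" using w(1) subspace_mult_left[OF WMs] by blast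
    ultimately have "(\<Sum>j<n. x * w j * d j) - x * ((\<Sum>j<n. w j * d j) - of_nat N) \<in> ?E"
      by (rule cr.subspace_diff[OF WMs])
    moreover have "(\<Sum>j<n. x * w j * d j) - x * ((\<Sum>j<n. w j * d j) - of_nat N) = of_nat N * x"
      by (simp add: algebra_simps sum_distrib_left)
    ultimately show "of_nat N * x \<in> ?E" by simp
  qed
  moreover have "x \<in> ideal_sum torsion (cr.span {of_nat p})" if xW: "of_nat N * x \<in> W" for x
  proof -
    obtain t where t: "t \<in> torsion" "of_nat N * x - t \<in> cr.span {of_nat (p ^ m)}"
      using xW by (auto simp: W_def ideal_sum_def)
    then obtain c where "of_nat N * x - t = c * of_nat (p ^ m)" by (auto simp: cr.span_singleton)
    then have "t = of_nat (p ^ s) * (of_nat u0 * x - of_nat p * c)"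
      by (simp add: su m_def algebra_simps)
    then have t': "of_nat u0 * x - of_nat p * c \<in> torsion"
      using t(1) saturation_power unfolding torsion_eq by metis
    have "coprime (int p) (int u0)" using su(2) p by (simp add: prime_imp_coprime)
    then obtain a b where "a * int p + b * int u0 = 1" using bezout_int by (metis coprime_iff_gcd_eq_1)
    then have "of_int (a * int p + b * int u0) * x = x" by simp
    then have "x = of_int b * (of_nat u0 * x - of_nat p * c) + (of_int a * x + of_int b * c) * of_nat p"
      by (simp add: algebra_simps)
    moreover have "(of_int a * x + of_int b * c) * of_nat p \<in> cr.span {of_nat p}"
      by (auto simp: cr.span_singleton)
    ultimately show ?thesis using ideal_sumI subspace_mult_left[OF torsion_subspace t'] by metis
  qed
  ultimately show ?thesis by blast
qed

text \<open>\<open>P\<close> is the saturation of the ideal of \<open>x\<close>, so the functions of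
  an approximate identity for \<open>P\<close> vanish on multiples of \<open>x\<close>, and
  \<open>x\<close> kills the \<open>w j\<close>. Since \<open>N\<close> is
  \<open>\<Sum> w j * d j\<close> up to \<open>P\<close>, multiplication by \<open>x\<close> puts
  \<open>N x\<close> into \<open>x P\<close>, and a power of \<open>p\<close> moves \<open>P\<close>
  into the multiples of \<open>x\<close>.\<close>

theorem von_neumann_regular: "\<exists>r c. of_nat (p ^ r * N) * x - c * x * x \<in> K"
proof -
  define P where "P = saturation (cr.span (insert x K))"
  have P: "cr.subspace P" unfolding P_def by (rule saturation_subspace[OF cr.subspace_span])
  have spP: "cr.span (insert x K) \<subseteq> P" unfolding P_def by (rule saturation_superset)
  have KP: "K \<subseteq> P" and xP: "x \<in> P" using spP cr.span_superset[of "insert x K"] by auto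
  define I where "I = {y. \<exists>q\<in>P. y - x * q \<in> K}"
  have I: "cr.subspace I"
  proof (rule cr.subspaceI)
    show "0 \<in> I" unfolding I_def using cr.subspace_0[OF P] cr.subspace_0[OF K_ideal] by (auto intro!: bexI[of _ 0])
  next
    fix y z assume "y \<in> I" "z \<in> I"
    then obtain q r where qr: "q \<in> P" "y - x * q \<in> K" "r \<in> P" "z - x * r \<in> K" by (auto simp: I_def)
    have "(y - x * q) + (z - x * r) \<in> K" by (rule cr.subspace_add[OF K_ideal qr(2,4)])
    then show "y + z \<in> I"
      unfolding I_def using cr.subspace_add[OF P qr(1,3)] by (auto intro!: bexI[of _ "q + r"] simp: algebra_simps)
  next
    fix c y assume "y \<in> I"
    then obtain q where q: "q \<in> P" "y - x * q \<in> K" by (auto simp: I_def)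
    have "c * (y - x * q) \<in> K" by (rule subspace_mult_left[OF K_ideal q(2)])
    then show "c * y \<in> I"
      unfolding I_def using subspace_mult_left[OF P q(1), of c] by (auto intro!: bexI[of _ "c * q"] simp: algebra_simps)
  qed
  have KI: "K \<subseteq> I" unfolding I_def using cr.subspace_0[OF P] by (auto intro!: bexI[of _ 0])
  have "of_nat N * x \<in> I"
  proof (rule ideal_closed[OF I KI])
    fix l
    \<comment> \<open>Puts \<open>p ^ m\<close> into \<open>M l\<close> and, even for
      \<open>l = 0\<close>, into \<open>M 1\<close>.\<close>
    define m where "m = Suc l"
    have ml: "M m \<subseteq> M 1" "M m \<subseteq> M l" unfolding m_def by (auto intro!: M_antimono simp: subset_iff)
        (metis M_antimono Suc_le_mono le0 subsetD One_nat_def, metis M_Suc_le subsetD)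
    have "\<exists>(n::nat) u d l'.
      (\<forall>j<n. additive_mod (p ^ m) UNIV (u j) \<and> (\<forall>x\<in>P \<union> M l'. int (p ^ m) dvd u j x)) \<and>
      (\<forall>y. y - (\<Sum>j<n. of_int (u j y) * d j) \<in> ideal_sum (ideal_sum P (M l)) (cr.span {of_nat (p ^ m)}))"
      by (rule approximate_identity[OF P KP]) (simp add: P_def saturation_saturated)
    then obtain n :: nat and u d l' where
      u: "\<And>j. j < n \<Longrightarrow> additive_mod (p ^ m) UNIV (u j)"
         "\<And>j x. j < n \<Longrightarrow> x \<in> P \<union> M l' \<Longrightarrow> int (p ^ m) dvd u j x" and
      d: "\<And>y. y - (\<Sum>j<n. of_int (u j y) * d j) \<in> ideal_sum (ideal_sum P (M l)) (cr.span {of_nat (p ^ m)})"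
      by blast
    define i where "i = max l' m"
    let ?p = "cr.span {of_nat (p ^ m) :: 'a}"
    let ?q = "ideal_sum (M i) ?p" and ?E = "ideal_sum P (M l)" and ?F = "ideal_sum I (M l)"
    have q: "cr.subspace ?q" by (intro ideal_sum_subspace M_ideal cr.subspace_span)
    have E: "cr.subspace ?E" by (intro ideal_sum_subspace M_ideal P)
    have F: "cr.subspace ?F" by (intro ideal_sum_subspace M_ideal I)
    have pM: "?p \<subseteq> M m" by (rule span_p_power_le)
    have iM: "M i \<subseteq> M m" "M i \<subseteq> M l'" unfolding i_def by (intro M_antimono; simp)+
    have qM: "?q \<subseteq> M m" by (intro ideal_sum_least M_ideal pM iM)
    have uq: "int (p ^ m) dvd u j y" if j: "j < n" and y: "y \<in> ?q" for j y
    proof -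
      obtain w where w: "w \<in> M i" "y - w \<in> ?p" using y by (auto simp: ideal_sum_def)
      then obtain c where c: "y - w = c * of_nat (p ^ m)" by (auto simp: cr.span_singleton)
      have sub: "add_subgroup (UNIV :: 'a set)" by (simp add: add_subgroup_def)
      have "int (p ^ m) dvd u j (of_nat (p ^ m) * c)"
        using dvd_add[OF additive_mod_of_nat[OF u(1)[OF j] sub, of c "p ^ m"] dvd_triv_left[of _ "u j c"]] by simp
      moreover have "int (p ^ m) dvd u j w" using u(2)[OF j] w(1) iM by blast
      ultimately have "int (p ^ m) dvd u j (w + of_nat (p ^ m) * c)"
        by (intro additive_mod_dvd_add[OF u(1)[OF j]])
      moreover have "y = w + of_nat (p ^ m) * c" using c by (simp add: algebra_simps)
      ultimately show ?thesis by metis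
    qed
    have "\<exists>w. (\<Sum>j<n. w j * d j) - of_nat N \<in> ideal_sum ?q ?E \<and>
      (\<forall>j<n. \<forall>b. (\<forall>t. int (p ^ m) dvd u j (b * t)) \<longrightarrow> b * w j \<in> ?q)"
    proof (rule casimir_approximation[OF q _ _ _ u(1) uq _ E])
      show "M i \<subseteq> ?q" by (rule ideal_sum_left[OF cr.subspace_span])
      show "?q \<subseteq> M 1" using qM ml by blast
      show "?p \<subseteq> ?q" by (rule ideal_sum_right[OF M_ideal])
      have "?p \<subseteq> ?E" using pM ml ideal_sum_right[OF P, of "M l"] by blast
      then have "ideal_sum ?E ?p \<subseteq> ?E" by (rule ideal_sum_least[OF E order_refl])
      then show "y - (\<Sum>j<n. of_int (u j y) * d j) \<in> ?E" for y using d by blast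
    qed
    then obtain w where w: "(\<Sum>j<n. w j * d j) - of_nat N \<in> ideal_sum ?q ?E"
      "\<And>j b. j < n \<Longrightarrow> (\<And>t. int (p ^ m) dvd u j (b * t)) \<Longrightarrow> b * w j \<in> ?q" by blast
    have "x * w j \<in> ?F" if j: "j < n" for j
    proof -
      have "x * w j \<in> ?q" using w(2)[OF j] u(2)[OF j] subspace_mult_right[OF P xP] by blast
      then show ?thesis using qM ml ideal_sum_right[OF I, of "M l"] by blast
    qed
    then have 1: "(\<Sum>j<n. x * w j * d j) \<in> ?F"
      by (intro cr.subspace_sum[OF F]) (blast intro: subspace_mult_right[OF F])
    have 2: "x * z \<in> ?F" if z: "z \<in> ideal_sum ?q ?E" for z
    proof -
      have "?q \<subseteq> ?E" using qM ml ideal_sum_right[OF P, of "M l"] by blast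
      then have "ideal_sum ?q ?E \<subseteq> ?E" by (rule ideal_sum_least[OF E _ order_refl])
      then obtain y where y: "y \<in> P" "z - y \<in> M l" using z unfolding ideal_sum_def[of P] by blast
      have "x * y \<in> I" unfolding I_def using y(1) cr.subspace_0[OF K_ideal] by (auto intro!: bexI[of _ y])
      from ideal_sumI[OF this subspace_mult_left[OF M_ideal y(2), of x]] show ?thesis by (simp add: algebra_simps)
    qed
    have "(\<Sum>j<n. x * w j * d j) - x * ((\<Sum>j<n. w j * d j) - of_nat N) \<in> ?F"
      by (rule cr.subspace_diff[OF F 1 2[OF w(1)]])
    moreover have "(\<Sum>j<n. x * w j * d j) - x * ((\<Sum>j<n. w j * d j) - of_nat N) = of_nat N * x"
      by (simp add: algebra_simps sum_distrib_left)
    ultimately show "of_nat N * x \<in> ?F" by simp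
  qed
  then obtain q where q: "q \<in> P" "of_nat N * x - x * q \<in> K" by (auto simp: I_def)
  then obtain r where "of_nat (p ^ r) * q \<in> cr.span (insert x K)" by (auto simp: P_def saturation_def)
  then obtain c where c: "of_nat (p ^ r) * q - c * x \<in> K"
    using K_ideal by (auto simp: cr.span_breakdown_eq cr.span_eq_iff[THEN iffD2])
  have "of_nat (p ^ r) * (of_nat N * x - x * q) + x * (of_nat (p ^ r) * q - c * x) \<in> K"
    by (intro cr.subspace_add[OF K_ideal] subspace_mult_left[OF K_ideal] q(2) c)
  moreover have "of_nat (p ^ r) * (of_nat N * x - x * q) + x * (of_nat (p ^ r) * q - c * x)
      = of_nat (p ^ r * N) * x - c * x * x"
    by (simp add: algebra_simps)
  ultimately show ?thesis by metis
qed

end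

section \<open>Finite quotients as test objects\<close>

text \<open>The bridge from ring records to type-class rings: ideals of \<open>B\<close> correspond
  to \<open>cr.subspace\<close> sets containing the kernel of \<open>q\<close>, and statements about
  \<open>B\<close> are read off on preimages.\<close>

locale presentation = cring B for B :: "('b, 'm) ring_scheme" (structure) +
  fixes q :: "'r::comm_ring_1 \<Rightarrow> 'b"
  assumes q_add: "q (x + y) = q x \<oplus> q y"
    and q_mult: "q (x * y) = q x \<otimes> q y"
    and q_one: "q 1 = \<one>"
    and q_range: "range q = carrier B"
begin

lemma q_closed [simp]: "q x \<in> carrier B"
  using q_range by blast

lemma q_zero: "q 0 = \<zero>"
  using q_add[of 0 0] by simp

lemma q_uminus: "q (- x) = \<ominus> q x"
  using q_add[of "- x" x] q_zero by (simp add: minus_equality)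

lemma q_diff: "q (x - y) = q x \<ominus> q y"
  using q_add[of x "- y"] by (simp add: q_uminus a_minus_def)

lemma q_sum: "q (sum f A) = (\<Oplus>x\<in>A. q (f x))"
  by (induction A rule: infinite_finite_induct) (auto simp: q_zero q_add)

lemma q_power: "q (x ^ n) = q x [^] n"
  by (induction n) (auto simp: q_one q_mult power_Suc2 simp del: power_Suc)

lemma q_of_nat: "q (of_nat n) = add_pow B n \<one>"
  by (induction n) (auto simp: q_zero q_add q_one add.m_comm)

lemma q_of_nat_mult: "q (of_nat n * x) = add_pow B n (q x)"
  by (simp add: q_mult q_of_nat add_pow_ldistr)

lemma q_eq_iff: "q x = q y \<longleftrightarrow> q (x - y) = \<zero>"
  by (simp add: q_diff)

lemma obtain_preimage: assumes "y \<in> carrier B" obtains x where "q x = y"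
proof -
  have "y \<in> range q" using assms q_range by simp
  then show thesis using that by blast
qed

lemma ideal_vimage:
  assumes "ideal I B" shows "cr.subspace (q -` I)"
proof -
  interpret I: ideal I B by fact
  show ?thesis
    by (rule cr.subspaceI) (auto simp: q_zero q_add q_mult I.I_l_closed)
qed

lemma ideal_image:
  assumes "cr.subspace J" shows "ideal (q ` J) B"
proof (rule idealI)
  show "subgroup (q ` J) (add_monoid B)"
  proof (rule add.subgroupI)
    show "q ` J \<subseteq> carrier B" "q ` J \<noteq> {}" using cr.subspace_0[OF assms] by auto
    fix a assume "a \<in> q ` J"
    then obtain x where "a = q x" "x \<in> J" by blast
    then have "\<ominus> a = q (- x)" "- x \<in> J" using cr.subspace_neg[OF assms] by (auto simp: q_uminus)
    then show "\<ominus> a \<in> q ` J" by blast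
    fix b assume "b \<in> q ` J"
    then obtain y where "b = q y" "y \<in> J" by blast
    then have "a \<oplus> b = q (x + y)" "x + y \<in> J"
      using \<open>a = q x\<close> \<open>x \<in> J\<close> cr.subspace_add[OF assms] by (auto simp: q_add)
    then show "a \<oplus> b \<in> q ` J" by blast
  qed
  fix a x assume "a \<in> q ` J" "x \<in> carrier B"
  then obtain y z where "a = q y" "y \<in> J" "x = q z" using q_range by blast
  then have "x \<otimes> a = q (z * y)" "z * y \<in> J" "a \<otimes> x = q (y * z)" "y * z \<in> J"
    using subspace_mult_left[OF assms] subspace_mult_right[OF assms] by (auto simp: q_mult)
  then show "x \<otimes> a \<in> q ` J" "a \<otimes> x \<in> q ` J" by blast+
qed (rule ring_axioms)

lemma image_vimage: "I \<subseteq> carrier B \<Longrightarrow> q ` (q -` I) = I"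
  by (simp add: image_vimage_eq q_range inf_absorb1)

lemma vimage_span:
  assumes "A \<subseteq> carrier B" "q ` F = A"
  shows "q -` (Idl A) = cr.span (F \<union> q -` {\<zero>})"
proof
  have K: "cr.subspace (q -` {\<zero>})" using ideal_vimage[OF zeroideal] .
  have "ideal (q ` cr.span (F \<union> q -` {\<zero>})) B" by (rule ideal_image[OF cr.subspace_span])
  moreover have "A \<subseteq> q ` cr.span (F \<union> q -` {\<zero>})" using assms(2) cr.span_superset[of "F \<union> q -` {\<zero>}"] by blast
  ultimately have "Idl A \<subseteq> q ` cr.span (F \<union> q -` {\<zero>})" by (rule genideal_minimal)
  show "q -` (Idl A) \<subseteq> cr.span (F \<union> q -` {\<zero>})"
  proof
    fix x assume "x \<in> q -` (Idl A)"
    then obtain y where y: "q x = q y" "y \<in> cr.span (F \<union> q -` {\<zero>})"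
      using \<open>Idl A \<subseteq> _\<close> by blast
    then have "x - y \<in> q -` {\<zero>}" by (simp add: q_eq_iff)
    then have "x - y \<in> cr.span (F \<union> q -` {\<zero>})" by (intro cr.span_base) auto
    from cr.span_add[OF this y(2)] show "x \<in> cr.span (F \<union> q -` {\<zero>})" by simp
  qed
  have "F \<union> q -` {\<zero>} \<subseteq> q -` (Idl A)"
    using genideal_self[OF assms(1)] assms(2) additive_subgroup.zero_closed[OF ideal.axioms(1)[OF genideal_ideal[OF assms(1)]]]
    by auto
  then show "cr.span (F \<union> q -` {\<zero>}) \<subseteq> q -` (Idl A)"
    by (intro cr.span_minimal ideal_vimage genideal_ideal assms)
qed

lemma noetherian_vimage:
  assumes "noetherian_ring B" "cr.subspace I" "q -` {\<zero>} \<subseteq> I"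
  shows "\<exists>F. finite F \<and> I = cr.span (F \<union> q -` {\<zero>})"
proof -
  obtain A where A: "A \<subseteq> carrier B" "finite A" "q ` I = Idl A"
    using noetherian_ring.finetely_gen[OF assms(1) ideal_image[OF assms(2)]] by blast
  obtain F where F: "finite F" "q ` F = A"
    using finite_subset_image[OF A(2), of q UNIV] A(1) q_range by auto
  have "x \<in> I" if "q x \<in> q ` I" for x
  proof -
    obtain y where y: "y \<in> I" "q x = q y" using \<open>q x \<in> _\<close> by blast
    then have "x - y \<in> I" using assms(3) by (auto simp: q_eq_iff)
    from cr.subspace_add[OF assms(2) this y(1)] show ?thesis by simp
  qed
  then have "I = q -` (Idl A)" using A(3) by blast
  then show ?thesis using vimage_span[OF A(1) F(2)] F(1) by auto
qed

lemma ideal_prod_vimage: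
  assumes "ideal I B" "ideal J B"
  shows "q -` (I \<cdot> J) = cr.span ({x * y |x y. x \<in> q -` I \<and> y \<in> q -` J} \<union> q -` {\<zero>})" (is "_ = cr.span ?S")
proof
  note IJ = ideal_prod_is_ideal[OF assms]
  have "?S \<subseteq> q -` (I \<cdot> J)"
    using additive_subgroup.zero_closed[OF ideal.axioms(1)[OF IJ]] by (auto simp: q_mult intro: ideal_prod.prod)
  then show "cr.span ?S \<subseteq> q -` (I \<cdot> J)" by (intro cr.span_minimal ideal_vimage IJ)
  have "\<exists>x\<in>cr.span ?S. q x = z" if "z \<in> I \<cdot> J" for z
    using that
  proof induction
    case (prod i j)
    obtain x y where "q x = i" "q y = j" using prod assms ideal.Icarr q_range by (metis rangeE)
    then show ?case using prod by (intro bexI[of _ "x * y"] cr.span_base) (auto simp: q_mult)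
  next
    case (sum s1 s2)
    then obtain x y where "x \<in> cr.span ?S" "q x = s1" "y \<in> cr.span ?S" "q y = s2" by blast
    then show ?case by (intro bexI[of _ "x + y"]) (auto simp: q_add intro: cr.span_add)
  qed
  then show "q -` (I \<cdot> J) \<subseteq> cr.span ?S"
  proof (intro subsetI)
    fix x assume "x \<in> q -` (I \<cdot> J)"
    then obtain y where y: "y \<in> cr.span ?S" "q y = q x" using \<open>\<And>z. z \<in> I \<cdot> J \<Longrightarrow> _\<close> by auto
    then have "x - y \<in> cr.span ?S" by (intro cr.span_base) (auto simp: q_eq_iff[symmetric])
    from cr.span_add[OF this y(1)] show "x \<in> cr.span ?S" by simp
  qed
qed

lemma max_ideal_pow_0 [simp]: "max_ideal_pow B 0 = carrier B"
  by (simp add: max_ideal_pow_def ideals_set_def nat_pow_def)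

lemma max_ideal_pow_Suc: "max_ideal_pow B (Suc n) = max_ideal_pow B n \<cdot> max_ideal B"
  by (simp add: max_ideal_pow_def ideals_set_def nat_pow_def)

lemma max_ideal_pow_ideal: "ideal (max_ideal B) B \<Longrightarrow> ideal (max_ideal_pow B n) B"
  by (induction n) (simp_all add: oneideal max_ideal_pow_Suc ideal_prod_is_ideal)

lemma max_ideal_pow_Suc_le: "ideal (max_ideal B) B \<Longrightarrow> max_ideal_pow B (Suc n) \<subseteq> max_ideal_pow B n"
  unfolding max_ideal_pow_Suc using ideal_prod_inter[OF max_ideal_pow_ideal] by blast

end

lemma local_max_ideal:
  assumes "local_cring A" shows "maximalideal (max_ideal A) A"
    "\<And>M. maximalideal M A \<Longrightarrow> M = max_ideal A"
proof -
  have ex: "\<exists>!M. maximalideal M A" using assms by (simp add: local_cring_def)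
  show "maximalideal (max_ideal A) A" unfolding max_ideal_def by (rule theI'[OF ex])
  then show "\<And>M. maximalideal M A \<Longrightarrow> M = max_ideal A" using ex by blast
qed

text \<open>Cosets are coded by values of \<open>q\<close>. The carrier type is
  \<open>nat set\<close> because representability is formulated for objects of that type.\<close>

definition quotient_coeff_ring ::
  "('r::comm_ring_1 \<Rightarrow> nat set) \<Rightarrow> ('r \<Rightarrow> 'k) \<Rightarrow> ((nat \<Rightarrow> 'k) \<Rightarrow> 'r) \<Rightarrow> (nat set, 'k) coeff_ring" where
  "quotient_coeff_ring q \<rho> \<omega> =
    \<lparr>carrier = range q, monoid.mult = (\<lambda>x y. q (inv_into UNIV q x * inv_into UNIV q y)), one = q 1,
     ring.zero = q 0, ring.add = (\<lambda>x y. q (inv_into UNIV q x + inv_into UNIV q y)),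
     residue = (\<lambda>x. \<rho> (inv_into UNIV q x)), witt_map = (\<lambda>w. q (\<omega> w))\<rparr>"

text \<open>The ideals \<open>c i\<close> stand in for powers of the maximal ideal:
  \<open>c_mult\<close> forces them to contain those powers, and \<open>c_e\<close> makes the
  maximal ideal nilpotent. Locality and completeness of the quotient rest on this.\<close>

locale finite_quotient =
  fixes p :: nat and k :: "'k ring" and s :: "'r::comm_ring_1 set" and q :: "'r \<Rightarrow> nat set"
    and \<rho> :: "'r \<Rightarrow> 'k" and \<omega> :: "(nat \<Rightarrow> 'k) \<Rightarrow> 'r" and c :: "nat \<Rightarrow> 'r set" and e :: nat
  assumes k: "field k"
    and s: "cr.subspace s"
    and q_iff: "q x = q y \<longleftrightarrow> x - y \<in> s"
    and q_finite: "finite (range q)"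
    and \<rho>_add: "\<rho> (x + y) = \<rho> x \<oplus>\<^bsub>k\<^esub> \<rho> y"
    and \<rho>_mult: "\<rho> (x * y) = \<rho> x \<otimes>\<^bsub>k\<^esub> \<rho> y"
    and \<rho>_one: "\<rho> 1 = \<one>\<^bsub>k\<^esub>"
    and \<rho>_range: "range \<rho> = carrier k"
    and \<rho>_s: "x \<in> s \<Longrightarrow> \<rho> x = \<zero>\<^bsub>k\<^esub>"
    and c_0: "c 0 = UNIV"
    and c_ideal: "cr.subspace (c i)"
    and c_mult: "\<rho> x = \<zero>\<^bsub>k\<^esub> \<Longrightarrow> y \<in> c i \<Longrightarrow> x * y \<in> c (Suc i)"
    and c_e: "c e \<subseteq> s"
    and \<omega>_add: "v \<in> carrier (witt_ring p k) \<Longrightarrow> w \<in> carrier (witt_ring p k) \<Longrightarrow>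
      \<omega> (v \<oplus>\<^bsub>witt_ring p k\<^esub> w) - (\<omega> v + \<omega> w) \<in> s"
    and \<omega>_mult: "v \<in> carrier (witt_ring p k) \<Longrightarrow> w \<in> carrier (witt_ring p k) \<Longrightarrow>
      \<omega> (v \<otimes>\<^bsub>witt_ring p k\<^esub> w) - \<omega> v * \<omega> w \<in> s"
    and \<omega>_one: "\<omega> \<one>\<^bsub>witt_ring p k\<^esub> - 1 \<in> s"
    and \<omega>_\<rho>: "w \<in> carrier (witt_ring p k) \<Longrightarrow> \<rho> (\<omega> w) = w 0"
begin

abbreviation S where "S \<equiv> quotient_coeff_ring q \<rho> \<omega>"

lemma q_inv [simp]: "q (inv_into UNIV q (q x)) = q x"
  by (simp add: f_inv_into_f)

lemma S_simps:
  "carrier S = range q" "q x \<otimes>\<^bsub>S\<^esub> q y = q (x * y)" "\<one>\<^bsub>S\<^esub> = q 1"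
  "\<zero>\<^bsub>S\<^esub> = q 0" "q x \<oplus>\<^bsub>S\<^esub> q y = q (x + y)"
proof -
  have x: "x' - x \<in> s" if "q x' = q x" for x' x using that q_iff by blast
  have "inv_into UNIV q (q x) * inv_into UNIV q (q y) - x * y = (inv_into UNIV q (q x) - x) * inv_into UNIV q (q y) + x * (inv_into UNIV q (q y) - y)"
    by (simp add: algebra_simps)
  also have "\<dots> \<in> s"
    using x by (intro cr.subspace_add[OF s] subspace_mult_left[OF s] subspace_mult_right[OF s]) auto
  finally show "q x \<otimes>\<^bsub>S\<^esub> q y = q (x * y)" by (simp add: quotient_coeff_ring_def q_iff)
  have "inv_into UNIV q (q x) + inv_into UNIV q (q y) - (x + y) = (inv_into UNIV q (q x) - x) + (inv_into UNIV q (q y) - y)"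
    by (simp add: algebra_simps)
  also have "\<dots> \<in> s" using x by (intro cr.subspace_add[OF s]) auto
  finally show "q x \<oplus>\<^bsub>S\<^esub> q y = q (x + y)" by (simp add: quotient_coeff_ring_def q_iff)
qed (simp_all add: quotient_coeff_ring_def)

lemma S_cring: "cring S"
proof (rule cringI)
  show "abelian_group S"
  proof (rule abelian_groupI)
    fix x assume "x \<in> carrier S"
    then obtain a where a: "x = q a" by (auto simp: S_simps)
    show "\<exists>y\<in>carrier S. y \<oplus>\<^bsub>S\<^esub> x = \<zero>\<^bsub>S\<^esub>"
      by (rule bexI[of _ "q (- a)"]) (auto simp: a S_simps)
  qed (auto simp: S_simps add.assoc add.commute add.left_commute)
  show "comm_monoid S"
    by (rule comm_monoidI) (auto simp: S_simps mult.assoc mult.commute mult.left_commute)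
qed (auto simp: S_simps distrib_right)

sublocale S: presentation S q
  by (intro presentation.intro S_cring presentation_axioms.intro) (auto simp: S_simps)

lemma field_presentation: "presentation k \<rho>"
proof -
  interpret field k by (rule k)
  show ?thesis by unfold_locales (auto simp: \<rho>_add \<rho>_mult \<rho>_one \<rho>_range)
qed

interpretation \<rho>: presentation k \<rho> by (rule field_presentation)

lemma residue_q [simp]: "residue S (q x) = \<rho> x"
proof -
  have "inv_into UNIV q (q x) - x \<in> s" using q_iff[of "inv_into UNIV q (q x)" x] by simp
  then have "\<rho> (inv_into UNIV q (q x) - x) = \<zero>\<^bsub>k\<^esub>" by (rule \<rho>_s)
  then show ?thesis by (simp add: quotient_coeff_ring_def \<rho>.q_diff)
qed

lemma residue_hom: "residue S \<in> Ring.ring_hom S k"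
proof (rule ring_hom_memI)
  fix x assume "x \<in> carrier S"
  then obtain a where a: "q a = x" by (rule S.obtain_preimage)
  show "residue S x \<in> carrier k" by (simp add: a[symmetric])
  fix y assume "y \<in> carrier S"
  then obtain b where b: "q b = y" by (rule S.obtain_preimage)
  show "residue S (x \<otimes>\<^bsub>S\<^esub> y) = residue S x \<otimes>\<^bsub>k\<^esub> residue S y"
    "residue S (x \<oplus>\<^bsub>S\<^esub> y) = residue S x \<oplus>\<^bsub>k\<^esub> residue S y"
    by (simp_all only: a[symmetric] b[symmetric] S_simps(2,5) residue_q \<rho>_add \<rho>_mult)
qed (simp only: S_simps(3) residue_q \<rho>_one)

lemma residue_range: "residue S ` carrier S = carrier k"
  unfolding S_simps(1) \<rho>_range[symmetric] image_image by simp

lemma power_in_c: "\<rho> x = \<zero>\<^bsub>k\<^esub> \<Longrightarrow> x ^ i \<in> c i"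
  by (induction i) (auto simp: c_0 c_mult)

lemma unit_mod_s:
  assumes "\<rho> x \<noteq> \<zero>\<^bsub>k\<^esub>" obtains y where "x * y - 1 \<in> s"
proof -
  have u: "\<rho> x \<in> Units k" using assms by (simp add: field.field_Units[OF k])
  obtain y where "\<rho> y = inv\<^bsub>k\<^esub> \<rho> x" using \<rho>.obtain_preimage[OF \<rho>.Units_inv_closed[OF u]] .
  then have y: "\<rho> x \<otimes>\<^bsub>k\<^esub> \<rho> y = \<one>\<^bsub>k\<^esub>" using \<rho>.Units_r_inv[OF u] by simp
  \<comment> \<open>\<open>z\<close> is nilpotent modulo \<open>s\<close>, so a finite geometric
    series inverts \<open>1 - z = x * y\<close>.\<close>
  define z where "z = 1 - x * y"
  have "\<rho> z = \<zero>\<^bsub>k\<^esub>" unfolding z_def by (simp add: \<rho>.q_diff \<rho>_mult \<rho>_one y)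
  then have "z ^ e \<in> s" using power_in_c c_e by blast
  moreover have "1 - z ^ e = (1 - z) * (\<Sum>i<e. z ^ i)" by (simp add: one_diff_power_eq)
  moreover have "1 - z = x * y" by (simp add: z_def)
  ultimately have "x * (y * (\<Sum>i<e. z ^ i)) = 1 - z ^ e" by (metis mult.assoc)
  then have "x * (y * (\<Sum>i<e. z ^ i)) - 1 = - (z ^ e)" by simp
  then have "x * (y * (\<Sum>i<e. z ^ i)) - 1 \<in> s"
    using cr.subspace_neg[OF s \<open>z ^ e \<in> s\<close>] by simp
  then show thesis by (rule that)
qed

lemma ideal_not_le_ker:
  assumes "ideal I S" "q x \<in> I" "\<rho> x \<noteq> \<zero>\<^bsub>k\<^esub>" shows "I = carrier S"
proof -
  interpret I: ideal I S by fact
  obtain y where "x * y - 1 \<in> s" using unit_mod_s[OF assms(3)] .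
  then have "q x \<otimes>\<^bsub>S\<^esub> q y = \<one>\<^bsub>S\<^esub>" by (simp add: S.q_mult[symmetric] S.q_one[symmetric] q_iff)
  then have "\<one>\<^bsub>S\<^esub> \<in> I" using I.I_r_closed[OF assms(2), of "q y"] by simp
  then show ?thesis by (rule I.one_imp_carrier)
qed

lemma ker_subspace: "cr.subspace {x. \<rho> x = \<zero>\<^bsub>k\<^esub>}"
  using \<rho>.ideal_vimage[OF \<rho>.zeroideal] by (simp add: vimage_def)

lemma maximal_ker: "maximalideal (q ` {x. \<rho> x = \<zero>\<^bsub>k\<^esub>}) S"
proof (rule maximalidealI)
  show "ideal (q ` {x. \<rho> x = \<zero>\<^bsub>k\<^esub>}) S" by (rule S.ideal_image[OF ker_subspace])
  have "\<one>\<^bsub>k\<^esub> \<noteq> \<zero>\<^bsub>k\<^esub>" using k by (metis domain.one_not_zero field.axioms(1))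
  show "carrier S \<noteq> q ` {x. \<rho> x = \<zero>\<^bsub>k\<^esub>}"
  proof
    assume "carrier S = q ` {x. \<rho> x = \<zero>\<^bsub>k\<^esub>}"
    then obtain x where x: "q 1 = q x" "\<rho> x = \<zero>\<^bsub>k\<^esub>" using S.q_closed[of 1] by blast
    then have "\<rho> 1 = \<rho> x" by (metis residue_q)
    then show False using x \<open>\<one>\<^bsub>k\<^esub> \<noteq> \<zero>\<^bsub>k\<^esub>\<close> by (simp add: \<rho>_one)
  qed
  fix J assume J: "ideal J S" "q ` {x. \<rho> x = \<zero>\<^bsub>k\<^esub>} \<subseteq> J" "J \<subseteq> carrier S"
  show "J = q ` {x. \<rho> x = \<zero>\<^bsub>k\<^esub>} \<or> J = carrier S"
  proof (cases "\<exists>x. q x \<in> J \<and> \<rho> x \<noteq> \<zero>\<^bsub>k\<^esub>")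
    case True
    then show ?thesis using ideal_not_le_ker[OF J(1)] by blast
  next
    case False
    then have "J \<subseteq> q ` {x. \<rho> x = \<zero>\<^bsub>k\<^esub>}" using J(3) by (auto simp: S_simps(1))
    then show ?thesis using J(2) by blast
  qed
qed

lemma S_local: "local_cring S" "max_ideal S = q ` {x. \<rho> x = \<zero>\<^bsub>k\<^esub>}"
proof -
  have uniq: "M = q ` {x. \<rho> x = \<zero>\<^bsub>k\<^esub>}" if "maximalideal M S" for M
  proof -
    interpret M: maximalideal M S by fact
    have "M \<subseteq> q ` {x. \<rho> x = \<zero>\<^bsub>k\<^esub>}"
    proof
      fix y assume y: "y \<in> M"
      have "y \<in> range q" using M.Icarr[OF y] by (simp only: S_simps(1))
      then obtain x where x: "y = q x" by blast
      have "\<rho> x = \<zero>\<^bsub>k\<^esub>"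
        using ideal_not_le_ker[OF M.ideal_axioms, of x] M.I_notcarr y x by blast
      then show "y \<in> q ` {x. \<rho> x = \<zero>\<^bsub>k\<^esub>}" using x by blast
    qed
    moreover have "q ` {x. \<rho> x = \<zero>\<^bsub>k\<^esub>} \<subseteq> carrier S" by (auto simp: S_simps(1))
    ultimately have "q ` {x. \<rho> x = \<zero>\<^bsub>k\<^esub>} = M \<or> q ` {x. \<rho> x = \<zero>\<^bsub>k\<^esub>} = carrier S"
      by (intro M.I_maximal S.ideal_image ker_subspace)
    then show ?thesis using maximalideal.I_notcarr[OF maximal_ker] by metis
  qed
  then show "local_cring S"
    unfolding local_cring_def using maximal_ker S_cring by blast
  from local_max_ideal(1)[OF this] show "max_ideal S = q ` {x. \<rho> x = \<zero>\<^bsub>k\<^esub>}" by (rule uniq)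
qed

lemma max_ideal_S: "ideal (max_ideal S) S" "q x \<in> max_ideal S \<longleftrightarrow> \<rho> x = \<zero>\<^bsub>k\<^esub>"
proof -
  show "ideal (max_ideal S) S" unfolding S_local(2) by (rule S.ideal_image[OF ker_subspace])
  show "q x \<in> max_ideal S \<longleftrightarrow> \<rho> x = \<zero>\<^bsub>k\<^esub>"
  proof
    assume "q x \<in> max_ideal S"
    then obtain y where "q x = q y" "\<rho> y = \<zero>\<^bsub>k\<^esub>" unfolding S_local(2) by blast
    then show "\<rho> x = \<zero>\<^bsub>k\<^esub>" using residue_q[of x] by simp
  qed (auto simp: S_local(2))
qed

lemma max_ideal_pow_le: "max_ideal_pow S i \<subseteq> q ` c i"
proof (induction i)
  case 0
  then show ?case by (simp add: c_0 S.q_range)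
next
  case (Suc i)
  have "z \<in> q ` c (Suc i)" if "z \<in> max_ideal_pow S i \<cdot>\<^bsub>S\<^esub> max_ideal S" for z
    using that
  proof induction
    case (prod a b)
    then obtain x y where "a = q x" "x \<in> c i" "b = q y" "\<rho> y = \<zero>\<^bsub>k\<^esub>" using Suc by (auto simp: S_local(2))
    then have "y * x \<in> c (Suc i)" using c_mult by blast
    moreover have "a \<otimes>\<^bsub>S\<^esub> b = q (y * x)" using \<open>a = q x\<close> \<open>b = q y\<close> by (simp add: S_simps mult.commute)
    ultimately show ?case by blast
  next
    case (sum a b)
    then obtain x y where "a = q x" "x \<in> c (Suc i)" "b = q y" "y \<in> c (Suc i)" by blast
    then have "a \<oplus>\<^bsub>S\<^esub> b = q (x + y)" "x + y \<in> c (Suc i)" using cr.subspace_add[OF c_ideal] by (auto simp: S_simps)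
    then show ?case by blast
  qed
  then show ?case unfolding S.max_ideal_pow_Suc by blast
qed

lemma max_ideal_pow_e: "max_ideal_pow S e = {\<zero>\<^bsub>S\<^esub>}"
proof
  show "max_ideal_pow S e \<subseteq> {\<zero>\<^bsub>S\<^esub>}"
  proof
    fix z assume "z \<in> max_ideal_pow S e"
    then obtain x where "z = q x" "x \<in> s" using max_ideal_pow_le[of e] c_e by blast
    then show "z \<in> {\<zero>\<^bsub>S\<^esub>}" by (simp add: S_simps q_iff)
  qed
  show "{\<zero>\<^bsub>S\<^esub>} \<subseteq> max_ideal_pow S e"
    using S.max_ideal_pow_ideal[OF max_ideal_S(1)] by (simp add: additive_subgroup.zero_closed ideal.axioms(1))
qed

text \<open>With a nilpotent maximal ideal, compatible sequences are constant from index
  \<open>e\<close> on, and \<open>x e\<close> is the limit.\<close>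

lemma S_complete: "complete_local S"
  unfolding complete_local_def
proof (intro allI impI)
  fix x :: "nat \<Rightarrow> nat set"
  assume x: "\<forall>n. x n \<in> carrier S \<and> x (Suc n) \<ominus>\<^bsub>S\<^esub> x n \<in> max_ideal_pow S n"
  have pow: "ideal (max_ideal_pow S n) S" for n by (rule S.max_ideal_pow_ideal[OF max_ideal_S(1)])
  have anti: "max_ideal_pow S n \<subseteq> max_ideal_pow S m" if "m \<le> n" for m n
    by (rule lift_Suc_antimono_le[of "max_ideal_pow S", OF S.max_ideal_pow_Suc_le[OF max_ideal_S(1)] that])
  have xc: "x n \<in> carrier S" for n using x by blast
  have tele: "x (n + j) \<ominus>\<^bsub>S\<^esub> x n \<in> max_ideal_pow S n" for n j
  proof (induction j)
    case 0
    have "x n \<ominus>\<^bsub>S\<^esub> x n = \<zero>\<^bsub>S\<^esub>" using xc S.r_right_minus_eq by blast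
    then show ?case using additive_subgroup.zero_closed[OF ideal.axioms(1)[OF pow[of n]]] by simp
  next
    case (Suc j)
    have "x (Suc (n + j)) \<ominus>\<^bsub>S\<^esub> x (n + j) \<in> max_ideal_pow S n" using x anti[of n "n + j"] by auto
    from additive_subgroup.a_closed[OF ideal.axioms(1)[OF pow] this Suc]
    have "(x (Suc (n + j)) \<ominus>\<^bsub>S\<^esub> x (n + j)) \<oplus>\<^bsub>S\<^esub> (x (n + j) \<ominus>\<^bsub>S\<^esub> x n) \<in> max_ideal_pow S n" .
    moreover have "(a \<ominus>\<^bsub>S\<^esub> b) \<oplus>\<^bsub>S\<^esub> (b \<ominus>\<^bsub>S\<^esub> d) = a \<ominus>\<^bsub>S\<^esub> d"
      if "a \<in> carrier S" "b \<in> carrier S" "d \<in> carrier S" for a b d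
      using that by (auto simp: S_simps(1) S.q_diff[symmetric] S.q_add[symmetric])
    ultimately show ?case using xc by simp
  qed
  show "\<exists>!y. y \<in> carrier S \<and> (\<forall>n. y \<ominus>\<^bsub>S\<^esub> x n \<in> max_ideal_pow S n)"
  proof (rule ex1I[of _ "x e"])
    have "x e \<ominus>\<^bsub>S\<^esub> x n \<in> max_ideal_pow S n" for n
    proof (cases "n \<le> e")
      case True
      then show ?thesis using tele[of n "e - n"] by simp
    next
      case False
      then have "x n \<ominus>\<^bsub>S\<^esub> x e \<in> {\<zero>\<^bsub>S\<^esub>}" using tele[of e "n - e"] max_ideal_pow_e by simp
      then have "x n = x e" using xc S.r_right_minus_eq by blast
      then show ?thesis using tele[of n 0] by simp
    qed
    then show "x e \<in> carrier S \<and> (\<forall>n. x e \<ominus>\<^bsub>S\<^esub> x n \<in> max_ideal_pow S n)" using x by blast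
    fix y assume y: "y \<in> carrier S \<and> (\<forall>n. y \<ominus>\<^bsub>S\<^esub> x n \<in> max_ideal_pow S n)"
    then have "y \<ominus>\<^bsub>S\<^esub> x e \<in> {\<zero>\<^bsub>S\<^esub>}" using max_ideal_pow_e by metis
    then show "y = x e" using xc y S.r_right_minus_eq by blast
  qed
qed

lemma S_noetherian: "noetherian_ring S"
proof (rule S.noetherian_ringI)
  fix I assume I: "ideal I S"
  then have sub: "I \<subseteq> carrier S" using ideal.Icarr[OF I] by (intro subsetI)
  then have "finite I" using q_finite by (metis S_simps(1) finite_subset)
  moreover have "I = Idl\<^bsub>S\<^esub> I"
    using S.genideal_minimal[OF I order_refl] S.genideal_self[OF sub] by blast
  ultimately show "\<exists>A\<subseteq>carrier S. finite A \<and> I = Idl\<^bsub>S\<^esub> A" using sub by blast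
qed

theorem S_in_category: "S \<in> coeff_category p k"
proof -
  have "a_kernel S k (residue S) = max_ideal S"
    by (auto simp: a_kernel_def' S_local(2) S_simps(1))
  moreover have witt: "witt_map S w = q (\<omega> w)" for w by (simp add: quotient_coeff_ring_def)
  moreover have "witt_map S \<in> Ring.ring_hom (witt_ring p k) S"
  proof (rule ring_hom_memI)
    show "witt_map S w \<in> carrier S" for w by (simp add: witt)
    fix v w assume "v \<in> carrier (witt_ring p k)" "w \<in> carrier (witt_ring p k)"
    then show "witt_map S (v \<otimes>\<^bsub>witt_ring p k\<^esub> w) = witt_map S v \<otimes>\<^bsub>S\<^esub> witt_map S w"
      "witt_map S (v \<oplus>\<^bsub>witt_ring p k\<^esub> w) = witt_map S v \<oplus>\<^bsub>S\<^esub> witt_map S w"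
      using \<omega>_mult \<omega>_add by (simp_all add: witt S_simps q_iff)
  next
    show "witt_map S \<one>\<^bsub>witt_ring p k\<^esub> = \<one>\<^bsub>S\<^esub>"
      using \<omega>_one by (simp add: witt S_simps q_iff)
  qed
  moreover have "residue S (witt_map S w) = w 0" if "w \<in> carrier (witt_ring p k)" for w
    using \<omega>_\<rho>[OF that] by (simp add: witt)
  ultimately show ?thesis
    unfolding coeff_category_def using S_noetherian S_local(1) S_complete residue_hom residue_range by blast
qed

end

section \<open>Matrices and strict equivalence\<close>

text \<open>Matrices as functions on all pairs of indices, of which only those below
  \<open>n\<close> count. No dimensions have to be tracked, and congruence modulo an ideal is
  entrywise.\<close>

type_synonym 'r fmat = "nat \<Rightarrow> nat \<Rightarrow> 'r"

definition fmat_mult :: "nat \<Rightarrow> 'r::comm_ring_1 fmat \<Rightarrow> 'r fmat \<Rightarrow> 'r fmat" where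
  "fmat_mult n A B = (\<lambda>i j. \<Sum>l<n. A i l * B l j)"

definition fmat_one :: "'r::comm_ring_1 fmat" where
  "fmat_one = (\<lambda>i j. if i = j then 1 else 0)"

definition fmat_add :: "'r::comm_ring_1 fmat \<Rightarrow> 'r fmat \<Rightarrow> 'r fmat" where
  "fmat_add A B = (\<lambda>i j. A i j + B i j)"

definition fmat_diff :: "'r::comm_ring_1 fmat \<Rightarrow> 'r fmat \<Rightarrow> 'r fmat" where
  "fmat_diff A B = (\<lambda>i j. A i j - B i j)"

definition fmat_sum :: "('g \<Rightarrow> 'r::comm_ring_1 fmat) \<Rightarrow> 'g set \<Rightarrow> 'r fmat" where
  "fmat_sum A G = (\<lambda>i j. \<Sum>g\<in>G. A g i j)"

definition fmat_set :: "nat \<Rightarrow> 'r set \<Rightarrow> 'r fmat set" where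
  "fmat_set n I = {A. \<forall>i<n. \<forall>j<n. A i j \<in> I}"

lemmas fmat_simps = fmat_mult_def fmat_add_def fmat_diff_def fmat_sum_def

lemma fmat_mult_assoc: "fmat_mult n (fmat_mult n A B) C = fmat_mult n A (fmat_mult n B C)"
proof (intro ext)
  fix i j
  have "(\<Sum>m<n. \<Sum>l<n. A i l * B l m * C m j) = (\<Sum>l<n. \<Sum>m<n. A i l * B l m * C m j)"
    by (rule sum.swap)
  then show "fmat_mult n (fmat_mult n A B) C i j = fmat_mult n A (fmat_mult n B C) i j"
    by (simp add: fmat_mult_def sum_distrib_left sum_distrib_right mult.assoc)
qed

lemma fmat_mult_diff_left: "fmat_mult n (fmat_diff A B) C = fmat_diff (fmat_mult n A C) (fmat_mult n B C)"
  and fmat_mult_diff_right: "fmat_mult n C (fmat_diff A B) = fmat_diff (fmat_mult n C A) (fmat_mult n C B)"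
  and fmat_mult_add_left: "fmat_mult n (fmat_add A B) C = fmat_add (fmat_mult n A C) (fmat_mult n B C)"
  and fmat_mult_add_right: "fmat_mult n C (fmat_add A B) = fmat_add (fmat_mult n C A) (fmat_mult n C B)"
  by (simp_all add: fmat_simps algebra_simps sum.distrib sum_subtractf)

lemma fmat_mult_sum_left: "fmat_mult n (fmat_sum A G) C = fmat_sum (\<lambda>g. fmat_mult n (A g) C) G"
  and fmat_mult_sum_right: "fmat_mult n C (fmat_sum A G) = fmat_sum (\<lambda>g. fmat_mult n C (A g)) G"
  by (auto simp: fmat_simps sum_distrib_left sum_distrib_right fun_eq_iff intro: sum.swap)

lemma fmat_one_mult: "i < n \<Longrightarrow> fmat_mult n fmat_one A i j = A i j"
  and fmat_mult_one: "j < n \<Longrightarrow> fmat_mult n A fmat_one i j = A i j"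
  by (simp_all add: fmat_mult_def fmat_one_def if_distrib[of "\<lambda>x. x * _"] if_distrib[of "\<lambda>x. _ * x"] cong: if_cong)

locale fmat_ideal =
  fixes s :: "'r::comm_ring_1 set" and n :: nat
  assumes s: "cr.subspace s"
begin

definition fcong :: "'r fmat \<Rightarrow> 'r fmat \<Rightarrow> bool" (infix "\<doteq>" 50) where
  "A \<doteq> B \<longleftrightarrow> (\<forall>i<n. \<forall>j<n. A i j - B i j \<in> s)"

lemma cong_refl [simp]: "A \<doteq> A"
  by (simp add: fcong_def cr.subspace_0 s)

lemma cong_eq: "A = B \<Longrightarrow> A \<doteq> B"
  by simp

lemma cong_sym: "A \<doteq> B \<Longrightarrow> B \<doteq> A"
  unfolding fcong_def using cr.subspace_neg[OF s] by (metis minus_diff_eq)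

lemma cong_trans [trans]: "A \<doteq> B \<Longrightarrow> B \<doteq> C \<Longrightarrow> A \<doteq> C"
proof -
  have "a - c = (a - b) + (b - c)" for a b c :: 'r by simp
  then show "A \<doteq> B \<Longrightarrow> B \<doteq> C \<Longrightarrow> A \<doteq> C"
    unfolding fcong_def using cr.subspace_add[OF s] by metis
qed

lemma cong_add: "A \<doteq> B \<Longrightarrow> C \<doteq> D \<Longrightarrow> fmat_add A C \<doteq> fmat_add B D"
proof -
  have "a + c - (b + d) = (a - b) + (c - d)" for a b c d :: 'r by simp
  then show "A \<doteq> B \<Longrightarrow> C \<doteq> D \<Longrightarrow> fmat_add A C \<doteq> fmat_add B D"
    unfolding fcong_def fmat_simps using cr.subspace_add[OF s] by metis
qed

lemma cong_diff: "A \<doteq> B \<Longrightarrow> C \<doteq> D \<Longrightarrow> fmat_diff A C \<doteq> fmat_diff B D"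
proof -
  have "a - c - (b - d) = (a - b) - (c - d)" for a b c d :: 'r by simp
  then show "A \<doteq> B \<Longrightarrow> C \<doteq> D \<Longrightarrow> fmat_diff A C \<doteq> fmat_diff B D"
    unfolding fcong_def fmat_simps using cr.subspace_diff[OF s] by metis
qed

lemma cong_sum: "(\<And>g. g \<in> G \<Longrightarrow> A g \<doteq> B g) \<Longrightarrow> fmat_sum A G \<doteq> fmat_sum B G"
  unfolding fcong_def fmat_simps by (auto simp: sum_subtractf[symmetric] intro: cr.subspace_sum[OF s])

lemma cong_mult: "A \<doteq> B \<Longrightarrow> C \<doteq> D \<Longrightarrow> fmat_mult n A C \<doteq> fmat_mult n B D"
proof -
  have *: "a * c - b * d = (a - b) * c + b * (c - d)" for a b c d :: 'r by (simp add: algebra_simps)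
  assume AB: "A \<doteq> B" and CD: "C \<doteq> D"
  show ?thesis
    unfolding fcong_def fmat_mult_def sum_subtractf[symmetric]
  proof (intro allI impI)
    fix i j assume "i < n" "j < n"
    show "(\<Sum>l<n. A i l * C l j - B i l * D l j) \<in> s"
    proof (rule cr.subspace_sum[OF s])
      fix l assume "l \<in> {..<n}"
      then have "A i l - B i l \<in> s" "C l j - D l j \<in> s"
        using AB CD \<open>i < n\<close> \<open>j < n\<close> by (auto simp: fcong_def)
      then show "A i l * C l j - B i l * D l j \<in> s"
        unfolding * by (rule cr.subspace_add[OF s subspace_mult_right[OF s] subspace_mult_left[OF s]])
    qed
  qed
qed

lemma one_mult_cong: "fmat_mult n fmat_one A \<doteq> A" and mult_one_cong: "fmat_mult n A fmat_one \<doteq> A"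
  by (auto simp: fcong_def fmat_one_mult fmat_mult_one cr.subspace_0 s)

end

text \<open>If \<open>a1\<close> and \<open>a2\<close> are representations modulo \<open>s\<close> that agree modulo an ideal \<open>I\<close> with square in
  \<open>s\<close>, then \<open>D = a1 - a2\<close> gives a 1-cocycle, and averaging shows that \<open>|G|\<close> times it is the
  coboundary of \<open>Y\<close>.\<close>

lemma (in fmat_ideal) averaged_conjugation:
  fixes G :: "('g, 'm) monoid_scheme" and a1 a2 :: "'g \<Rightarrow> 'r fmat" and I :: "'r set"
  assumes G: "group G" "finite (carrier G)"
    and a1: "\<And>g h. g \<in> carrier G \<Longrightarrow> h \<in> carrier G \<Longrightarrow> a1 (g \<otimes>\<^bsub>G\<^esub> h) \<doteq> fmat_mult n (a1 g) (a1 h)"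
    and a2: "\<And>g h. g \<in> carrier G \<Longrightarrow> h \<in> carrier G \<Longrightarrow> a2 (g \<otimes>\<^bsub>G\<^esub> h) \<doteq> fmat_mult n (a2 g) (a2 h)"
    and a2_one: "a2 \<one>\<^bsub>G\<^esub> \<doteq> fmat_one"
    and I: "cr.subspace I" "\<And>x y. x \<in> I \<Longrightarrow> y \<in> I \<Longrightarrow> x * y \<in> s"
    and D_I: "\<And>g i j. g \<in> carrier G \<Longrightarrow> a1 g i j - a2 g i j \<in> I"
  defines "Y \<equiv> fmat_sum (\<lambda>h. fmat_mult n (fmat_diff (a1 h) (a2 h)) (a2 (inv\<^bsub>G\<^esub> h))) (carrier G)"
  shows "Y i j \<in> I"
    and "fmat_mult n (fmat_add fmat_one Y) (fmat_diff fmat_one Y) \<doteq> fmat_one"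
    and "fmat_mult n (fmat_diff fmat_one Y) (fmat_add fmat_one Y) \<doteq> fmat_one"
    and "g \<in> carrier G \<Longrightarrow> fmat_mult n (fmat_mult n (fmat_add fmat_one Y) (a2 g)) (fmat_diff fmat_one Y)
      \<doteq> (\<lambda>i j. a2 g i j + of_nat (card (carrier G)) * (a1 g i j - a2 g i j))"
proof -
  interpret group G by fact
  define D where "D g = fmat_diff (a1 g) (a2 g)" for g
  have Y: "Y = fmat_sum (\<lambda>h. fmat_mult n (D h) (a2 (inv\<^bsub>G\<^esub> h))) (carrier G)" by (simp add: Y_def D_def)
  have DI: "D g i j \<in> I" if "g \<in> carrier G" for g i j
    using D_I[OF that] by (simp add: D_def fmat_diff_def)
  have XI: "Y i j \<in> I" for i j
    unfolding Y fmat_simps using DI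
    by (intro cr.subspace_sum[OF I(1)] subspace_mult_right[OF I(1)]) auto
  show "Y i j \<in> I" by (rule XI)
  \<comment> \<open>The square of \<open>I\<close> lies in \<open>s\<close>, so products of two
    matrices over \<open>I\<close> disappear. Therefore \<open>1 + Y\<close> and
    \<open>1 - Y\<close> are inverse to each other, and only terms linear in \<open>D\<close>
    survive.\<close>
  have II: "fmat_mult n A B \<doteq> (\<lambda>_ _. 0)" if "\<And>i j. A i j \<in> I" "\<And>i j. B i j \<in> I" for A B
    unfolding fcong_def fmat_mult_def using that I(2) by (auto intro: cr.subspace_sum[OF s])
  have id1: "fmat_diff (fmat_add A B) (fmat_add A' B') = (\<lambda>i j. A i j - A' i j + (B i j - B' i j))" for A B A' B' :: "'r fmat"
    by (simp add: fmat_simps algebra_simps)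
  show "fmat_mult n (fmat_add fmat_one Y) (fmat_diff fmat_one Y) \<doteq> fmat_one"
  proof -
    have "fmat_mult n (fmat_add fmat_one Y) (fmat_diff fmat_one Y) \<doteq>
        fmat_diff (fmat_add (fmat_mult n fmat_one fmat_one) (fmat_mult n Y fmat_one))
          (fmat_add (fmat_mult n fmat_one Y) (fmat_mult n Y Y))"
      by (rule cong_eq) (simp only: fmat_mult_diff_right fmat_mult_add_left)
    also have "\<dots> \<doteq> fmat_diff (fmat_add fmat_one Y) (fmat_add Y (\<lambda>_ _. 0))"
      by (intro cong_diff cong_add one_mult_cong mult_one_cong II XI)
    also have "fmat_diff (fmat_add fmat_one Y) (fmat_add Y (\<lambda>_ _. 0)) \<doteq> fmat_one"
      by (intro cong_eq ext) (simp add: fmat_add_def fmat_diff_def)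
    finally show ?thesis .
  qed
  show "fmat_mult n (fmat_diff fmat_one Y) (fmat_add fmat_one Y) \<doteq> fmat_one"
  proof -
    have "fmat_mult n (fmat_diff fmat_one Y) (fmat_add fmat_one Y) \<doteq>
        fmat_add (fmat_diff (fmat_mult n fmat_one fmat_one) (fmat_mult n Y fmat_one))
          (fmat_diff (fmat_mult n fmat_one Y) (fmat_mult n Y Y))"
      by (rule cong_eq) (simp only: fmat_mult_diff_left fmat_mult_add_right)
    also have "\<dots> \<doteq> fmat_add (fmat_diff fmat_one Y) (fmat_diff Y (\<lambda>_ _. 0))"
      by (intro cong_diff cong_add one_mult_cong mult_one_cong II XI)
    also have "fmat_add (fmat_diff fmat_one Y) (fmat_diff Y (\<lambda>_ _. 0)) \<doteq> fmat_one"
      by (intro cong_eq ext) (simp add: fmat_add_def fmat_diff_def)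
    finally show ?thesis .
  qed
  assume g: "g \<in> carrier G"
  \<comment> \<open>Substituting \<open>a1 = a2 + D\<close> into multiplicativity leaves the product
    rule of a 1-cocycle, since \<open>D g * D h\<close> vanishes modulo \<open>s\<close>.\<close>
  have cocycle: "D (g \<otimes>\<^bsub>G\<^esub> h) \<doteq> fmat_add (fmat_mult n (D g) (a2 h)) (fmat_mult n (a2 g) (D h))"
    if h: "h \<in> carrier G" for h
  proof -
    have a1_eq: "a1 x = fmat_add (a2 x) (D x)" for x by (simp add: D_def fmat_simps)
    have "D (g \<otimes>\<^bsub>G\<^esub> h) \<doteq> fmat_diff (fmat_mult n (a1 g) (a1 h)) (fmat_mult n (a2 g) (a2 h))"
      unfolding D_def by (intro cong_diff a1 a2 g h)
    also have "\<dots> \<doteq> fmat_add (fmat_add (fmat_mult n (D g) (a2 h)) (fmat_mult n (a2 g) (D h))) (fmat_mult n (D g) (D h))"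
      unfolding a1_eq fmat_mult_add_left fmat_mult_add_right by (intro cong_eq ext) (simp add: fmat_simps fun_eq_iff algebra_simps)
    also have "\<dots> \<doteq> fmat_add (fmat_add (fmat_mult n (D g) (a2 h)) (fmat_mult n (a2 g) (D h))) (\<lambda>_ _. 0)"
      by (intro cong_add cong_refl II DI g h)
    also have "\<dots> \<doteq> fmat_add (fmat_mult n (D g) (a2 h)) (fmat_mult n (a2 g) (D h))"
      by (rule cong_eq) (simp add: fmat_add_def)
    finally show ?thesis .
  qed
  let ?ND = "\<lambda>i j. of_nat (card (carrier G)) * D g i j"
  \<comment> \<open>Multiplication by \<open>a2 g\<close> shifts the summation index from
    \<open>h\<close> to \<open>g h\<close>. The cocycle rule costs one \<open>D g\<close> for each
    summand, which adds up to the order of the group times \<open>D g\<close>.\<close>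
  have comm: "fmat_mult n (a2 g) Y \<doteq> fmat_diff (fmat_mult n Y (a2 g)) ?ND"
  proof -
    have summand: "fmat_mult n (a2 g) (fmat_mult n (D h) (a2 (inv\<^bsub>G\<^esub> h)))
        \<doteq> fmat_diff (fmat_mult n (fmat_mult n (D (g \<otimes>\<^bsub>G\<^esub> h)) (a2 (inv\<^bsub>G\<^esub> (g \<otimes>\<^bsub>G\<^esub> h)))) (a2 g)) (D g)"
      if h: "h \<in> carrier G" for h
    proof -
      have inv_h: "inv\<^bsub>G\<^esub> h = inv\<^bsub>G\<^esub> (g \<otimes>\<^bsub>G\<^esub> h) \<otimes>\<^bsub>G\<^esub> g"
        using g h by (simp add: inv_mult_group m_assoc)
      have 1: "a2 (inv\<^bsub>G\<^esub> h) \<doteq> fmat_mult n (a2 (inv\<^bsub>G\<^esub> (g \<otimes>\<^bsub>G\<^esub> h))) (a2 g)"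
        using a2[of "inv\<^bsub>G\<^esub> (g \<otimes>\<^bsub>G\<^esub> h)" g] g h unfolding inv_h[symmetric] by simp
      have 2: "fmat_mult n (a2 h) (a2 (inv\<^bsub>G\<^esub> h)) \<doteq> fmat_one"
        using cong_trans[OF cong_sym[OF a2[of h "inv\<^bsub>G\<^esub> h"]]] h a2_one by (simp add: r_inv)
      have aD: "fmat_mult n (a2 g) (D h)
          = fmat_diff (fmat_add (fmat_mult n (D g) (a2 h)) (fmat_mult n (a2 g) (D h))) (fmat_mult n (D g) (a2 h))"
        by (intro ext) (simp add: fmat_diff_def fmat_add_def)
      have "fmat_mult n (a2 g) (fmat_mult n (D h) (a2 (inv\<^bsub>G\<^esub> h))) \<doteq> fmat_mult n (fmat_mult n (a2 g) (D h)) (a2 (inv\<^bsub>G\<^esub> h))"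
        by (rule cong_eq) (rule fmat_mult_assoc[symmetric])
      also have "\<dots> \<doteq> fmat_mult n (fmat_diff (D (g \<otimes>\<^bsub>G\<^esub> h)) (fmat_mult n (D g) (a2 h))) (a2 (inv\<^bsub>G\<^esub> h))"
        by (subst aD) (intro cong_mult cong_diff cong_refl cong_sym[OF cocycle] h)
      also have "\<dots> \<doteq> fmat_diff (fmat_mult n (D (g \<otimes>\<^bsub>G\<^esub> h)) (a2 (inv\<^bsub>G\<^esub> h))) (fmat_mult n (D g) (fmat_mult n (a2 h) (a2 (inv\<^bsub>G\<^esub> h))))"
        by (rule cong_eq) (simp only: fmat_mult_diff_left fmat_mult_assoc)
      also have "\<dots> \<doteq> fmat_diff (fmat_mult n (D (g \<otimes>\<^bsub>G\<^esub> h)) (fmat_mult n (a2 (inv\<^bsub>G\<^esub> (g \<otimes>\<^bsub>G\<^esub> h))) (a2 g))) (fmat_mult n (D g) fmat_one)"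
        by (intro cong_mult cong_diff cong_refl 1 2)
      also have "\<dots> \<doteq> fmat_diff (fmat_mult n (fmat_mult n (D (g \<otimes>\<^bsub>G\<^esub> h)) (a2 (inv\<^bsub>G\<^esub> (g \<otimes>\<^bsub>G\<^esub> h)))) (a2 g)) (D g)"
        unfolding fmat_mult_assoc by (intro cong_diff cong_refl mult_one_cong)
      finally show ?thesis .
    qed
    have "fmat_mult n (a2 g) Y \<doteq> fmat_sum (\<lambda>h. fmat_diff (fmat_mult n (fmat_mult n (D (g \<otimes>\<^bsub>G\<^esub> h)) (a2 (inv\<^bsub>G\<^esub> (g \<otimes>\<^bsub>G\<^esub> h)))) (a2 g)) (D g)) (carrier G)"
      unfolding Y fmat_mult_sum_right by (intro cong_sum summand)
    also have "\<dots> \<doteq> fmat_diff (fmat_sum (\<lambda>h. fmat_mult n (fmat_mult n (D (g \<otimes>\<^bsub>G\<^esub> h)) (a2 (inv\<^bsub>G\<^esub> (g \<otimes>\<^bsub>G\<^esub> h)))) (a2 g)) (carrier G)) ?ND"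
      by (rule cong_eq) (simp add: fmat_sum_def fmat_diff_def sum_subtractf)
    also have "\<dots> \<doteq> fmat_diff (fmat_mult n Y (a2 g)) ?ND"
    proof (intro cong_diff cong_refl cong_eq)
      have "bij_betw ((\<otimes>\<^bsub>G\<^esub>) g) (carrier G) (carrier G)"
        by (rule bij_betwI[where g = "(\<otimes>\<^bsub>G\<^esub>) (inv\<^bsub>G\<^esub> g)"]) (use g in \<open>auto simp: m_assoc[symmetric]\<close>)
      then have "fmat_sum (\<lambda>h. fmat_mult n (fmat_mult n (D (g \<otimes>\<^bsub>G\<^esub> h)) (a2 (inv\<^bsub>G\<^esub> (g \<otimes>\<^bsub>G\<^esub> h)))) (a2 g)) (carrier G)
          = fmat_sum (\<lambda>h. fmat_mult n (fmat_mult n (D h) (a2 (inv\<^bsub>G\<^esub> h))) (a2 g)) (carrier G)"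
        unfolding fmat_sum_def by (intro ext) (rule sum.reindex_bij_betw)
      also have "\<dots> = fmat_mult n Y (a2 g)" unfolding Y fmat_mult_sum_left ..
      finally show "fmat_sum (\<lambda>h. fmat_mult n (fmat_mult n (D (g \<otimes>\<^bsub>G\<^esub> h)) (a2 (inv\<^bsub>G\<^esub> (g \<otimes>\<^bsub>G\<^esub> h)))) (a2 g)) (carrier G)
          = fmat_mult n Y (a2 g)" .
    qed
    finally show ?thesis .
  qed
  \<comment> \<open>Up to the vanishing term \<open>Y * a2 g * Y\<close>, conjugation adds the
    commutator \<open>Y * a2 g - a2 g * Y\<close>, which \<open>comm\<close> evaluates.\<close>
  have "fmat_mult n (fmat_mult n (fmat_add fmat_one Y) (a2 g)) (fmat_diff fmat_one Y)
      \<doteq> fmat_diff (fmat_add (fmat_mult n (fmat_mult n fmat_one (a2 g)) fmat_one) (fmat_mult n (fmat_mult n Y (a2 g)) fmat_one))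
         (fmat_add (fmat_mult n (fmat_mult n fmat_one (a2 g)) Y) (fmat_mult n (fmat_mult n Y (a2 g)) Y))"
    by (rule cong_eq) (simp only: fmat_mult_add_left fmat_mult_diff_right)
  also have "\<dots> \<doteq> fmat_diff (fmat_add (a2 g) (fmat_mult n Y (a2 g)))
         (fmat_add (fmat_diff (fmat_mult n Y (a2 g)) ?ND) (\<lambda>_ _. 0))"
  proof (intro cong_diff cong_add)
    show "fmat_mult n (fmat_mult n fmat_one (a2 g)) fmat_one \<doteq> a2 g"
      using cong_trans[OF mult_one_cong one_mult_cong] .
    show "fmat_mult n (fmat_mult n Y (a2 g)) fmat_one \<doteq> fmat_mult n Y (a2 g)" by (rule mult_one_cong)
    show "fmat_mult n (fmat_mult n fmat_one (a2 g)) Y \<doteq> fmat_diff (fmat_mult n Y (a2 g)) ?ND"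
      using cong_trans[OF cong_mult[OF one_mult_cong cong_refl] comm] .
    show "fmat_mult n (fmat_mult n Y (a2 g)) Y \<doteq> (\<lambda>_ _. 0)"
      by (rule II) (auto simp: fmat_mult_def intro!: XI cr.subspace_sum[OF I(1)] subspace_mult_right[OF I(1)])
  qed
  also have "\<dots> \<doteq> (\<lambda>i j. a2 g i j + of_nat (card (carrier G)) * (a1 g i j - a2 g i j))"
    by (rule cong_eq) (simp add: fmat_add_def fmat_diff_def D_def)
  finally show "fmat_mult n (fmat_mult n (fmat_add fmat_one Y) (a2 g)) (fmat_diff fmat_one Y)
      \<doteq> (\<lambda>i j. a2 g i j + of_nat (card (carrier G)) * (a1 g i j - a2 g i j))" .
qed

section \<open>Invertible matrices over a presented ring\<close>

context presentation
begin

definition qmat :: "nat \<Rightarrow> 'r fmat \<Rightarrow> 'b mat" where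
  "qmat n A = mat n n (\<lambda>(i, j). q (A i j))"

lemma qmat_eq_iff: "qmat n A = qmat n A' \<longleftrightarrow> (\<forall>i<n. \<forall>j<n. q (A i j) = q (A' i j))"
  unfolding qmat_def by (auto simp: mat_eq_iff)

lemma qmat_closed: "qmat n A \<in> carrier (mat_monoid B n)"
  by (simp add: mat_monoid_def qmat_def)

lemma obtain_qmat:
  assumes "Z \<in> carrier (mat_monoid B n)" obtains A where "Z = qmat n A"
proof -
  have Z: "Z \<in> carrier_mat n n" "\<And>i j. i < n \<Longrightarrow> j < n \<Longrightarrow> Z $$ (i, j) \<in> range q"
    using assms q_range by (auto simp: mat_monoid_def)
  define A where "A i j = inv_into UNIV q (Z $$ (i, j))" for i j
  have "q (A i j) = Z $$ (i, j)" if "i < n" "j < n" for i j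
    unfolding A_def using Z(2)[OF that] by (rule f_inv_into_f)
  then have "Z = qmat n A" unfolding qmat_def using Z(1) by (intro eq_matI) auto
  then show thesis using that by blast
qed

lemma qmat_mult: "qmat n A \<otimes>\<^bsub>mat_monoid B n\<^esub> qmat n A' = qmat n (fmat_mult n A A')"
proof (rule eq_matI)
  fix i j assume "i < dim_row (qmat n (fmat_mult n A A'))" "j < dim_col (qmat n (fmat_mult n A A'))"
  then have ij: "i < n" "j < n" by (auto simp: qmat_def)
  have "(\<Oplus>l\<in>{..<n}. qmat n A $$ (i, l) \<otimes> qmat n A' $$ (l, j)) = (\<Oplus>l\<in>{..<n}. q (A i l * A' l j))"
    using ij by (intro finsum_cong') (auto simp: qmat_def q_mult)
  then show "(qmat n A \<otimes>\<^bsub>mat_monoid B n\<^esub> qmat n A') $$ (i, j) = qmat n (fmat_mult n A A') $$ (i, j)"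
    using ij by (simp add: mat_monoid_def fmat_mult_def q_sum) (simp add: qmat_def q_sum fmat_mult_def)
qed (simp_all add: qmat_def mat_monoid_def)

lemma qmat_one: "\<one>\<^bsub>mat_monoid B n\<^esub> = qmat n fmat_one"
  by (rule eq_matI) (simp_all add: qmat_def mat_monoid_def fmat_one_def q_one q_zero)

lemma mat_monoid_monoid: "monoid (mat_monoid B n)"
proof (rule monoidI)
  show "\<one>\<^bsub>mat_monoid B n\<^esub> \<in> carrier (mat_monoid B n)" by (simp add: qmat_one qmat_closed)
  fix x assume "x \<in> carrier (mat_monoid B n)"
  then obtain A where x: "x = qmat n A" by (rule obtain_qmat)
  show "\<one>\<^bsub>mat_monoid B n\<^esub> \<otimes>\<^bsub>mat_monoid B n\<^esub> x = x" "x \<otimes>\<^bsub>mat_monoid B n\<^esub> \<one>\<^bsub>mat_monoid B n\<^esub> = x"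
    by (simp_all add: x qmat_one qmat_mult qmat_eq_iff fmat_one_mult fmat_mult_one)
  fix y assume "y \<in> carrier (mat_monoid B n)"
  then obtain A' where y: "y = qmat n A'" by (rule obtain_qmat)
  show "x \<otimes>\<^bsub>mat_monoid B n\<^esub> y \<in> carrier (mat_monoid B n)" by (simp add: x y qmat_mult qmat_closed)
  fix z assume "z \<in> carrier (mat_monoid B n)"
  then obtain A'' where z: "z = qmat n A''" by (rule obtain_qmat)
  show "x \<otimes>\<^bsub>mat_monoid B n\<^esub> y \<otimes>\<^bsub>mat_monoid B n\<^esub> z = x \<otimes>\<^bsub>mat_monoid B n\<^esub> (y \<otimes>\<^bsub>mat_monoid B n\<^esub> z)"
    by (simp add: x y z qmat_mult fmat_mult_assoc)
qed

lemma GL_simps: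
  "\<one>\<^bsub>GL n B\<^esub> = qmat n fmat_one" "qmat n A \<otimes>\<^bsub>GL n B\<^esub> qmat n A' = qmat n (fmat_mult n A A')"
  by (simp_all add: GL_def units_of_def qmat_one qmat_mult)

lemma GL_group: "group (GL n B)"
  unfolding GL_def by (rule monoid.units_group[OF mat_monoid_monoid])

lemma GL_carrier: "carrier (GL n B) = Units (mat_monoid B n)"
  by (simp add: GL_def units_of_def)

lemma obtain_GL:
  assumes "Z \<in> carrier (GL n B)" obtains A where "Z = qmat n A"
  using obtain_qmat[of Z n] assms monoid.Units_closed[OF mat_monoid_monoid, of Z n]
  unfolding GL_carrier by blast

lemma qmat_in_GL:
  assumes "qmat n (fmat_mult n A A') = qmat n fmat_one" "qmat n (fmat_mult n A' A) = qmat n fmat_one"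
  shows "qmat n A \<in> carrier (GL n B)" "inv\<^bsub>GL n B\<^esub> (qmat n A) = qmat n A'"
proof -
  have *: "qmat n A \<in> carrier (GL n B)" "qmat n A' \<in> carrier (GL n B)"
    unfolding GL_carrier Units_def using assms qmat_closed[of n A] qmat_closed[of n A']
    by (auto simp: qmat_mult qmat_one intro: bexI[of _ "qmat n A"] bexI[of _ "qmat n A'"])
  then show "qmat n A \<in> carrier (GL n B)" by blast
  show "inv\<^bsub>GL n B\<^esub> (qmat n A) = qmat n A'"
    by (rule group.inv_equality[OF GL_group]) (use * assms in \<open>simp_all add: GL_simps\<close>)
qed

lemma map_mat_qmat: "(\<And>x. f (q x) = f' x) \<Longrightarrow> map_mat f (qmat n A) = mat n n (\<lambda>(i, j). f' (A i j))"
  by (rule eq_matI) (auto simp: qmat_def)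

end

locale residue_presentation = presentation B q + res: presentation k \<rho>
  for B :: "('b, 'k) coeff_ring" and q :: "'r::comm_ring_1 \<Rightarrow> 'b"
    and k :: "'k ring" and \<rho> :: "'r \<Rightarrow> 'k" +
  assumes residue_q: "residue B (q x) = \<rho> x"
begin

lemma map_mat_residue: "map_mat (residue B) (qmat n A) = res.qmat n A"
  unfolding res.qmat_def by (rule map_mat_qmat) (rule residue_q)

lemma kernel_eq: "kernel (GL n B) (GL n k) (map_mat (residue B)) =
    {Z \<in> carrier (GL n B). map_mat (residue B) Z = \<one>\<^bsub>GL n k\<^esub>}"
  by (simp add: kernel_def)

lemma kernel_subgroup: "subgroup (kernel (GL n B) (GL n k) (map_mat (residue B))) (GL n B)"
proof -
  interpret GL: group "GL n B" by (rule GL_group)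
  have mult: "map_mat (residue B) (x \<otimes>\<^bsub>GL n B\<^esub> y) = map_mat (residue B) x \<otimes>\<^bsub>GL n k\<^esub> map_mat (residue B) y"
    if xy: "x \<in> carrier (GL n B)" "y \<in> carrier (GL n B)" for x y
  proof -
    obtain A A' where "x = qmat n A" "y = qmat n A'" using obtain_GL xy by metis
    then show ?thesis by (simp add: GL_simps res.GL_simps map_mat_residue)
  qed
  have one: "map_mat (residue B) \<one>\<^bsub>GL n B\<^esub> = \<one>\<^bsub>GL n k\<^esub>"
    by (simp add: GL_simps res.GL_simps map_mat_residue)
  have one_mult: "\<one>\<^bsub>GL n k\<^esub> \<otimes>\<^bsub>GL n k\<^esub> \<one>\<^bsub>GL n k\<^esub> = \<one>\<^bsub>GL n k\<^esub>"
    by (simp add: group.is_monoid[OF res.GL_group] monoid.r_one monoid.one_closed)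
  show ?thesis
  proof (rule GL.subgroupI)
    show "kernel (GL n B) (GL n k) (map_mat (residue B)) \<subseteq> carrier (GL n B)" by (auto simp: kernel_eq)
    show "kernel (GL n B) (GL n k) (map_mat (residue B)) \<noteq> {}" using one by (auto simp: kernel_eq)
    fix a assume "a \<in> kernel (GL n B) (GL n k) (map_mat (residue B))"
    then have a: "a \<in> carrier (GL n B)" "map_mat (residue B) a = \<one>\<^bsub>GL n k\<^esub>" by (auto simp: kernel_eq)
    obtain A' where A': "inv\<^bsub>GL n B\<^esub> a = qmat n A'" using obtain_GL[OF GL.inv_closed[OF a(1)]] by metis
    have "map_mat (residue B) (inv\<^bsub>GL n B\<^esub> a) \<otimes>\<^bsub>GL n k\<^esub> map_mat (residue B) a = \<one>\<^bsub>GL n k\<^esub>"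
      using mult[OF GL.inv_closed[OF a(1)] a(1)] a one by simp
    moreover have "res.qmat n A' \<otimes>\<^bsub>GL n k\<^esub> \<one>\<^bsub>GL n k\<^esub> = res.qmat n A'"
      by (simp add: res.GL_simps res.qmat_eq_iff fmat_mult_one)
    ultimately have "map_mat (residue B) (inv\<^bsub>GL n B\<^esub> a) = \<one>\<^bsub>GL n k\<^esub>"
      using a(2) by (simp add: A' map_mat_residue)
    then show "inv\<^bsub>GL n B\<^esub> a \<in> kernel (GL n B) (GL n k) (map_mat (residue B))" using a by (simp add: kernel_eq)
    fix b assume "b \<in> kernel (GL n B) (GL n k) (map_mat (residue B))"
    then show "a \<otimes>\<^bsub>GL n B\<^esub> b \<in> kernel (GL n B) (GL n k) (map_mat (residue B))"
      using a mult[of a b] one_mult by (auto simp: kernel_eq)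
  qed
qed

text \<open>Ensures that the elements of a value of \<open>Def\<close> are sets of lifts, and that
  equivalent images give the same class in \<open>Def_map\<close>.\<close>

lemma strict_equivalence_equiv:
  assumes "group G" shows "equiv (lifts k G n \<rho>bar B) (strict_equivalence k G n \<rho>bar B)"
proof -
  interpret GL: group "GL n B" by (rule GL_group)
  interpret ker: subgroup "kernel (GL n B) (GL n k) (map_mat (residue B))" "GL n B" by (rule kernel_subgroup)
  let ?K = "kernel (GL n B) (GL n k) (map_mat (residue B))" and ?E = "strict_equivalence k G n \<rho>bar B"
  have lift_closed: "r g \<in> carrier (GL n B)" if "r \<in> lifts k G n \<rho>bar B" "g \<in> carrier G" for r g
    using that by (auto simp: lifts_def hom_def)
  show ?thesis
  proof (rule equivI)
    show "?E \<subseteq> lifts k G n \<rho>bar B \<times> lifts k G n \<rho>bar B" by (auto simp: strict_equivalence_def)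
    show "refl_on (lifts k G n \<rho>bar B) ?E"
      by (rule refl_onI) (auto simp: strict_equivalence_def lift_closed intro!: bexI[OF _ ker.one_closed])
    show "sym ?E"
    proof (rule symI)
      fix r r' assume "(r, r') \<in> ?E"
      then obtain C where r: "r \<in> lifts k G n \<rho>bar B" "r' \<in> lifts k G n \<rho>bar B" and C: "C \<in> ?K"
        "\<And>g. g \<in> carrier G \<Longrightarrow> r' g = C \<otimes>\<^bsub>GL n B\<^esub> r g \<otimes>\<^bsub>GL n B\<^esub> inv\<^bsub>GL n B\<^esub> C"
        by (auto simp: strict_equivalence_def)
      have Cc: "C \<in> carrier (GL n B)" using C(1) by (rule ker.mem_carrier)
      have "r g = inv\<^bsub>GL n B\<^esub> C \<otimes>\<^bsub>GL n B\<^esub> r' g \<otimes>\<^bsub>GL n B\<^esub> inv\<^bsub>GL n B\<^esub> (inv\<^bsub>GL n B\<^esub> C)" if g: "g \<in> carrier G" for g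
        using lift_closed[OF r(1) g] Cc by (simp add: C(2)[OF g] GL.m_assoc GL.inv_solve_left GL.inv_solve_left')
      then show "(r', r) \<in> ?E" unfolding strict_equivalence_def using r ker.m_inv_closed[OF C(1)] by blast
    qed
    show "trans ?E"
    proof (rule transI)
      fix r r' r'' assume "(r, r') \<in> ?E" "(r', r'') \<in> ?E"
      then obtain C C' where r: "r \<in> lifts k G n \<rho>bar B" "r'' \<in> lifts k G n \<rho>bar B" and C: "C \<in> ?K" "C' \<in> ?K"
        "\<And>g. g \<in> carrier G \<Longrightarrow> r' g = C \<otimes>\<^bsub>GL n B\<^esub> r g \<otimes>\<^bsub>GL n B\<^esub> inv\<^bsub>GL n B\<^esub> C"
        "\<And>g. g \<in> carrier G \<Longrightarrow> r'' g = C' \<otimes>\<^bsub>GL n B\<^esub> r' g \<otimes>\<^bsub>GL n B\<^esub> inv\<^bsub>GL n B\<^esub> C'"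
        by (auto simp: strict_equivalence_def)
      have Cc: "C \<in> carrier (GL n B)" "C' \<in> carrier (GL n B)" using C(1,2) by (auto intro: ker.mem_carrier)
      have "r'' g = (C' \<otimes>\<^bsub>GL n B\<^esub> C) \<otimes>\<^bsub>GL n B\<^esub> r g \<otimes>\<^bsub>GL n B\<^esub> inv\<^bsub>GL n B\<^esub> (C' \<otimes>\<^bsub>GL n B\<^esub> C)" if g: "g \<in> carrier G" for g
        using lift_closed[OF r(1) g] Cc by (simp add: C(3,4)[OF g] GL.m_assoc GL.inv_mult_group)
      then show "(r, r'') \<in> ?E"
        unfolding strict_equivalence_def using r ker.m_closed[OF C(2,1)] by blast
    qed
  qed
qed

end

section \<open>The tensor square\<close>

text \<open>The ring \<open>'v tensor\<close> is the tensor square over the integers of \<open>'v int_poly\<close>, written as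
  polynomials over one copy in the variables of the other copy.\<close>

type_synonym 'v tensor = "('v \<Rightarrow>\<^sub>0 nat) \<Rightarrow>\<^sub>0 'v int_poly"

definition tensor_left :: "'v int_poly \<Rightarrow> 'v tensor" where
  "tensor_left x = Poly_Mapping.single 0 x"

definition tensor_right :: "'v int_poly \<Rightarrow> 'v tensor" where
  "tensor_right = poly_subst (\<lambda>v. Poly_Mapping.single (Poly_Mapping.single v 1) 1)"

text \<open>For additive \<open>h\<close> this is the map
  \<open>a \<otimes> b \<mapsto> a * h b\<close>, read off on the monomials of the second
  factor.\<close>

definition tensor_pair :: "('v int_poly \<Rightarrow> 'v int_poly) \<Rightarrow> 'v tensor \<Rightarrow> 'v int_poly" where
  "tensor_pair h F = (\<Sum>m\<in>Poly_Mapping.keys F. Poly_Mapping.lookup F m * h (Poly_Mapping.single m 1))"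

definition tensor_mult :: "'v tensor \<Rightarrow> 'v int_poly" where
  "tensor_mult = tensor_pair (\<lambda>x. x)"

text \<open>Modulo the square of the diagonal ideal this is, up to sign convention, the universal
  derivation over the integers.\<close>

definition tensor_diff :: "'v int_poly \<Rightarrow> 'v tensor" where
  "tensor_diff x = tensor_left x - tensor_right x"

text \<open>This is the kernel of \<open>tensor_mult\<close>: one inclusion is
  \<open>tensor_mult_diagonal\<close>, the other follows from
  \<open>diagonal_decomposition\<close>.\<close>

definition diagonal_ideal :: "'v tensor set" where
  "diagonal_ideal = cr.span (range tensor_diff)"

lemma single_of_int_mult: "Poly_Mapping.single m (of_int z * c) = of_int z * Poly_Mapping.single m (c::'r::comm_ring_1)"
proof -
  have "of_int z * Poly_Mapping.single m c = Poly_Mapping.single 0 (of_int z) * Poly_Mapping.single m c"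
    by (simp only: single_of_int)
  then show ?thesis by (simp only: mult_single) simp
qed

lemma tensor_left_simps [simp]:
  "tensor_left (x + y) = tensor_left x + tensor_left y"
  "tensor_left (x - y) = tensor_left x - tensor_left y"
  "tensor_left (x * y) = tensor_left x * tensor_left y"
  "tensor_left 1 = 1" "tensor_left 0 = 0"
  by (simp_all add: tensor_left_def single_add single_diff mult_single)

lemma tensor_right_simps [simp]:
  "tensor_right (x + y) = tensor_right x + tensor_right y"
  "tensor_right (x - y) = tensor_right x - tensor_right y"
  "tensor_right (- x) = - tensor_right x"
  "tensor_right (x * y) = tensor_right x * tensor_right y"
  "tensor_right 1 = 1" "tensor_right 0 = 0"
  by (simp_all add: tensor_right_def)

lemma tensor_left_of_nat: "tensor_left (of_nat n) = of_nat n"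
  and tensor_right_of_nat: "tensor_right (of_nat n) = of_nat n"
  by (induction n) simp_all

lemma tensor_right_single:
  "tensor_right (Poly_Mapping.single m z) = Poly_Mapping.single m (of_int z)"
proof -
  have int: "tensor_right (of_int z) = of_int z"
    by (cases z) (simp_all add: tensor_right_of_nat del: of_nat_Suc)
  have pow: "tensor_right (x ^ i) = tensor_right x ^ i" for x i by (simp add: tensor_right_def)
  have prod: "tensor_right (prod f A) = (\<Prod>x\<in>A. tensor_right (f x))" for f and A :: "'a set"
    by (induction A rule: infinite_finite_induct) simp_all
  have "tensor_right (Poly_Mapping.single m 1) = Poly_Mapping.single m 1"
    unfolding single_eq_prod_vars[of m] prod pow poly_var_def[symmetric]
    by (simp add: tensor_right_def)
  moreover have "Poly_Mapping.single m z = of_int z * Poly_Mapping.single m 1"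
    using single_of_int_mult[of m z "1::int"] by simp
  moreover have "Poly_Mapping.single m (of_int z) = of_int z * Poly_Mapping.single m (1 :: 'a int_poly)"
    using single_of_int_mult[of m z "1 :: 'a int_poly"] by simp
  ultimately show ?thesis by (simp add: int)
qed

lemma tensor_pair_superset:
  assumes "finite A" "Poly_Mapping.keys F \<subseteq> A"
  shows "tensor_pair h F = (\<Sum>m\<in>A. Poly_Mapping.lookup F m * h (Poly_Mapping.single m 1))"
  unfolding tensor_pair_def using assms
  by (intro sum.mono_neutral_left) (auto simp: in_keys_iff)

lemma tensor_pair_add: "tensor_pair h (F + F') = tensor_pair h F + tensor_pair h F'"
proof -
  let ?A = "Poly_Mapping.keys F \<union> Poly_Mapping.keys F'"
  have "tensor_pair h (F + F') = (\<Sum>m\<in>?A. Poly_Mapping.lookup (F + F') m * h (Poly_Mapping.single m 1))"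
    using Poly_Mapping.keys_add[of F F'] by (intro tensor_pair_superset) auto
  also have "\<dots> = tensor_pair h F + tensor_pair h F'"
    by (subst (1 2) tensor_pair_superset[of ?A]) (auto simp: lookup_add distrib_right sum.distrib)
  finally show ?thesis .
qed

lemma tensor_pair_single: "tensor_pair h (Poly_Mapping.single m c) = c * h (Poly_Mapping.single m 1)"
  by (subst tensor_pair_superset[of "{m}"]) auto

lemma tensor_pair_0 [simp]: "tensor_pair h 0 = 0"
  by (simp add: tensor_pair_def)

lemma tensor_pair_uminus: "tensor_pair h (- F) = - tensor_pair h F"
  using tensor_pair_add[of h "- F" F] by (simp add: eq_neg_iff_add_eq_0)

lemma tensor_pair_diff: "tensor_pair h (F - F') = tensor_pair h F - tensor_pair h F'"
  using tensor_pair_add[of h F "- F'"] by (simp add: tensor_pair_uminus)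

lemma tensor_pair_left: "tensor_pair h (tensor_left a * F) = a * tensor_pair h F"
  by (induction F rule: single_induct)
    (simp_all add: tensor_left_def mult_single tensor_pair_single mult.assoc tensor_pair_add distrib_left)

lemma tensor_pair_single_mult:
  "tensor_pair h (Poly_Mapping.single m 1 * F) = tensor_pair (\<lambda>x. h (Poly_Mapping.single m 1 * x)) F"
  by (induction F rule: single_induct)
    (simp_all add: mult_single tensor_pair_single tensor_pair_add distrib_left)

lemma tensor_mult_simps [simp]:
  fixes F F' :: "'v tensor" and x :: "'v int_poly"
  shows "tensor_mult (F + F') = tensor_mult F + tensor_mult F'"
  "tensor_mult (F - F') = tensor_mult F - tensor_mult F'"
  "tensor_mult (F * F') = tensor_mult F * tensor_mult F'"
  "tensor_mult (0 :: 'v tensor) = 0" "tensor_mult (1 :: 'v tensor) = 1"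
  "tensor_mult (tensor_left x) = x" "tensor_mult (tensor_right x) = x"
proof -
  show add: "tensor_mult (F + F') = tensor_mult F + tensor_mult F'" for F F' :: "'v tensor"
    by (simp add: tensor_mult_def tensor_pair_add)
  show diff: "tensor_mult (F - F') = tensor_mult F - tensor_mult F'" for F F' :: "'v tensor"
    by (simp add: tensor_mult_def tensor_pair_diff)
  show mult: "tensor_mult (F * F') = tensor_mult F * tensor_mult F'" for F F' :: "'v tensor"
  proof (induction F rule: single_induct)
    case (single m c)
    show ?case
    proof (induction F' rule: single_induct)
      case (single m' c')
      have "Poly_Mapping.single (m + m') (1::int) = Poly_Mapping.single m 1 * Poly_Mapping.single m' 1"
        by (simp add: mult_single)
      then show ?case by (simp add: tensor_mult_def mult_single tensor_pair_single mult_ac)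
    qed (simp add: add distrib_left)
  qed (simp add: add distrib_right)
  show "tensor_mult (0 :: 'v tensor) = 0" by (simp add: tensor_mult_def)
  show "tensor_mult (1 :: 'v tensor) = 1"
    using tensor_pair_single[of "\<lambda>x::'v int_poly. x" 0 1] by (simp add: tensor_mult_def)
  show "tensor_mult (tensor_left x) = x"
    by (simp add: tensor_mult_def tensor_left_def tensor_pair_single)
  show "tensor_mult (tensor_right x) = x"
  proof (induction x rule: single_induct)
    case (single m z)
    have "of_int z * Poly_Mapping.single m 1 = Poly_Mapping.single m z"
      using single_of_int_mult[of m z "1::int"] by simp
    then show ?case by (simp add: tensor_mult_def tensor_right_single tensor_pair_single)
  qed (simp add: add)
qed

lemma tensor_mult_diff [simp]: "tensor_mult (tensor_diff x) = 0"
  by (simp add: tensor_diff_def)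

lemma tensor_mult_diagonal: "F \<in> diagonal_ideal \<Longrightarrow> tensor_mult F = 0"
proof -
  have "cr.subspace {F. tensor_mult F = (0 :: 'a int_poly)}" by (rule cr.subspaceI) auto
  then have "diagonal_ideal \<subseteq> {F. tensor_mult F = (0 :: 'a int_poly)}"
    unfolding diagonal_ideal_def by (intro cr.span_minimal) auto
  then show "F \<in> diagonal_ideal \<Longrightarrow> tensor_mult F = 0" by blast
qed

lemma diagonal_ideal_subspace: "cr.subspace diagonal_ideal"
  by (simp add: diagonal_ideal_def)

lemma tensor_diff_in_diagonal: "tensor_diff x \<in> diagonal_ideal"
  unfolding diagonal_ideal_def by (intro cr.span_base) auto

lemma diagonal_decomposition: "F - tensor_left (tensor_mult F) \<in> diagonal_ideal"
proof (induction F rule: single_induct)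
  case (single m c)
  have "Poly_Mapping.single m c = tensor_left c * tensor_right (Poly_Mapping.single m 1)"
    by (simp add: tensor_left_def tensor_right_single mult_single)
  then have "Poly_Mapping.single m c - tensor_left (tensor_mult (Poly_Mapping.single m c))
      = - tensor_left c * tensor_diff (Poly_Mapping.single m 1)"
    by (simp add: tensor_diff_def algebra_simps)
  then show ?case using subspace_mult_left[OF diagonal_ideal_subspace tensor_diff_in_diagonal] by metis
next
  case (add F F')
  have "F + F' - tensor_left (tensor_mult (F + F'))
      = (F - tensor_left (tensor_mult F)) + (F' - tensor_left (tensor_mult F'))" by simp
  then show ?case using add cr.subspace_add[OF diagonal_ideal_subspace] by metis
qed

section \<open>The tensor square of a quotient and its Casimir elements\<close>

locale tensor_quotient =
  fixes q :: "'v int_poly set"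
  assumes q: "cr.subspace q"
begin

definition functionals :: "('v int_poly \<Rightarrow> 'v int_poly) set" where
  "functionals = {h. (\<forall>x y. h (x + y) - (h x + h y) \<in> q) \<and> (\<forall>x\<in>q. h x \<in> q)}"

text \<open>The kernel of \<open>A \<otimes> A \<rightarrow> A/q \<otimes> A/q\<close>, described by duality.\<close>

definition tensor_kernel :: "'v tensor set" where
  "tensor_kernel = {F. \<forall>h\<in>functionals. tensor_pair h F \<in> q}"

lemma functionals_add: "h \<in> functionals \<Longrightarrow> h (x + y) - (h x + h y) \<in> q"
  and functionals_q: "h \<in> functionals \<Longrightarrow> x \<in> q \<Longrightarrow> h x \<in> q"
  by (auto simp: functionals_def)

lemma functionals_mult: "h \<in> functionals \<Longrightarrow> (\<lambda>x. h (a * x)) \<in> functionals"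
  unfolding functionals_def using subspace_mult_left[OF q] by (simp add: distrib_left)

lemma functionals_id: "(\<lambda>x. x) \<in> functionals"
  by (simp add: functionals_def cr.subspace_0 q)

lemma functionals_0: assumes "h \<in> functionals" shows "h 0 \<in> q"
  using functionals_q[OF assms cr.subspace_0[OF q]] .

lemma functionals_uminus: assumes h: "h \<in> functionals" shows "h (- x) + h x \<in> q"
  using cr.subspace_diff[OF q functionals_0[OF h] functionals_add[OF h, of "- x" x]] by simp

lemma functionals_of_int: assumes h: "h \<in> functionals" shows "h (of_int z * x) - of_int z * h x \<in> q"
proof -
  have nat: "h (of_nat i * x) - of_nat i * h x \<in> q" for i x
  proof (induction i)
    case 0
    then show ?case using functionals_0[OF h] by simp
  next
    case (Suc i)
    from cr.subspace_add[OF q functionals_add[OF h, of x "of_nat i * x"] Suc]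
    show ?case by (simp add: algebra_simps)
  qed
  show ?thesis
  proof (cases z rule: int_cases2)
    case (nonneg n) then show ?thesis using nat by simp
  next
    case (nonpos n)
    from cr.subspace_diff[OF q functionals_uminus[OF h, of "of_nat n * x"] nat[of n x]]
    show ?thesis by (simp add: nonpos)
  qed
qed

lemma tensor_pair_cong:
  assumes "\<And>m. h m - h' m \<in> q" shows "tensor_pair h F - tensor_pair h' F \<in> q"
  unfolding tensor_pair_def sum_subtractf[symmetric] right_diff_distrib[symmetric]
  using assms by (intro cr.subspace_sum[OF q] subspace_mult_left[OF q])

lemma tensor_pair_add_functional:
  "tensor_pair (\<lambda>x. h x + h' x) F = tensor_pair h F + tensor_pair h' F"
  by (simp add: tensor_pair_def distrib_left sum.distrib)

text \<open>A congruence only: \<open>h\<close> is additive modulo \<open>q\<close>, so the integer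
  coefficients of \<open>b\<close> pass through it up to \<open>q\<close>.\<close>

lemma tensor_pair_right:
  assumes h: "h \<in> functionals"
  shows "tensor_pair h (tensor_right b * F) - tensor_pair (\<lambda>x. h (b * x)) F \<in> q"
proof (induction b rule: single_induct)
  case (single m z)
  have b: "Poly_Mapping.single m z = of_int z * Poly_Mapping.single m 1"
    using single_of_int_mult[of m z "1::int"] by simp
  have "tensor_right (Poly_Mapping.single m z) = tensor_left (of_int z) * Poly_Mapping.single m 1"
    using single_of_int_mult[of m z "1 :: 'v int_poly"]
    by (simp add: tensor_right_single tensor_left_def mult_single)
  then have eq: "tensor_pair h (tensor_right (Poly_Mapping.single m z) * F)
      = tensor_pair (\<lambda>x. of_int z * h (Poly_Mapping.single m 1 * x)) F"
    by (simp add: mult.assoc tensor_pair_left tensor_pair_single_mult)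
      (simp add: tensor_pair_def sum_distrib_left mult.left_commute)
  have "tensor_pair (\<lambda>x. h (Poly_Mapping.single m z * x)) F - tensor_pair (\<lambda>x. of_int z * h (Poly_Mapping.single m 1 * x)) F \<in> q"
    by (rule tensor_pair_cong) (simp add: b mult.assoc functionals_of_int[OF h])
  from cr.subspace_neg[OF q this] show ?case by (simp add: eq)
next
  case (add b c)
  have "tensor_pair (\<lambda>x. h ((b + c) * x)) F - tensor_pair (\<lambda>x. h (b * x) + h (c * x)) F \<in> q"
    by (rule tensor_pair_cong) (simp add: distrib_right functionals_add[OF h])
  from cr.subspace_diff[OF q cr.subspace_add[OF q add] this] show ?case
    by (simp add: distrib_right tensor_pair_add tensor_pair_add_functional algebra_simps)
qed

lemma tensor_kernel_subspace: "cr.subspace tensor_kernel"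
proof (rule cr.subspaceI)
  show "0 \<in> tensor_kernel" by (simp add: tensor_kernel_def cr.subspace_0 q)
  show "F + F' \<in> tensor_kernel" if "F \<in> tensor_kernel" "F' \<in> tensor_kernel" for F F'
    using that by (simp add: tensor_kernel_def tensor_pair_add cr.subspace_add q)
  fix c F assume F: "F \<in> tensor_kernel"
  have add: "x + y \<in> tensor_kernel" if "x \<in> tensor_kernel" "y \<in> tensor_kernel" for x y
    using that by (simp add: tensor_kernel_def tensor_pair_add cr.subspace_add q)
  show "c * F \<in> tensor_kernel"
  proof (induction c rule: single_induct)
    case (single m a)
    have "Poly_Mapping.single m a = tensor_left a * Poly_Mapping.single m 1"
      by (simp add: tensor_left_def mult_single)
    then show ?case using F functionals_mult
      by (simp add: tensor_kernel_def mult.assoc tensor_pair_left tensor_pair_single_mult subspace_mult_left[OF q])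
  qed (simp add: distrib_right add)
qed

lemma tensor_left_kernel: "x \<in> q \<Longrightarrow> tensor_left x \<in> tensor_kernel"
  by (simp add: tensor_kernel_def tensor_left_def tensor_pair_single subspace_mult_right[OF q])

lemma tensor_right_kernel: assumes "x \<in> q" shows "tensor_right x \<in> tensor_kernel"
  unfolding tensor_kernel_def
proof (intro CollectI ballI)
  fix h assume h: "h \<in> functionals"
  have "tensor_pair (\<lambda>y. h (x * y)) 1 = h x"
    using tensor_pair_single[of "\<lambda>y. h (x * y)" 0 1] by simp
  then have "tensor_pair h (tensor_right x) - h x \<in> q"
    using tensor_pair_right[OF h, of x 1] by simp
  from cr.subspace_add[OF q this functionals_q[OF h assms]] show "tensor_pair h (tensor_right x) \<in> q" by simp
qed

lemma tensor_mult_kernel: "F \<in> tensor_kernel \<Longrightarrow> tensor_mult F \<in> q"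
  using functionals_id by (auto simp: tensor_kernel_def tensor_mult_def)

text \<open>Dividing by it gives the ring \<open>(A \<otimes> A)/I^2\<close> of the overview, with
  \<open>A\<close> the quotient by \<open>q\<close>.\<close>

definition first_order_ideal :: "'v tensor set" where
  "first_order_ideal = cr.span (tensor_kernel \<union> {a * b |a b. a \<in> diagonal_ideal \<and> b \<in> diagonal_ideal})"

text \<open>Multiplying the square system expressing \<open>N y\<^sub>j \<in> I\<^sup>2\<close> for the generators \<open>y\<^sub>j\<close> of the diagonal
  ideal \<open>I\<close> by the adjugate matrix gives an element that annihilates \<open>I\<close> and is \<open>N\<^sup>d\<close> on the diagonal.\<close>

lemma casimir_if_unramified:
  fixes g :: "nat \<Rightarrow> 'v int_poly"
  assumes gen: "\<And>x. tensor_diff x \<in> cr.span ((\<lambda>j. tensor_diff (g j)) ` {..<d} \<union> tensor_kernel)"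
    and unram: "\<And>x. of_nat N * tensor_diff x \<in> first_order_ideal"
  shows "\<exists>T a. casimir_family q (N ^ d) T a"
proof -
  note KC = tensor_kernel_subspace
  let ?I = "diagonal_ideal :: 'v tensor set"
  note I = diagonal_ideal_subspace[where 'a = 'v]
  define y where "y j = tensor_diff (g j)" for j
  have y_I: "y j \<in> ?I" for j by (simp add: y_def tensor_diff_in_diagonal)
  have IG: "?I \<subseteq> cr.span (y ` {..<d} \<union> tensor_kernel)"
    unfolding diagonal_ideal_def y_def using gen by (intro cr.span_minimal) auto
  have rep: "\<exists>c. x - (\<Sum>j<d. c j * y j) \<in> tensor_kernel" if "x \<in> cr.span (y ` {..<d} \<union> tensor_kernel)" for x
    using that
  proof (induction d arbitrary: x)
    case 0
    have "cr.span tensor_kernel = tensor_kernel" using KC by simp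
    moreover have "x \<in> cr.span tensor_kernel" using 0 by simp
    ultimately have "x \<in> tensor_kernel" by (simp only:)
    then show ?case by simp
  next
    case (Suc d)
    have "y ` {..<Suc d} \<union> tensor_kernel = insert (y d) (y ` {..<d} \<union> tensor_kernel)"
      by (auto simp: lessThan_Suc)
    then obtain k where "x - k * y d \<in> cr.span (y ` {..<d} \<union> tensor_kernel)"
      using Suc.prems by (auto simp: cr.span_breakdown_eq)
    then obtain c where "x - k * y d - (\<Sum>j<d. c j * y j) \<in> tensor_kernel" using Suc.IH by blast
    then show ?case by (intro exI[of _ "c(d := k)"]) (simp add: algebra_simps)
  qed
  \<comment> \<open>Combinations of the \<open>y j\<close> with coefficients in the diagonal ideal,
    up to \<open>tensor_kernel\<close>; this ideal contains
    \<open>first_order_ideal\<close>.\<close>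
  let ?Z = "{x. \<exists>e. (\<forall>j<d. e j \<in> ?I) \<and> x - (\<Sum>j<d. e j * y j) \<in> tensor_kernel}"
  have Z: "cr.subspace ?Z"
  proof (rule cr.subspaceI)
    show "0 \<in> ?Z" by (auto intro!: exI[of _ "\<lambda>_. 0"] simp: cr.subspace_0 I KC)
  next
    fix x x' assume "x \<in> ?Z" "x' \<in> ?Z"
    then obtain e e' where e: "\<And>j. j < d \<Longrightarrow> e j \<in> ?I" "x - (\<Sum>j<d. e j * y j) \<in> tensor_kernel"
      "\<And>j. j < d \<Longrightarrow> e' j \<in> ?I" "x' - (\<Sum>j<d. e' j * y j) \<in> tensor_kernel" by auto
    have eq: "x + x' - (\<Sum>j<d. (e j + e' j) * y j) = (x - (\<Sum>j<d. e j * y j)) + (x' - (\<Sum>j<d. e' j * y j))"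
      by (simp add: algebra_simps sum.distrib)
    have "x + x' - (\<Sum>j<d. (e j + e' j) * y j) \<in> tensor_kernel"
      unfolding eq by (rule cr.subspace_add[OF KC e(2,4)])
    then show "x + x' \<in> ?Z" using cr.subspace_add[OF I e(1,3)] by (auto intro!: exI[of _ "\<lambda>j. e j + e' j"])
  next
    fix c x assume "x \<in> ?Z"
    then obtain e where e: "\<And>j. j < d \<Longrightarrow> e j \<in> ?I" "x - (\<Sum>j<d. e j * y j) \<in> tensor_kernel" by auto
    have eq: "c * x - (\<Sum>j<d. (c * e j) * y j) = c * (x - (\<Sum>j<d. e j * y j))"
      by (simp add: algebra_simps sum_distrib_left)
    have "c * x - (\<Sum>j<d. (c * e j) * y j) \<in> tensor_kernel"
      unfolding eq by (rule subspace_mult_left[OF KC e(2)])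
    then show "c * x \<in> ?Z" using subspace_mult_left[OF I e(1)] by (auto intro!: exI[of _ "\<lambda>j. c * e j"])
  qed
  have "a * b \<in> ?Z" if "a \<in> ?I" "b \<in> ?I" for a b
  proof -
    obtain c where c: "b - (\<Sum>j<d. c j * y j) \<in> tensor_kernel" using rep IG \<open>b \<in> ?I\<close> by blast
    have eq: "a * b - (\<Sum>j<d. (a * c j) * y j) = a * (b - (\<Sum>j<d. c j * y j))"
      by (simp add: algebra_simps sum_distrib_left)
    have "a * b - (\<Sum>j<d. (a * c j) * y j) \<in> tensor_kernel"
      unfolding eq by (rule subspace_mult_left[OF KC c])
    then show ?thesis using subspace_mult_right[OF I \<open>a \<in> ?I\<close>] by (auto intro!: exI[of _ "\<lambda>j. a * c j"])
  qed
  moreover have "tensor_kernel \<subseteq> ?Z" by (auto intro!: exI[of _ "\<lambda>_. 0"] simp: cr.subspace_0 I)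
  ultimately have "first_order_ideal \<subseteq> ?Z"
    unfolding first_order_ideal_def by (intro cr.span_minimal Z) auto
  then have "\<forall>l. of_nat N * y l \<in> ?Z" using unram unfolding y_def by blast
  then have "\<forall>l. \<exists>e. (\<forall>j<d. e j \<in> ?I) \<and> of_nat N * y l - (\<Sum>j<d. e j * y j) \<in> tensor_kernel" by blast
  from choice[OF this] obtain e where
    e: "\<And>l j. j < d \<Longrightarrow> e l j \<in> ?I" "\<And>l. of_nat N * y l - (\<Sum>j<d. e l j * y j) \<in> tensor_kernel" by blast
  \<comment> \<open>The matrix of the system \<open>N * y l = \<Sum> e l j * y j\<close>. It kills
    the vector of the \<open>y j\<close> modulo \<open>tensor_kernel\<close>, and
    \<open>tensor_mult\<close> maps it to \<open>N\<close> times the identity because the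
    \<open>e l j\<close> lie in the diagonal ideal.\<close>
  define Bm where "Bm = mat d d (\<lambda>(l, j). (if l = j then of_nat N else 0) - e l j)"
  have Bm: "Bm \<in> carrier_mat d d" by (simp add: Bm_def)
  define z where "z = det Bm"
  have By: "(\<Sum>j<d. Bm $$ (l, j) * y j) \<in> tensor_kernel" if "l < d" for l
  proof -
    have "(\<Sum>j<d. Bm $$ (l, j) * y j) = (\<Sum>j<d. (if l = j then of_nat N * y j else 0) - e l j * y j)"
      using that by (intro sum.cong) (auto simp: Bm_def algebra_simps)
    also have "\<dots> = of_nat N * y l - (\<Sum>j<d. e l j * y j)"
      using that by (simp add: sum_subtractf)
    finally show ?thesis using e(2) by simp
  qed
  have zy: "z * y j \<in> tensor_kernel" if j: "j < d" for j
  proof -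
    have ij: "(\<Sum>l<d. adj_mat Bm $$ (j, l) * Bm $$ (l, i)) = (if j = i then z else 0)" if "i < d" for i
    proof -
      have "(adj_mat Bm * Bm) $$ (j, i) = (\<Sum>l<d. adj_mat Bm $$ (j, l) * Bm $$ (l, i))"
        using adj_mat(1)[OF Bm] Bm j that by (simp add: scalar_prod_def atLeast0LessThan)
      moreover have "(adj_mat Bm * Bm) $$ (j, i) = (if j = i then z else 0)"
        using adj_mat(3)[OF Bm] j that by (simp add: z_def)
      ultimately show ?thesis by simp
    qed
    have "(\<Sum>l<d. adj_mat Bm $$ (j, l) * (\<Sum>i<d. Bm $$ (l, i) * y i))
        = (\<Sum>i<d. (\<Sum>l<d. adj_mat Bm $$ (j, l) * Bm $$ (l, i)) * y i)"
      unfolding sum_distrib_left sum_distrib_right by (subst sum.swap) (simp add: mult.assoc)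
    also have "\<dots> = (\<Sum>i<d. if j = i then z * y i else 0)"
      using ij by (intro sum.cong) auto
    also have "\<dots> = z * y j" using j by simp
    finally have "z * y j = (\<Sum>l<d. adj_mat Bm $$ (j, l) * (\<Sum>i<d. Bm $$ (l, i) * y i))" ..
    also have "\<dots> \<in> tensor_kernel"
      using By by (intro cr.subspace_sum[OF KC]) (auto intro: subspace_mult_left[OF KC])
    finally show ?thesis .
  qed
  have zI: "z * x \<in> tensor_kernel" if "x \<in> ?I" for x
  proof -
    have "cr.span (y ` {..<d} \<union> tensor_kernel) \<subseteq> {x. z * x \<in> tensor_kernel}"
      using zy subspace_mult_left[OF KC] by (intro cr.span_minimal subspace_colon KC) auto
    then show ?thesis using IG \<open>x \<in> ?I\<close> by blast
  qed
  have z_diag: "tensor_mult z = of_nat (N ^ d)"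
  proof -
    interpret mu: comm_ring_hom "tensor_mult :: 'v tensor \<Rightarrow> 'v int_poly" by unfold_locales simp_all
    have "map_mat tensor_mult Bm = of_nat N \<cdot>\<^sub>m 1\<^sub>m d"
      by (rule eq_matI) (auto simp: Bm_def tensor_mult_diagonal e(1) mu.hom_of_nat)
    moreover have "tensor_mult z = det (map_mat tensor_mult Bm)" unfolding z_def by (rule mu.hom_det[symmetric])
    ultimately show ?thesis by (simp add: det_smult)
  qed
  \<comment> \<open>The right-hand factors are the monomials of \<open>z\<close> in the second copy
    of the variables, the left-hand factors their coefficients; \<open>a\<close> recovers a
    coefficient from its monomial.\<close>
  define T :: "'v int_poly set" where "T = (\<lambda>m. Poly_Mapping.single m 1) ` Poly_Mapping.keys z"
  have inj: "inj_on (\<lambda>m. Poly_Mapping.single m (1::int)) (Poly_Mapping.keys z)"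
    by (rule inj_onI) (metis lookup_single_eq lookup_single_not_eq one_neq_zero)
  define a where "a t = Poly_Mapping.lookup z (the_inv_into (Poly_Mapping.keys z) (\<lambda>m. Poly_Mapping.single m (1::int)) t)" for t
  have a: "a (Poly_Mapping.single m 1) = Poly_Mapping.lookup z m" if "m \<in> Poly_Mapping.keys z" for m
    unfolding a_def using the_inv_into_f_f[OF inj that] by (rule arg_cong)
  have sum_T: "(\<Sum>t\<in>T. a t * h t) = tensor_pair h z" for h
    unfolding T_def tensor_pair_def sum.reindex[OF inj] comp_def using a by (intro sum.cong) simp_all
  have "casimir_family q (N ^ d) T a"
    unfolding casimir_family_def
  proof (intro conjI allI impI)
    show "finite T" by (simp add: T_def)
    show "(\<Sum>t\<in>T. a t * t) - of_nat (N ^ d) \<in> q"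
      unfolding sum_T[of "\<lambda>t. t"] using z_diag cr.subspace_0[OF q] by (simp add: tensor_mult_def)
    fix b h assume "\<forall>x y. h (x + y) - (h x + h y) \<in> q" "\<forall>x\<in>q. h x \<in> q"
    then have h: "h \<in> functionals" by (simp add: functionals_def)
    have "tensor_diff b * z \<in> tensor_kernel" using zI[OF tensor_diff_in_diagonal, of b] by (simp add: mult.commute)
    then have "tensor_pair h (tensor_left b * z) - tensor_pair h (tensor_right b * z) \<in> q"
      using h by (auto simp: tensor_kernel_def tensor_diff_def left_diff_distrib tensor_pair_diff)
    from cr.subspace_add[OF q this tensor_pair_right[OF h, of b z]]
    show "b * (\<Sum>t\<in>T. a t * h t) - (\<Sum>t\<in>T. a t * h (b * t)) \<in> q"
      unfolding sum_T sum_T[of "\<lambda>t. h (b * t)"] by (simp add: tensor_pair_left)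
  qed
  then show ?thesis by blast
qed

end

section \<open>First-order deformations\<close>

text \<open>\<open>\<Theta>\<close> may separate more than the cosets of \<open>s\<close>; its range
  only serves to bound their number. Codes are singletons to fit the type
  \<open>nat set\<close>.\<close>

lemma obtain_code:
  assumes s: "cr.subspace s" and fin: "finite (range \<Theta>)" and \<Theta>: "\<And>x y. \<Theta> x = \<Theta> y \<Longrightarrow> x - y \<in> s"
  obtains q :: "'r::comm_ring_1 \<Rightarrow> nat set" where "finite (range q)" "\<And>x y. q x = q y \<longleftrightarrow> x - y \<in> s"
proof -
  define cls where "cls x = {y. x - y \<in> s}" for x
  have cls: "cls x = cls y \<longleftrightarrow> x - y \<in> s" for x y
  proof
    assume eq: "cls x = cls y"
    have "y \<in> cls y" using cr.subspace_0[OF s] by (simp add: cls_def)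
    then have "y \<in> cls x" by (simp only: eq)
    then show "x - y \<in> s" by (simp add: cls_def)
  next
    assume xy: "x - y \<in> s"
    have "x - z \<in> s \<longleftrightarrow> y - z \<in> s" for z
      using cr.subspace_add[OF s xy, of "y - z"] cr.subspace_diff[OF s _ xy, of "x - z"] by auto
    then show "cls x = cls y" by (simp add: cls_def)
  qed
  have "range cls \<subseteq> (cls \<circ> inv_into UNIV \<Theta>) ` range \<Theta>"
  proof
    fix c assume "c \<in> range cls"
    then obtain x where x: "c = cls x" by blast
    have "cls (inv_into UNIV \<Theta> (\<Theta> x)) = cls x" by (simp add: cls \<Theta> f_inv_into_f)
    then show "c \<in> (cls \<circ> inv_into UNIV \<Theta>) ` range \<Theta>" by (auto simp: x image_iff intro!: exI[of _ x])
  qed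
  then have fin_cls: "finite (range cls)" using fin by (rule finite_subset[OF _ finite_imageI])
  obtain f :: "'r set \<Rightarrow> nat" where f: "inj_on f (range cls)"
    using finite_imp_inj_to_nat_seg[OF fin_cls] by metis
  show thesis
  proof (rule that[of "\<lambda>x. {f (cls x)}"])
    have "range (\<lambda>x. {f (cls x)}) = (\<lambda>c. {f c}) ` range cls" by (simp add: image_image)
    then show "finite (range (\<lambda>x. {f (cls x)}))" using fin_cls by simp
    show "{f (cls x)} = {f (cls y)} \<longleftrightarrow> x - y \<in> s" for x y
      using f cls[of x y] by (auto dest: inj_onD)
  qed
qed

text \<open>Morphisms are defined on representatives: \<open>f\<close> has to respect the operations
  only after composition with \<open>qb\<close>.\<close>

lemma coeff_hom_of_map:
  fixes f :: "'r1::comm_ring_1 \<Rightarrow> 'r2::comm_ring_1"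
  assumes A: "presentation A qa" and B: "presentation B qb"
    and cls: "\<And>x y. qa x = qa y \<Longrightarrow> qb (f x) = qb (f y)"
    and add: "\<And>x y. qb (f (x + y)) = qb (f x) \<oplus>\<^bsub>B\<^esub> qb (f y)"
    and mult: "\<And>x y. qb (f (x * y)) = qb (f x) \<otimes>\<^bsub>B\<^esub> qb (f y)"
    and one: "qb (f 1) = \<one>\<^bsub>B\<^esub>"
    and max: "max_ideal A \<subseteq> carrier A" "\<And>x. qa x \<in> max_ideal A \<Longrightarrow> qb (f x) \<in> max_ideal B"
    and witt: "\<And>w. w \<in> carrier (witt_ring p k) \<Longrightarrow> \<exists>x. witt_map A w = qa x \<and> witt_map B w = qb (f x)"
  obtains F where "F \<in> coeff_hom p k A B" "\<And>x. F (qa x) = qb (f x)"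
proof -
  interpret A: presentation A qa by (rule A)
  interpret B: presentation B qb by (rule B)
  define F where "F = (\<lambda>t\<in>carrier A. qb (f (inv_into UNIV qa t)))"
  have F: "F (qa x) = qb (f x)" for x
    using cls[of "inv_into UNIV qa (qa x)" x] by (simp add: F_def f_inv_into_f)
  have "F \<in> Ring.ring_hom A B"
  proof (rule ring_hom_memI)
    fix x assume "x \<in> carrier A"
    then obtain a where a: "qa a = x" by (rule A.obtain_preimage)
    show "F x \<in> carrier B" by (simp add: a[symmetric] F)
    fix y assume "y \<in> carrier A"
    then obtain b where b: "qa b = y" by (rule A.obtain_preimage)
    show "F (x \<otimes>\<^bsub>A\<^esub> y) = F x \<otimes>\<^bsub>B\<^esub> F y" "F (x \<oplus>\<^bsub>A\<^esub> y) = F x \<oplus>\<^bsub>B\<^esub> F y"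
      by (simp_all only: a[symmetric] b[symmetric] A.q_mult[symmetric] A.q_add[symmetric] F mult add)
  qed (simp only: A.q_one[symmetric] F one)
  moreover have "F ` max_ideal A \<subseteq> max_ideal B"
  proof
    fix z assume "z \<in> F ` max_ideal A"
    then obtain t where t: "t \<in> max_ideal A" "z = F t" by blast
    obtain x where x: "qa x = t" using max(1) t(1) A.obtain_preimage by blast
    show "z \<in> max_ideal B" using max(2)[of x] t by (simp add: x[symmetric] F)
  qed
  moreover have "\<forall>w\<in>carrier (witt_ring p k). F (witt_map A w) = witt_map B w"
  proof
    fix w assume "w \<in> carrier (witt_ring p k)"
    from witt[OF this] obtain x where "witt_map A w = qa x" "witt_map B w = qb (f x)" by blast
    then show "F (witt_map A w) = witt_map B w" by (simp only: F)
  qed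
  moreover have "F \<in> extensional (carrier A)" by (simp add: F_def)
  ultimately have "F \<in> coeff_hom p k A B" unfolding coeff_hom_def by blast
  then show thesis using F that by blast
qed

lemma coeff_hom_compose:
  assumes \<phi>: "\<phi> \<in> coeff_hom p k R A" and f: "f \<in> coeff_hom p k A B"
    and R: "cring R" "max_ideal R \<subseteq> carrier R" "\<And>w. w \<in> carrier (witt_ring p k) \<Longrightarrow> witt_map R w \<in> carrier R"
  shows "compose (carrier R) f \<phi> \<in> coeff_hom p k R B"
proof -
  interpret cring R by (rule R(1))
  have \<phi>h: "\<phi> \<in> Ring.ring_hom R A" "\<phi> ` max_ideal R \<subseteq> max_ideal A"
      "\<And>w. w \<in> carrier (witt_ring p k) \<Longrightarrow> \<phi> (witt_map R w) = witt_map A w"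
    and fh: "f \<in> Ring.ring_hom A B" "f ` max_ideal A \<subseteq> max_ideal B"
      "\<And>w. w \<in> carrier (witt_ring p k) \<Longrightarrow> f (witt_map A w) = witt_map B w"
    using \<phi> f by (auto simp: coeff_hom_def)
  have "compose (carrier R) f \<phi> \<in> Ring.ring_hom R B"
  proof (rule ring_hom_memI)
    fix x assume x: "x \<in> carrier R"
    note x' = ring_hom_closed[OF \<phi>h(1) x]
    show "compose (carrier R) f \<phi> x \<in> carrier B"
      using x ring_hom_closed[OF fh(1) x'] by (simp add: compose_eq)
    fix y assume y: "y \<in> carrier R"
    note y' = ring_hom_closed[OF \<phi>h(1) y]
    show "compose (carrier R) f \<phi> (x \<otimes>\<^bsub>R\<^esub> y) = compose (carrier R) f \<phi> x \<otimes>\<^bsub>B\<^esub> compose (carrier R) f \<phi> y"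
      using x y by (simp add: compose_eq ring_hom_mult[OF \<phi>h(1) x y] ring_hom_mult[OF fh(1) x' y'])
    show "compose (carrier R) f \<phi> (x \<oplus>\<^bsub>R\<^esub> y) = compose (carrier R) f \<phi> x \<oplus>\<^bsub>B\<^esub> compose (carrier R) f \<phi> y"
      using x y by (simp add: compose_eq ring_hom_add[OF \<phi>h(1) x y] ring_hom_add[OF fh(1) x' y'])
  next
    show "compose (carrier R) f \<phi> \<one>\<^bsub>R\<^esub> = \<one>\<^bsub>B\<^esub>"
      by (simp add: compose_eq ring_hom_one[OF \<phi>h(1)] ring_hom_one[OF fh(1)])
  qed
  moreover have "compose (carrier R) f \<phi> ` max_ideal R \<subseteq> max_ideal B"
  proof
    fix z assume "z \<in> compose (carrier R) f \<phi> ` max_ideal R"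
    then obtain x where "x \<in> max_ideal R" "z = compose (carrier R) f \<phi> x" by blast
    moreover from this have "f (\<phi> x) \<in> max_ideal B" using \<phi>h(2) fh(2) by blast
    ultimately show "z \<in> max_ideal B" using R(2) by (simp add: compose_eq subsetD)
  qed
  ultimately show ?thesis
    unfolding coeff_hom_def using R(3) \<phi>h(3) fh(3) by (auto simp: compose_eq)
qed

text \<open>Generators of the maximal ideal together with representatives of the residue field generate a
  dense subring.\<close>

lemma (in adic_ring) finite_topological_generators:
  "\<exists>G. finite G \<and> (\<forall>i B. G \<subseteq> B \<longrightarrow> (\<forall>x\<in>B. \<forall>y\<in>B. x + y \<in> B \<and> x * y \<in> B) \<longrightarrow> M i \<subseteq> B \<longrightarrow> B = UNIV)"
proof -
  obtain F where F: "finite F" "F \<subseteq> M 1"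
    and repr: "\<And>n x. x \<in> M (Suc n) \<Longrightarrow> \<exists>c. (\<forall>f\<in>F. c f \<in> M n) \<and> x - (\<Sum>f\<in>F. c f * f) \<in> K"
    using M_Suc_repr by blast
  obtain F0 where F0: "finite F0" "\<And>x. \<exists>y\<in>F0. x - y \<in> M 1" using residue_finite by auto
  have "B = UNIV" if B: "insert 0 (F \<union> F0) \<subseteq> B" "\<And>x y. x \<in> B \<Longrightarrow> y \<in> B \<Longrightarrow> x + y \<in> B"
    "\<And>x y. x \<in> B \<Longrightarrow> y \<in> B \<Longrightarrow> x * y \<in> B" "M i \<subseteq> B" for i B
  proof -
    have sum: "sum f A \<in> B" if "\<And>a. a \<in> A \<Longrightarrow> f a \<in> B" for f and A :: "'a set"
      using that B(1,2) by (induction A rule: infinite_finite_induct) auto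
    \<comment> \<open>Approximating the coefficients modulo \<open>M n\<close> approximates the
      element modulo \<open>M (Suc n)\<close>, since the generators lie in
      \<open>M 1\<close>.\<close>
    have dense: "\<exists>b\<in>B. x - b \<in> M n" for n x
    proof (induction n arbitrary: x)
      case 0
      then show ?case using B(1) by (auto simp: M_0)
    next
      case (Suc n)
      obtain b where b: "b \<in> F0" "x - b \<in> M 1" using F0 by blast
      then obtain c where c: "x - b - (\<Sum>f\<in>F. c f * f) \<in> K" using repr[of "x - b" 0] by auto
      have "\<exists>d. \<forall>f. d f \<in> B \<and> c f - d f \<in> M n" by (rule choice) (use Suc in blast)
      then obtain d where d: "\<And>f. d f \<in> B" "\<And>f. c f - d f \<in> M n" by blast
      have eq: "x - (b + (\<Sum>f\<in>F. d f * f)) = (x - b - (\<Sum>f\<in>F. c f * f)) + (\<Sum>f\<in>F. (c f - d f) * f)"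
        by (simp add: algebra_simps sum_subtractf)
      have "(\<Sum>f\<in>F. (c f - d f) * f) \<in> M (Suc n)"
        using F(2) M_le_1_mult[OF d(2)] by (intro cr.subspace_sum[OF M_ideal]) blast
      then have "x - (b + (\<Sum>f\<in>F. d f * f)) \<in> M (Suc n)"
        unfolding eq using c K_le by (intro cr.subspace_add[OF M_ideal]) auto
      moreover have "b + (\<Sum>f\<in>F. d f * f) \<in> B" using B(1,3) b(1) d(1) by (intro B(2) sum) auto
      ultimately show ?case by blast
    qed
    have "x \<in> B" for x
    proof -
      obtain b where b: "b \<in> B" "x - b \<in> M i" using dense by blast
      then have "b + (x - b) \<in> B" using B(2,4) by blast
      then show ?thesis by simp
    qed
    then show ?thesis by blast
  qed
  then have "\<forall>i B. insert 0 (F \<union> F0) \<subseteq> B \<longrightarrow> (\<forall>x\<in>B. \<forall>y\<in>B. x + y \<in> B \<and> x * y \<in> B) \<longrightarrow> M i \<subseteq> B \<longrightarrow> B = UNIV"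
    by (intro allI impI) (simp only: Ball_def)
  moreover have "finite (insert 0 (F \<union> F0))" using F(1) F0(1) by simp
  ultimately show ?thesis by blast
qed

text \<open>Modulo \<open>q\<close> a functional is a map of a finite set of representatives to
  itself, so finitely many pairings determine an element up to \<open>tensor_kernel\<close>.
  \<open>\<Theta>\<close> tabulates them.\<close>

lemma (in tensor_quotient) finite_tensor_quotient:
  assumes qT: "finite (range qT)" "\<And>x y. qT x = qT y \<longleftrightarrow> x - y \<in> q"
  obtains \<Theta> :: "'v tensor \<Rightarrow> ('v int_poly \<Rightarrow> 'v int_poly) \<Rightarrow> 'v int_poly" where "finite (range \<Theta>)"
    "\<And>F F'. \<Theta> F = \<Theta> F' \<Longrightarrow> F - F' \<in> tensor_kernel"
proof -
  define r where "r x = inv_into UNIV qT (qT x)" for x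
  define E where "E = range r"
  have r_q: "r x - x \<in> q" for x
    using qT(2)[of "r x" x] by (simp add: r_def f_inv_into_f)
  have q_r: "x - r x \<in> q" for x
    using qT(2)[of x "r x"] by (simp add: r_def f_inv_into_f)
  have r_eq: "x - y \<in> q" if eq: "r x = r y" for x y
    using cr.subspace_diff[OF q q_r[of x] q_r[of y]] by (simp add: eq)
  have "E = inv_into UNIV qT ` range qT" unfolding E_def r_def image_image ..
  then have E: "finite E" using qT(1) by simp
  define \<Theta> where "\<Theta> F = (\<lambda>g\<in>PiE E (\<lambda>_. E). r (tensor_pair (\<lambda>x. g (r x)) F))" for F :: "'v tensor"
  show thesis
  proof (rule that)
    have "\<Theta> F \<in> PiE (PiE E (\<lambda>_. E)) (\<lambda>_. E)" for F
      unfolding \<Theta>_def by (intro restrict_PiE_iff[THEN iffD2] ballI) (simp add: E_def)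
    then have "range \<Theta> \<subseteq> PiE (PiE E (\<lambda>_. E)) (\<lambda>_. E)" by blast
    moreover have "finite (PiE (PiE E (\<lambda>_. E)) (\<lambda>_. E))" using E by (simp add: finite_PiE)
    ultimately show "finite (range \<Theta>)" by (rule finite_subset)
    fix F F' assume eq: "\<Theta> F = \<Theta> F'"
    show "F - F' \<in> tensor_kernel"
      unfolding tensor_kernel_def
    proof (intro CollectI ballI)
      fix h assume h: "h \<in> functionals"
      define g where "g = (\<lambda>e\<in>E. r (h e))"
      have g: "g \<in> PiE E (\<lambda>_. E)" by (auto simp: g_def E_def)
      have hg: "h x - g (r x) \<in> q" for x
      proof -
        have "h (r x + (x - r x)) - (h (r x) + h (x - r x)) \<in> q" by (rule functionals_add[OF h])
        from cr.subspace_add[OF q this functionals_q[OF h q_r[of x]]] have "h x - h (r x) \<in> q" by simp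
        from cr.subspace_add[OF q this q_r[of "h (r x)"]] show ?thesis by (simp add: g_def E_def)
      qed
      have "r (tensor_pair (\<lambda>x. g (r x)) F) = r (tensor_pair (\<lambda>x. g (r x)) F')"
        using fun_cong[OF eq, of g] g by (simp add: \<Theta>_def)
      then have "tensor_pair (\<lambda>x. g (r x)) F - tensor_pair (\<lambda>x. g (r x)) F' \<in> q"
        using r_eq by blast
      then have 1: "tensor_pair (\<lambda>x. g (r x)) (F - F') \<in> q" by (simp add: tensor_pair_diff)
      have "tensor_pair h (F - F') - tensor_pair (\<lambda>x. g (r x)) (F - F') \<in> q"
        by (rule tensor_pair_cong) (rule hg)
      from cr.subspace_add[OF q this 1] show "tensor_pair h (F - F') \<in> q" by simp
    qed
  qed
qed

section \<open>Objects of the category as presented rings\<close>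

locale presented_object = presentation R \<pi>
  for R :: "('a, 'k) coeff_ring" (structure) and \<pi> :: "'r::comm_ring_1 \<Rightarrow> 'a" +
  fixes p :: nat and k :: "'k ring"
  assumes k: "field k" and k_finite: "finite (carrier k)" and k_char: "has_char k p"
    and R_object: "R \<in> coeff_category p k"
begin

definition M where "M j = \<pi> -` max_ideal_pow R j"
definition K where "K = \<pi> -` {\<zero>}"
definition \<rho> where "\<rho> x = residue R (\<pi> x)"
text \<open>A lift of the structure map along \<open>\<pi>\<close>, chosen elementwise; it respects
  the operations only modulo \<open>K\<close>.\<close>

definition \<omega> where "\<omega> w = (SOME x. \<pi> x = witt_map R w)"

lemma R_noetherian: "noetherian_ring R" and R_local: "local_cring R" and R_complete: "complete_local R"
  and residue_hom: "residue R \<in> Ring.ring_hom R k" and residue_range: "residue R ` carrier R = carrier k"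
  and residue_kernel: "a_kernel R k (residue R) = max_ideal R"
  and witt_hom: "witt_map R \<in> Ring.ring_hom (witt_ring p k) R"
  and residue_witt: "w \<in> carrier (witt_ring p k) \<Longrightarrow> residue R (witt_map R w) = w 0"
  using R_object by (auto simp: coeff_category_def)

lemma max_ideal_ideal: "ideal (max_ideal R) R"
  using local_max_ideal(1)[OF R_local] by (rule maximalideal.axioms(1))

lemma max_ideal_carrier: "max_ideal R \<subseteq> carrier R"
  using ideal.Icarr[OF max_ideal_ideal] by blast

lemma max_ideal_pow_1: "max_ideal_pow R 1 = max_ideal R"
  using ideal_prod_commute[OF oneideal max_ideal_ideal] ideal_prod_one[OF max_ideal_ideal]
  by (simp add: max_ideal_pow_Suc)

lemma p_prime: "Factorial_Ring.prime p"
  using k k_finite k_char by (rule finite_field_char_prime)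

lemma residue_presentation: "presentation k \<rho>"
proof -
  interpret k: field k by (rule k)
  show ?thesis
  proof
    show "range \<rho> = carrier k"
      unfolding \<rho>_def residue_range[symmetric] q_range[symmetric] by (simp add: image_image)
  qed (simp_all add: \<rho>_def q_add q_mult q_one ring_hom_add[OF residue_hom] ring_hom_mult[OF residue_hom]
      ring_hom_one[OF residue_hom])
qed

sublocale \<rho>: presentation k \<rho> by (rule residue_presentation)

lemma max_ideal_iff: "\<pi> x \<in> max_ideal R \<longleftrightarrow> \<rho> x = \<zero>\<^bsub>k\<^esub>"
  by (simp add: residue_kernel[symmetric] a_kernel_def' \<rho>_def)

lemma M_1: "x \<in> M 1 \<longleftrightarrow> \<rho> x = \<zero>\<^bsub>k\<^esub>"
  unfolding M_def max_ideal_pow_1 by (simp add: max_ideal_iff)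

lemma \<pi>_\<omega>: "witt_map R w \<in> carrier R \<Longrightarrow> \<pi> (\<omega> w) = witt_map R w"
  unfolding \<omega>_def by (rule someI_ex) (metis obtain_preimage)

lemma witt_closed: "w \<in> carrier (witt_ring p k) \<Longrightarrow> witt_map R w \<in> carrier R"
  by (rule ring_hom_closed[OF witt_hom])

sublocale adic_ring_prime M K p
proof
  show "cr.subspace (M n)" for n
    unfolding M_def by (intro ideal_vimage max_ideal_pow_ideal max_ideal_ideal)
  have pow_ideal: "ideal (max_ideal_pow R n) R" for n by (intro max_ideal_pow_ideal max_ideal_ideal)
  have zero_mem: "\<zero> \<in> max_ideal_pow R n" for n
    using pow_ideal by (simp add: additive_subgroup.zero_closed ideal.axioms(1))
  show "K = (\<Inter>n. M n)"
  proof
    show "K \<subseteq> (\<Inter>n. M n)" using zero_mem by (auto simp: K_def M_def)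
    show "(\<Inter>n. M n) \<subseteq> K"
    proof
      \<comment> \<open>Both \<open>\<pi> x\<close> and zero are limits of the constant sequence
        zero, and limits are unique.\<close>
      fix x assume x: "x \<in> (\<Inter>n. M n)"
      have zz: "\<zero> \<ominus> \<zero> = \<zero>" by simp
      have "\<exists>!y. y \<in> carrier R \<and> (\<forall>n. y \<ominus> \<zero> \<in> max_ideal_pow R n)"
        by (intro R_complete[unfolded complete_local_def, rule_format, of "\<lambda>_. \<zero>"] conjI zero_closed)
          (simp only: zz zero_mem)
      moreover have "\<pi> x \<in> carrier R \<and> (\<forall>n. \<pi> x \<ominus> \<zero> \<in> max_ideal_pow R n)"
        using x by (auto simp: M_def a_minus_def)
      moreover have "\<zero> \<in> carrier R \<and> (\<forall>n. \<zero> \<ominus> \<zero> \<in> max_ideal_pow R n)"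
        by (simp add: zz zero_mem)
      ultimately have "\<pi> x = \<zero>" by blast
      then show "x \<in> K" by (simp add: K_def)
    qed
  qed
  show M0: "M 0 = UNIV" by (auto simp: M_def)
  have M1: "M 1 = \<pi> -` max_ideal R" unfolding M_def max_ideal_pow_1 ..
  show "x * y \<in> M (Suc n)" if "x \<in> M 1" "y \<in> M n" for x y n
  proof -
    have "\<pi> (y * x) \<in> max_ideal_pow R n \<cdot> max_ideal R"
      unfolding q_mult using that M1 by (intro ideal_prod.prod) (auto simp: M_def)
    then show ?thesis by (simp add: M_def max_ideal_pow_Suc mult.commute)
  qed
  show "M (Suc n) \<subseteq> cr.span ({x * y |x y. x \<in> M 1 \<and> y \<in> M n} \<union> K)" for n
  proof -
    have "{x * y |x y. x \<in> M n \<and> y \<in> M 1} = {x * y |x y. x \<in> M 1 \<and> y \<in> M n}"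
      using mult.commute by blast
    then show ?thesis
      using ideal_prod_vimage[OF pow_ideal[of n] max_ideal_ideal]
      unfolding M1[symmetric] M_def[symmetric, of n] K_def[symmetric] max_ideal_pow_Suc[symmetric] M_def[symmetric, of "Suc n"]
      by simp
  qed
  show "\<exists>y. \<forall>n. y - s n \<in> M n" if s: "\<And>n. s (Suc n) - s n \<in> M n" for s
  proof -
    have "\<forall>n. \<pi> (s n) \<in> carrier R \<and> \<pi> (s (Suc n)) \<ominus> \<pi> (s n) \<in> max_ideal_pow R n"
      using s by (auto simp: M_def q_diff)
    then obtain y where y: "y \<in> carrier R" "\<And>n. y \<ominus> \<pi> (s n) \<in> max_ideal_pow R n"
      using R_complete[unfolded complete_local_def, rule_format, of "\<lambda>n. \<pi> (s n)"] by blast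
    obtain x where "\<pi> x = y" using obtain_preimage[OF y(1)] .
    then have "\<forall>n. x - s n \<in> M n" using y(2) by (auto simp: M_def q_diff)
    then show ?thesis by blast
  qed
  show "\<exists>F. finite F \<and> I = cr.span (F \<union> K)" if "cr.subspace I" "K \<subseteq> I" for I
    using noetherian_vimage[OF R_noetherian that(1)] that(2) by (simp add: K_def)
  show "\<exists>F. finite F \<and> (\<forall>x. \<exists>y\<in>F. x - y \<in> M 1)"
  proof (intro exI conjI allI)
    show "finite (inv_into UNIV \<rho> ` carrier k)" using k_finite by simp
    fix x
    have "\<rho> (inv_into UNIV \<rho> (\<rho> x)) = \<rho> x" by (simp add: f_inv_into_f)
    then have "\<rho> (x - inv_into UNIV \<rho> (\<rho> x)) = \<zero>\<^bsub>k\<^esub>" by (simp add: \<rho>.q_eq_iff[symmetric])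
    then have "x - inv_into UNIV \<rho> (\<rho> x) \<in> M 1" by (simp only: M_1)
    then show "\<exists>y\<in>inv_into UNIV \<rho> ` carrier k. x - y \<in> M 1" by (rule bexI) (simp only: image_eqI[OF refl] \<rho>.q_closed)
  qed
  show "Factorial_Ring.prime p" by (rule p_prime)
  have "\<rho> (of_nat p) = \<zero>\<^bsub>k\<^esub>" using k_char by (simp add: \<rho>.q_of_nat has_char_def)
  then show "of_nat p \<in> M 1" by (simp only: M_1)
qed

lemma local_inverse:
  assumes "x \<notin> M 1" shows "\<exists>y. 1 - x * y \<in> M 1"
proof -
  have "\<rho> x \<noteq> \<zero>\<^bsub>k\<^esub>" using assms by (simp only: M_1 not_False_eq_True)
  then have u: "\<rho> x \<in> Units k" by (simp add: field.field_Units[OF k])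
  obtain y where "\<rho> y = inv\<^bsub>k\<^esub> \<rho> x" using \<rho>.obtain_preimage[OF \<rho>.Units_inv_closed[OF u]] .
  then have "\<rho> (1 - x * y) = \<zero>\<^bsub>k\<^esub>" using \<rho>.Units_r_inv[OF u] by (simp add: \<rho>.q_diff \<rho>.q_mult \<rho>.q_one)
  then show ?thesis using M_1 by blast
qed

lemma char_0:
  assumes "has_char R 0" shows "of_nat (p ^ r) \<notin> K"
  using assms p_prime by (auto simp: K_def q_of_nat has_char_def simp del: of_nat_power dest: prime_gt_0_nat)

end

lemma span_mult_left_le:
  assumes "cr.subspace C" "\<And>y. y \<in> G \<Longrightarrow> x * y \<in> C" "y \<in> cr.span G"
  shows "x * y \<in> C"
proof -
  have "cr.span G \<subseteq> {y. x * y \<in> C}"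
    using assms(2) by (intro cr.span_minimal subspace_colon assms(1)) auto
  then show ?thesis using assms(3) by blast
qed

section \<open>The first-order neighbourhood of the diagonal\<close>

locale tensor_square = presented_object R \<pi> p k
  for R :: "('a, 'k) coeff_ring" (structure) and \<pi> :: "'v int_poly \<Rightarrow> 'a" and p k +
  fixes Q :: "'v int_poly set" and i :: nat
  assumes Q: "cr.subspace Q" and Q_lower: "M i \<subseteq> Q" and Q_upper: "Q \<subseteq> M 1"
begin

sublocale tensor_quotient Q by unfold_locales (rule Q)

abbreviation I where "I \<equiv> diagonal_ideal :: 'v tensor set"

lemma s_subspace: "cr.subspace first_order_ideal"
  by (simp add: first_order_ideal_def)

lemma kernel_le_s: "x \<in> tensor_kernel \<Longrightarrow> x \<in> first_order_ideal"
  unfolding first_order_ideal_def by (rule cr.span_base) simp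

lemma I_square: "a \<in> I \<Longrightarrow> b \<in> I \<Longrightarrow> a * b \<in> first_order_ideal"
  unfolding first_order_ideal_def by (rule cr.span_base) blast

lemma left_Q: "x \<in> Q \<Longrightarrow> tensor_left x \<in> first_order_ideal"
  and right_Q: "x \<in> Q \<Longrightarrow> tensor_right x \<in> first_order_ideal"
  by (auto intro: kernel_le_s tensor_left_kernel tensor_right_kernel)

lemma diff_Q: "x \<in> Q \<Longrightarrow> tensor_diff x \<in> first_order_ideal"
  unfolding tensor_diff_def by (intro cr.subspace_diff[OF s_subspace] left_Q right_Q)

lemma \<rho>_Q: "x \<in> Q \<Longrightarrow> \<rho> x = \<zero>\<^bsub>k\<^esub>"
  using Q_upper M_1 by blast

lemma \<rho>_s:
  assumes "F \<in> first_order_ideal" shows "\<rho> (tensor_mult F) = \<zero>\<^bsub>k\<^esub>"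
proof -
  have "cr.subspace {F :: 'v tensor. \<rho> (tensor_mult F) = \<zero>\<^bsub>k\<^esub>}"
    by (rule cr.subspaceI) (simp_all add: \<rho>.q_zero \<rho>.q_add \<rho>.q_mult)
  then have "first_order_ideal \<subseteq> {F :: 'v tensor. \<rho> (tensor_mult F) = \<zero>\<^bsub>k\<^esub>}"
    unfolding first_order_ideal_def
    by (rule cr.span_minimal[rotated]) (auto simp: \<rho>_Q tensor_mult_kernel tensor_mult_diagonal \<rho>.q_zero)
  then show ?thesis using assms by blast
qed

text \<open>The powers of the maximal ideal of the quotient by \<open>first_order_ideal\<close>: up to \<open>i\<close> factors
  kill the left-hand component, and \<open>i\<close> more kill \<open>I\<close>.\<close>

definition chain :: "nat \<Rightarrow> 'v tensor set" where
  "chain j = (if j < i then cr.span (tensor_left ` M j \<union> I)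
    else cr.span ({tensor_left x * y |x y. x \<in> M (j - i) \<and> y \<in> I} \<union> first_order_ideal))"

lemma i_pos: "i > 0"
proof (rule ccontr)
  assume "\<not> i > 0"
  then have "1 \<in> M 1" using Q_lower Q_upper M_0 by auto
  then show False
    using k unfolding M_1 \<rho>.q_one by (metis domain.one_not_zero field.axioms(1))
qed

lemma chain_subspace: "cr.subspace (chain j)"
  by (simp add: chain_def)

lemma chain_0: "chain 0 = UNIV"
proof -
  have "F \<in> chain 0" for F
  proof -
    have "tensor_left (tensor_mult F) + (F - tensor_left (tensor_mult F)) \<in> chain 0"
      using i_pos diagonal_decomposition[of F] unfolding chain_def
      by (intro cr.subspace_add) (auto simp: M_0 intro!: cr.span_base)
    then show ?thesis by simp
  qed
  then show ?thesis by blast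
qed

lemma chain_end: "chain (2 * i) \<subseteq> first_order_ideal"
proof -
  have "tensor_left x * y \<in> first_order_ideal" if "x \<in> M i" for x y
    using left_Q Q_lower that by (intro subspace_mult_right[OF s_subspace]) blast
  then have "cr.span ({tensor_left x * y |x y. x \<in> M i \<and> y \<in> I} \<union> first_order_ideal) \<subseteq> first_order_ideal"
    by (intro cr.span_minimal s_subspace) auto
  then show ?thesis by (simp add: chain_def)
qed

text \<open>\<open>z\<close> is the left copy of an element of \<open>M 1\<close> plus an element of
  the diagonal ideal. Below \<open>i\<close> the first part raises the power of \<open>M\<close> and
  the second lands in the diagonal ideal. From \<open>i\<close> on, the first part still raises the
  power, while the second multiplies the diagonal ideal into its square.\<close>

lemma chain_mult:
  assumes z: "\<rho> (tensor_mult z) = \<zero>\<^bsub>k\<^esub>" and y: "y \<in> chain j" shows "z * y \<in> chain (Suc j)"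
proof -
  define m where "m = tensor_mult z"
  define e where "e = z - tensor_left m"
  have z_eq: "z = tensor_left m + e" by (simp add: e_def)
  have m: "m \<in> M 1" using z unfolding M_1 m_def .
  have e: "e \<in> I" unfolding e_def m_def by (rule diagonal_decomposition)
  note I = diagonal_ideal_subspace[where 'a = 'v]
  show ?thesis
  proof (cases "j < i")
    case True
    have I_sub: "a \<in> chain (Suc j)" if a: "a \<in> I" for a
    proof (cases "Suc j < i")
      case True
      then show ?thesis using a by (auto simp: chain_def intro!: cr.span_base)
    next
      case False
      with \<open>j < i\<close> have "Suc j - i = 0" by simp
      \<comment> \<open>Here \<open>Suc j = i\<close>, where the definition of \<open>chain\<close>
        switches; the factor from \<open>M\<close> is then unrestricted, so the whole diagonal ideal
        is available.\<close>
      then have "1 \<in> M (Suc j - i)" using M_0 by simp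
      then have "tensor_left 1 * a \<in> {tensor_left x * y |x y. x \<in> M (Suc j - i) \<and> y \<in> I}"
        using a by blast
      then have "tensor_left 1 * a \<in> chain (Suc j)"
        using False unfolding chain_def by (simp del: tensor_left_simps add: cr.span_base)
      then show ?thesis by simp
    qed
    have left_sub: "tensor_left x \<in> chain (Suc j)" if x: "x \<in> M (Suc j)" for x
    proof (cases "Suc j < i")
      case True
      then show ?thesis using x by (auto simp: chain_def intro!: cr.span_base)
    next
      case False
      with \<open>j < i\<close> have "Suc j = i" by simp
      then have "tensor_left x \<in> first_order_ideal" using x Q_lower left_Q by blast
      then show ?thesis using False unfolding chain_def by (auto intro!: cr.span_base)
    qed
    have gen: "z * y \<in> chain (Suc j)" if "y \<in> tensor_left ` M j \<union> I" for y
      using that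
    proof
      assume "y \<in> I"
      then show ?thesis using subspace_mult_left[OF I] I_sub by blast
    next
      assume "y \<in> tensor_left ` M j"
      then obtain x where x: "x \<in> M j" "y = tensor_left x" by blast
      have "z * y = tensor_left (m * x) + e * y" by (simp add: z_eq x(2) distrib_right)
      also have "\<dots> \<in> chain (Suc j)"
        using M_mult[OF m x(1)] subspace_mult_right[OF I e]
        by (intro cr.subspace_add[OF chain_subspace] left_sub I_sub)
      finally show ?thesis .
    qed
    have "y \<in> cr.span (tensor_left ` M j \<union> I)" using y True by (simp add: chain_def)
    from span_mult_left_le[OF chain_subspace gen this] show ?thesis .
  next
    case False
    have s_sub: "a \<in> chain (Suc j)" if "a \<in> first_order_ideal" for a
      using that False by (auto simp: chain_def intro!: cr.span_base)
    have gen: "z * y \<in> chain (Suc j)" if "y \<in> {tensor_left x * y |x y. x \<in> M (j - i) \<and> y \<in> I} \<union> first_order_ideal" for y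
      using that
    proof
      assume "y \<in> first_order_ideal"
      then show ?thesis using subspace_mult_left[OF s_subspace] s_sub by blast
    next
      assume "y \<in> {tensor_left x * y |x y. x \<in> M (j - i) \<and> y \<in> I}"
      then obtain x b where x: "x \<in> M (j - i)" "b \<in> I" "y = tensor_left x * b" by blast
      have "Suc (j - i) = Suc j - i" using False by simp
      then have "m * x \<in> M (Suc j - i)" using M_mult[OF m x(1)] by (simp only:)
      then have 1: "tensor_left (m * x) * b \<in> chain (Suc j)"
        using x(2) False unfolding chain_def by (auto simp del: tensor_left_simps intro!: cr.span_base)
      have 2: "tensor_left x * (e * b) \<in> chain (Suc j)"
        by (intro s_sub subspace_mult_left[OF s_subspace] I_square e x(2))
      have "z * y = tensor_left (m * x) * b + tensor_left x * (e * b)"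
        by (simp add: z_eq x(3) algebra_simps)
      then show ?thesis using cr.subspace_add[OF chain_subspace 1 2] by simp
    qed
    have "y \<in> cr.span ({tensor_left x * y |x y. x \<in> M (j - i) \<and> y \<in> I} \<union> first_order_ideal)"
      using y False by (simp add: chain_def)
    from span_mult_left_le[OF chain_subspace gen this] show ?thesis .
  qed
qed

text \<open>The Leibniz rule. With one left and one right factor it holds exactly, not just modulo
  the square of the diagonal ideal.\<close>

lemma diff_mult: "tensor_diff (x * y) = tensor_left x * tensor_diff y + tensor_right y * tensor_diff x"
  by (simp add: tensor_diff_def algebra_simps)

lemma diff_power:
  "tensor_diff (x ^ n) - of_nat n * (tensor_right x ^ (n - 1) * tensor_diff x) \<in> first_order_ideal"
proof (induction n)
  case 0
  then show ?case by (simp add: tensor_diff_def cr.subspace_0 s_subspace)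
next
  case (Suc n)
  note [simp del] = power_Suc of_nat_Suc
  have pow: "tensor_right (x ^ n) = tensor_right x ^ n" by (simp add: tensor_right_def)
  let ?D = "tensor_diff x"
  have left: "tensor_left x = tensor_right x + ?D" by (simp add: tensor_diff_def)
  have step: "of_nat n * (tensor_right x ^ (n - 1) * ?D) * tensor_right x = of_nat n * (tensor_right x ^ n * ?D)"
    by (cases n) (simp_all add: power_Suc mult_ac)
  have "tensor_diff (x ^ Suc n) - of_nat (Suc n) * (tensor_right x ^ n * ?D) =
      tensor_left x * (tensor_diff (x ^ n) - of_nat n * (tensor_right x ^ (n - 1) * ?D))
      + (of_nat n * tensor_right x ^ (n - 1)) * (?D * ?D)"
  proof -
    have "tensor_left x * (of_nat n * (tensor_right x ^ (n - 1) * ?D))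
        = of_nat n * (tensor_right x ^ n * ?D) + (of_nat n * tensor_right x ^ (n - 1)) * (?D * ?D)"
      unfolding left distrib_right using step by (simp add: mult_ac)
    then show ?thesis
      unfolding power_Suc[of x] diff_mult pow by (simp add: of_nat_Suc algebra_simps)
  qed
  also have "\<dots> \<in> first_order_ideal"
    by (intro cr.subspace_add[OF s_subspace] subspace_mult_left[OF s_subspace] Suc.IH I_square tensor_diff_in_diagonal)
  finally show ?case by simp
qed

text \<open>The preimage under \<open>\<pi>\<close> of the image of \<open>W(k)\<close>. Closure
  under sums and products is what gets established for it.\<close>

definition witt_set where "witt_set = {x. \<exists>w\<in>carrier (witt_ring p k). \<pi> x = witt_map R w}"

lemma witt_ring_closed:
  assumes "v \<in> carrier (witt_ring p k)" "w \<in> carrier (witt_ring p k)"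
  shows "v \<oplus>\<^bsub>witt_ring p k\<^esub> w \<in> carrier (witt_ring p k)" "v \<otimes>\<^bsub>witt_ring p k\<^esub> w \<in> carrier (witt_ring p k)"
proof -
  have "case_sum v w u \<in> carrier k" for u using assms by (cases u) (auto simp: witt_ring_def)
  then show "v \<oplus>\<^bsub>witt_ring p k\<^esub> w \<in> carrier (witt_ring p k)" "v \<otimes>\<^bsub>witt_ring p k\<^esub> w \<in> carrier (witt_ring p k)"
    by (simp_all add: witt_ring_def eval_witt_poly_eq \<rho>.poly_eval_closed)
qed

lemma witt_set_closed:
  assumes "x \<in> witt_set" "y \<in> witt_set" shows witt_set_add: "x + y \<in> witt_set" and witt_set_mult: "x * y \<in> witt_set"
proof -
  obtain v w where "v \<in> carrier (witt_ring p k)" "w \<in> carrier (witt_ring p k)" "\<pi> x = witt_map R v" "\<pi> y = witt_map R w"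
    using assms by (auto simp: witt_set_def)
  then show "x + y \<in> witt_set" "x * y \<in> witt_set"
    unfolding witt_set_def using witt_ring_closed
    by (auto simp: q_add q_mult ring_hom_add[OF witt_hom, symmetric] ring_hom_mult[OF witt_hom, symmetric])
qed

lemma witt_set_1: "1 \<in> witt_set"
proof -
  have "\<one>\<^bsub>witt_ring p k\<^esub> \<in> carrier (witt_ring p k)" by (simp add: witt_ring_def)
  moreover have "\<pi> 1 = witt_map R \<one>\<^bsub>witt_ring p k\<^esub>"
    unfolding q_one by (rule ring_hom_one[OF witt_hom, symmetric])
  ultimately show ?thesis unfolding witt_set_def by blast
qed

lemma witt_set_power: "x \<in> witt_set \<Longrightarrow> x ^ n \<in> witt_set"
  by (induction n) (auto intro: witt_set_1 witt_set_mult)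

lemma witt_set_of_nat_mult: assumes "x \<in> witt_set" shows "of_nat (Suc n) * x \<in> witt_set"
proof (induction n)
  case (Suc n)
  have "of_nat (Suc (Suc n)) * x = x + of_nat (Suc n) * x" by (simp add: distrib_right)
  then show ?case using witt_set_add[OF assms Suc] by (simp only:)
qed (simp add: assms)

lemma \<omega>_witt_set: "w \<in> carrier (witt_ring p k) \<Longrightarrow> \<omega> w \<in> witt_set"
  unfolding witt_set_def using \<pi>_\<omega>[OF witt_closed] by blast

lemma \<rho>_\<omega>: "w \<in> carrier (witt_ring p k) \<Longrightarrow> \<rho> (\<omega> w) = w 0"
  by (simp add: \<rho>_def \<pi>_\<omega> witt_closed residue_witt)

lemma witt_set_multiple_of_p:
  assumes "x \<in> witt_set" "\<rho> x = \<zero>\<^bsub>k\<^esub>" obtains y where "y \<in> witt_set" "x - of_nat p * y \<in> K"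
proof -
  obtain w where w: "w \<in> carrier (witt_ring p k)" "\<pi> x = witt_map R w" using assms(1) by (auto simp: witt_set_def)
  then have "w 0 = \<zero>\<^bsub>k\<^esub>" using assms(2) residue_witt by (simp add: \<rho>_def)
  then obtain b where b: "b \<in> carrier (witt_ring p k)" "witt_map R w = add_pow R p (witt_map R b)"
    using witt_hom_multiple_of_char[OF k k_finite k_char is_cring witt_hom w(1)] by blast
  have "\<pi> (x - of_nat p * \<omega> b) = \<zero>"
    by (simp add: q_diff q_of_nat_mult \<pi>_\<omega> witt_closed b w(2))
  then show thesis using that \<omega>_witt_set[OF b(1)] by (simp add: K_def)
qed

lemma witt_set_root:
  assumes "x \<in> witt_set" obtains y where "y \<in> witt_set" "\<rho> (y ^ p) = \<rho> x"
proof -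
  obtain a where a: "a \<in> carrier k" "a [^]\<^bsub>k\<^esub> p = \<rho> x"
    using finite_field_frobenius_surj[OF k k_finite k_char \<rho>.q_closed] by blast
  define w where "w = (\<lambda>n::nat. if n = 0 then a else \<zero>\<^bsub>k\<^esub>)"
  have w: "w \<in> carrier (witt_ring p k)" using a(1) by (simp add: w_def witt_ring_def)
  then have "\<rho> (\<omega> w ^ p) = \<rho> x" by (simp add: \<rho>.q_power \<rho>_\<omega>) (simp add: w_def a(2))
  then show thesis using that \<omega>_witt_set[OF w] by blast
qed

text \<open>The derivation \<open>tensor_diff\<close> kills the image of the Witt vectors because every element of this
  image is a \<open>p\<close>-th power up to a multiple of \<open>p\<close>.\<close>

lemma diff_witt_step:
  assumes "x \<in> witt_set"
  shows "tensor_diff x \<in> cr.span (first_order_ideal \<union> {of_nat (p ^ j) * y |y. y \<in> I})"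
  using assms
proof (induction j arbitrary: x)
  case 0
  then show ?case using tensor_diff_in_diagonal by (auto intro!: cr.span_base)
next
  case (Suc j)
  let ?S = "\<lambda>j. cr.span (first_order_ideal \<union> {of_nat (p ^ j) * y |y. y \<in> I})"
  have s_sub: "a \<in> ?S (Suc j)" if "a \<in> first_order_ideal" for a
    using that by (auto intro!: cr.span_base)
  have p_mult: "of_nat p * a \<in> ?S (Suc j)" if a: "a \<in> ?S j" for a
  proof (rule span_mult_left_le[OF cr.subspace_span _ a])
    fix b assume "b \<in> first_order_ideal \<union> {of_nat (p ^ j) * y |y. y \<in> I}"
    then show "of_nat p * b \<in> ?S (Suc j)"
    proof
      assume "b \<in> {of_nat (p ^ j) * y |y. y \<in> I}"
      then obtain y where y: "y \<in> I" "b = of_nat (p ^ j) * y" by blast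
      then have "of_nat p * b = of_nat (p ^ Suc j) * y" by (simp add: mult_ac)
      then show ?thesis using y(1) by (intro cr.span_base) blast
    qed (use s_sub subspace_mult_left[OF s_subspace] in blast)
  qed
  obtain y where y: "y \<in> witt_set" "\<rho> (y ^ p) = \<rho> x" using witt_set_root[OF Suc.prems] .
  \<comment> \<open>The aim is an element \<open>z\<close> congruent to \<open>x - y ^ p\<close>
    modulo \<open>Q\<close> that stays in \<open>witt_set\<close>. As only sums, products and
    positive multiples are at hand, \<open>- y ^ p\<close> is replaced by \<open>p ^ i - 1\<close>
    times \<open>y ^ p\<close>, and \<open>Suc u\<close> is that positive factor; the difference is
    a multiple of \<open>p ^ i\<close>, which lies in \<open>Q\<close>.\<close>
  define u where "u = p ^ i - 2"
  have p1: "p > 1" using p_prime by (rule prime_gt_1_nat)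
  then have "p ^ i > 1" using i_pos by (rule one_less_power)
  then have u: "p ^ i = Suc (Suc u)" by (simp add: u_def)
  define z where "z = x + of_nat (Suc u) * y ^ p"
  have z: "z \<in> witt_set"
    unfolding z_def by (intro witt_set_add Suc.prems witt_set_of_nat_mult witt_set_power y(1))
  have "\<rho> (x + of_nat (Suc u) * y ^ p) = \<rho> (x - y ^ p + of_nat (p ^ i) * y ^ p)"
    unfolding u by (rule arg_cong[where f = \<rho>]) (simp add: algebra_simps)
  also have "\<dots> = \<zero>\<^bsub>k\<^esub>"
  proof -
    have "of_nat (p ^ i) * y ^ p \<in> Q" using Q_lower p_power_in_M by (intro subspace_mult_right[OF Q]) blast
    then have "\<rho> (of_nat (p ^ i) * y ^ p) = \<zero>\<^bsub>k\<^esub>" by (rule \<rho>_Q)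
    moreover have "\<rho> (x - y ^ p) = \<zero>\<^bsub>k\<^esub>" using y(2) by (simp add: \<rho>.q_eq_iff[symmetric])
    ultimately show ?thesis by (simp add: \<rho>.q_add del: of_nat_power)
  qed
  finally have "\<rho> z = \<zero>\<^bsub>k\<^esub>" by (simp only: z_def)
  then obtain b where b: "b \<in> witt_set" "z - of_nat p * b \<in> K" by (rule witt_set_multiple_of_p[OF z])
  then have 1: "tensor_diff (z - of_nat p * b) \<in> ?S (Suc j)" using K_le Q_lower diff_Q s_sub by blast
  have 2: "of_nat p * tensor_diff b \<in> ?S (Suc j)" using Suc.IH[OF b(1)] by (rule p_mult)
  have 3: "tensor_diff (y ^ p) - of_nat p * (tensor_right y ^ (p - 1) * tensor_diff y) \<in> ?S (Suc j)"
    using diff_power by (rule s_sub)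
  have 4: "of_nat p * (tensor_right y ^ (p - 1) * tensor_diff y) \<in> ?S (Suc j)"
    by (intro p_mult cr.span_scale Suc.IH y(1))
  have 5: "tensor_diff (y ^ p) \<in> ?S (Suc j)" using cr.span_add[OF 3 4] by simp
  \<comment> \<open>Modulo \<open>first_order_ideal\<close>, the differentials of \<open>z\<close>
    and of \<open>y ^ p\<close> are \<open>p\<close> times combinations of those of \<open>b\<close>
    and \<open>y\<close>: the first because \<open>z\<close> is \<open>p * b\<close> up to
    \<open>K\<close>, the second by \<open>diff_power\<close>. The induction hypothesis for
    \<open>b\<close> and \<open>y\<close> thus gains a factor \<open>p\<close>.\<close>
  have "tensor_diff x = tensor_diff (z - of_nat p * b) + of_nat p * tensor_diff b - of_nat (Suc u) * tensor_diff (y ^ p)"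
    unfolding z_def tensor_diff_def by (simp add: tensor_left_of_nat tensor_right_of_nat algebra_simps del: of_nat_Suc)
  also have "\<dots> \<in> ?S (Suc j)"
    by (rule cr.span_diff[OF cr.span_add[OF 1 2] cr.span_scale[OF 5]])
  finally show ?case .
qed

text \<open>\<open>p ^ i\<close> lies in \<open>Q\<close>, so its multiples vanish in the quotient
  and \<open>i\<close> steps suffice.\<close>

lemma diff_witt: assumes "x \<in> witt_set" shows "tensor_diff x \<in> first_order_ideal"
proof -
  have "tensor_left (of_nat (p ^ i)) \<in> first_order_ideal" using Q_lower p_power_in_M by (intro left_Q) blast
  then have "of_nat (p ^ i) * y \<in> first_order_ideal" for y
    unfolding tensor_left_of_nat by (rule subspace_mult_right[OF s_subspace])
  then have "cr.span (first_order_ideal \<union> {of_nat (p ^ i) * y |y. y \<in> I}) \<subseteq> first_order_ideal"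
    by (intro cr.span_minimal s_subspace) (auto simp del: of_nat_power)
  then show ?thesis using diff_witt_step[OF assms, of i] by blast
qed

end

locale tensor_square_codes = tensor_square R \<pi> p k Q i
  for R :: "('a, 'k) coeff_ring" (structure) and \<pi> :: "'v int_poly \<Rightarrow> 'a" and p k Q i +
  fixes qT :: "'v int_poly \<Rightarrow> nat set" and qS :: "'v tensor \<Rightarrow> nat set"
  assumes qT: "finite (range qT)" "qT x = qT y \<longleftrightarrow> x - y \<in> Q"
    and qS: "finite (range qS)" "qS F = qS F' \<longleftrightarrow> F - F' \<in> first_order_ideal"
begin

lemma \<omega>_hom:
  assumes v: "v \<in> carrier (witt_ring p k)" and w: "w \<in> carrier (witt_ring p k)"
  shows "\<omega> (v \<oplus>\<^bsub>witt_ring p k\<^esub> w) - (\<omega> v + \<omega> w) \<in> Q" "\<omega> (v \<otimes>\<^bsub>witt_ring p k\<^esub> w) - \<omega> v * \<omega> w \<in> Q"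
proof -
  note c = witt_ring_closed[OF v w]
  have "\<omega> (v \<oplus>\<^bsub>witt_ring p k\<^esub> w) - (\<omega> v + \<omega> w) \<in> K" "\<omega> (v \<otimes>\<^bsub>witt_ring p k\<^esub> w) - \<omega> v * \<omega> w \<in> K"
    using \<pi>_\<omega>[OF witt_closed[OF c(1)]] \<pi>_\<omega>[OF witt_closed[OF c(2)]] 
    by (simp_all add: K_def q_diff q_add q_mult \<pi>_\<omega> witt_closed v w ring_hom_add[OF witt_hom v w] ring_hom_mult[OF witt_hom v w])
  then show "\<omega> (v \<oplus>\<^bsub>witt_ring p k\<^esub> w) - (\<omega> v + \<omega> w) \<in> Q" "\<omega> (v \<otimes>\<^bsub>witt_ring p k\<^esub> w) - \<omega> v * \<omega> w \<in> Q"
    using K_le Q_lower by blast+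
qed

lemma \<omega>_one: "\<omega> \<one>\<^bsub>witt_ring p k\<^esub> - 1 \<in> Q"
proof -
  have "\<pi> (\<omega> \<one>\<^bsub>witt_ring p k\<^esub>) = \<one>" using \<pi>_\<omega>[of "\<one>\<^bsub>witt_ring p k\<^esub>"] by (simp add: ring_hom_one[OF witt_hom])
  then have "\<omega> \<one>\<^bsub>witt_ring p k\<^esub> - 1 \<in> K" by (simp add: K_def q_diff q_one)
  then show ?thesis using K_le Q_lower by blast
qed

sublocale T: finite_quotient p k Q qT \<rho> \<omega> M i
proof (rule finite_quotient.intro)
  show "x * y \<in> M (Suc j)" if "\<rho> x = \<zero>\<^bsub>k\<^esub>" "y \<in> M j" for x y j
    using that M_mult M_1 by blast
qed (fact k Q qT \<rho>.q_add \<rho>.q_mult \<rho>.q_one \<rho>.q_range \<rho>_Q M_0 M_ideal Q_lower \<omega>_hom \<omega>_one \<rho>_\<omega>)+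

text \<open>The structure map from \<open>W(k)\<close> uses the right-hand copy; by
  \<open>diff_witt\<close> the left-hand copy would give the same map. The residue map factors
  through the diagonal, and \<open>chain\<close> bounds the nilpotency of its kernel by
  \<open>2 * i\<close>.\<close>

sublocale S: finite_quotient p k first_order_ideal qS "\<lambda>F. \<rho> (tensor_mult F)" "\<lambda>w. tensor_right (\<omega> w)" chain "2 * i"
proof (rule finite_quotient.intro)
  have "range (\<lambda>F::'v tensor. \<rho> (tensor_mult F)) = \<rho> ` range (tensor_mult :: 'v tensor \<Rightarrow> _)" by (simp add: image_image)
  moreover have "range (tensor_mult :: 'v tensor \<Rightarrow> _) = UNIV" by (metis surjI tensor_mult_simps(6))
  ultimately show "range (\<lambda>F::'v tensor. \<rho> (tensor_mult F)) = carrier k" by (simp only: \<rho>.q_range)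
  fix v w assume vw: "v \<in> carrier (witt_ring p k)" "w \<in> carrier (witt_ring p k)"
  show "tensor_right (\<omega> (v \<oplus>\<^bsub>witt_ring p k\<^esub> w)) - (tensor_right (\<omega> v) + tensor_right (\<omega> w)) \<in> first_order_ideal"
    "tensor_right (\<omega> (v \<otimes>\<^bsub>witt_ring p k\<^esub> w)) - tensor_right (\<omega> v) * tensor_right (\<omega> w) \<in> first_order_ideal"
    using right_Q[OF \<omega>_hom(1)[OF vw]] right_Q[OF \<omega>_hom(2)[OF vw]] by simp_all
  show "\<rho> (tensor_mult (tensor_right (\<omega> v))) = v 0" using vw(1) by (simp add: \<rho>_\<omega>)
next
  show "tensor_right (\<omega> \<one>\<^bsub>witt_ring p k\<^esub>) - 1 \<in> first_order_ideal"
    using right_Q[OF \<omega>_one] by simp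
qed (simp_all add: k s_subspace qS \<rho>.q_add \<rho>.q_mult \<rho>.q_one \<rho>_s chain_0 chain_subspace chain_mult chain_end)

end

section \<open>Comparison of the two maps into the first-order neighbourhood\<close>

lemma lifts_map:
  assumes A: "residue_presentation A qa k \<rho>a" and B: "residue_presentation B qb k \<rho>b"
    and F: "\<And>x. F (qa x) = qb (f x)"
    and add: "\<And>x y. qb (f (x + y)) = qb (f x) \<oplus>\<^bsub>B\<^esub> qb (f y)"
    and mult: "\<And>x y. qb (f (x * y)) = qb (f x) \<otimes>\<^bsub>B\<^esub> qb (f y)"
    and one: "qb (f 1) = \<one>\<^bsub>B\<^esub>" and res: "\<And>x. \<rho>b (f x) = \<rho>a x"
    and G: "group G" and r: "r \<in> lifts k G n \<rho>bar A"
  shows "(\<lambda>g\<in>carrier G. map_mat F (r g)) \<in> lifts k G n \<rho>bar B"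
proof -
  interpret A: residue_presentation A qa k \<rho>a by (rule A)
  interpret B: residue_presentation B qb k \<rho>b by (rule B)
  interpret G: group G by (rule G)
  have f0: "qb (f 0) = \<zero>\<^bsub>B\<^esub>" using add[of 0 0] by simp
  have fsum: "qb (f (sum h S)) = (\<Oplus>\<^bsub>B\<^esub>i\<in>S. qb (f (h i)))" for h and S :: "nat set"
    by (induction S rule: infinite_finite_induct) (simp_all add: f0 add)
  have FM: "map_mat F (A.qmat n Z) = B.qmat n (\<lambda>i j. f (Z i j))" for Z
    unfolding B.qmat_def by (rule A.map_mat_qmat) (rule F)
  have FM_mult: "map_mat F (A.qmat n Z \<otimes>\<^bsub>GL n A\<^esub> A.qmat n Z') = map_mat F (A.qmat n Z) \<otimes>\<^bsub>GL n B\<^esub> map_mat F (A.qmat n Z')" for Z Z'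
    unfolding A.GL_simps FM B.GL_simps B.qmat_eq_iff fmat_mult_def by (simp add: fsum mult B.q_sum B.q_mult)
  have FM_one: "map_mat F \<one>\<^bsub>GL n A\<^esub> = \<one>\<^bsub>GL n B\<^esub>"
    unfolding A.GL_simps FM B.GL_simps B.qmat_eq_iff by (simp add: fmat_one_def f0 one B.q_one B.q_zero)
  have rc: "r g \<in> carrier (GL n A)" if "g \<in> carrier G" for g
    using r that by (auto simp: lifts_def hom_def)
  have rm: "r (g \<otimes>\<^bsub>G\<^esub> h) = r g \<otimes>\<^bsub>GL n A\<^esub> r h" if "g \<in> carrier G" "h \<in> carrier G" for g h
    using r that by (auto simp: lifts_def hom_def)
  have closed: "map_mat F Z \<in> carrier (GL n B)" if Z: "Z \<in> carrier (GL n A)" for Z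
  proof -
    interpret GLA: group "GL n A" by (rule A.GL_group)
    obtain V W where V: "Z = A.qmat n V" and W: "inv\<^bsub>GL n A\<^esub> Z = A.qmat n W"
      using A.obtain_GL Z GLA.inv_closed by metis
    have "map_mat F (A.qmat n V) \<otimes>\<^bsub>GL n B\<^esub> map_mat F (A.qmat n W) = \<one>\<^bsub>GL n B\<^esub>"
      "map_mat F (A.qmat n W) \<otimes>\<^bsub>GL n B\<^esub> map_mat F (A.qmat n V) = \<one>\<^bsub>GL n B\<^esub>"
      unfolding FM_mult[symmetric] unfolding V[symmetric] W[symmetric] by (simp_all add: Z FM_one)
    then show ?thesis
      unfolding V FM B.GL_simps by (rule B.qmat_in_GL(1))
  qed
  have "map_mat (residue B) (map_mat F (r g)) = map_mat (residue A) (r g)" if g: "g \<in> carrier G" for g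
  proof -
    obtain V where V: "r g = A.qmat n V" using A.obtain_GL[OF rc[OF g]] .
    show ?thesis
      unfolding V FM B.map_mat_residue A.map_mat_residue A.res.qmat_def B.res.qmat_def res ..
  qed
  moreover have "map_mat (residue A) (r g) = \<rho>bar g" if "g \<in> carrier G" for g
    using r that by (simp add: lifts_def)
  moreover have "map_mat F (r (g \<otimes>\<^bsub>G\<^esub> h)) = map_mat F (r g) \<otimes>\<^bsub>GL n B\<^esub> map_mat F (r h)"
    if g: "g \<in> carrier G" "h \<in> carrier G" for g h
  proof -
    obtain V W where V: "r g = A.qmat n V" "r h = A.qmat n W" using A.obtain_GL rc g by metis
    show ?thesis unfolding rm[OF g] V by (rule FM_mult)
  qed
  ultimately show ?thesis
    using closed rc by (auto simp: lifts_def intro!: homI)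
qed

context tensor_square_codes
begin

lemma T_residue: "residue_presentation T.S qT k \<rho>"
  by (intro residue_presentation.intro residue_presentation_axioms.intro T.S.presentation_axioms
      residue_presentation T.residue_q)

lemma S_residue: "residue_presentation S.S qS k (\<lambda>F. \<rho> (tensor_mult F))"
  by (intro residue_presentation.intro residue_presentation_axioms.intro S.S.presentation_axioms
      S.field_presentation S.residue_q)

definition tensor_deform :: "nat \<Rightarrow> 'v int_poly \<Rightarrow> 'v tensor" where
  "tensor_deform N x = tensor_right x + of_nat N * tensor_diff x"

lemma tensor_deform_0: "tensor_deform 0 = tensor_right"
  by (simp add: tensor_deform_def fun_eq_iff)

lemma deform_add: "qS (tensor_deform N (x + y)) = qS (tensor_deform N x) \<oplus>\<^bsub>S.S\<^esub> qS (tensor_deform N y)"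
  unfolding S.S.q_add[symmetric] by (rule arg_cong[where f = qS]) (simp add: tensor_deform_def tensor_diff_def algebra_simps)

text \<open>The defect from multiplicativity is \<open>N - N * N\<close> times the product of two
  differentials, which lies in the square of the diagonal ideal.\<close>

lemma deform_mult: "qS (tensor_deform N (x * y)) = qS (tensor_deform N x) \<otimes>\<^bsub>S.S\<^esub> qS (tensor_deform N y)"
proof -
  have left: "tensor_left u = tensor_right u + tensor_diff u" for u :: "'v int_poly" by (simp add: tensor_diff_def)
  have "tensor_deform N (x * y) - tensor_deform N x * tensor_deform N y
      = (of_nat N - of_nat N * of_nat N) * (tensor_diff x * tensor_diff y)"
    unfolding tensor_deform_def diff_mult left by (simp add: algebra_simps)
  also have "\<dots> \<in> first_order_ideal"
    by (intro subspace_mult_left[OF s_subspace] I_square tensor_diff_in_diagonal)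
  finally show ?thesis unfolding S.S.q_mult[symmetric] qS(2) .
qed

lemma deform_one: "qS (tensor_deform N 1) = \<one>\<^bsub>S.S\<^esub>"
  unfolding S.S.q_one[symmetric] by (simp add: tensor_deform_def tensor_diff_def)

lemma deform_cong: assumes "qT x = qT y" shows "qS (tensor_deform N x) = qS (tensor_deform N y)"
proof -
  have "x - y \<in> Q" using assms qT(2) by simp
  then have "tensor_deform N (x - y) \<in> first_order_ideal"
    unfolding tensor_deform_def by (intro cr.subspace_add[OF s_subspace] subspace_mult_left[OF s_subspace] right_Q diff_Q)
  moreover have "tensor_deform N (x - y) = tensor_deform N x - tensor_deform N y"
    by (simp add: tensor_deform_def tensor_diff_def algebra_simps)
  ultimately show ?thesis unfolding qS(2) by simp
qed

lemma deform_residue: "\<rho> (tensor_mult (tensor_deform N x)) = \<rho> x"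
  by (simp add: tensor_deform_def)

lemma quotient_hom: obtains \<phi> where "\<phi> \<in> coeff_hom p k R T.S" "\<And>x. \<phi> (\<pi> x) = qT x"
proof (rule coeff_hom_of_map[where A = R and qa = \<pi> and B = T.S and qb = qT and f = "\<lambda>x. x" and p = p and k = k])
  show "presentation R \<pi>" by (rule presentation_axioms)
  show "presentation T.S qT" by (rule T.S.presentation_axioms)
  show "qT x = qT y" if "\<pi> x = \<pi> y" for x y
  proof -
    have "x - y \<in> K" using that by (simp add: K_def q_eq_iff)
    then have "x - y \<in> Q" using K_le Q_lower by blast
    then show ?thesis by (simp only: qT(2))
  qed
  show "max_ideal R \<subseteq> carrier R" by (rule max_ideal_carrier)
  show "qT x \<in> max_ideal T.S" if "\<pi> x \<in> max_ideal R" for x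
    using that by (simp only: max_ideal_iff T.max_ideal_S(2))
  show "\<exists>x. witt_map R w = \<pi> x \<and> witt_map T.S w = qT x" if "w \<in> carrier (witt_ring p k)" for w
  proof (intro exI conjI)
    show "witt_map R w = \<pi> (\<omega> w)" using \<pi>_\<omega>[OF witt_closed[OF that]] by simp
    show "witt_map T.S w = qT (\<omega> w)" by (simp only: quotient_coeff_ring_def coeff_ring.simps)
  qed
qed (rule T.S.q_add T.S.q_mult T.S.q_one that, assumption?)+

text \<open>\<open>W(k)\<close>-linearity is where \<open>diff_witt\<close> enters: on the image of
  the Witt vectors the deformation term vanishes, so every \<open>N\<close> yields the same
  structure map.\<close>

lemma deform_hom: obtains F where "F \<in> coeff_hom p k T.S S.S" "\<And>x. F (qT x) = qS (tensor_deform N x)"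
proof (rule coeff_hom_of_map[where A = T.S and qa = qT and B = S.S and qb = qS and f = "tensor_deform N" and p = p and k = k])
  show "presentation T.S qT" by (rule T.S.presentation_axioms)
  show "presentation S.S qS" by (rule S.S.presentation_axioms)
  show "max_ideal T.S \<subseteq> carrier T.S" using ideal.Icarr[OF T.max_ideal_S(1)] by (intro subsetI)
  show "qS (tensor_deform N x) \<in> max_ideal S.S" if "qT x \<in> max_ideal T.S" for x
    using that by (simp only: T.max_ideal_S(2) S.max_ideal_S(2) deform_residue)
  show "\<exists>x. witt_map T.S w = qT x \<and> witt_map S.S w = qS (tensor_deform N x)" if w: "w \<in> carrier (witt_ring p k)" for w
  proof (intro exI conjI)
    show "witt_map T.S w = qT (\<omega> w)" by (simp only: quotient_coeff_ring_def coeff_ring.simps)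
    have "tensor_right (\<omega> w) - tensor_deform N (\<omega> w) = - (of_nat N) * tensor_diff (\<omega> w)"
      by (simp add: tensor_deform_def)
    also have "\<dots> \<in> first_order_ideal"
      by (intro subspace_mult_left[OF s_subspace] diff_witt \<omega>_witt_set w)
    finally have "qS (tensor_right (\<omega> w)) = qS (tensor_deform N (\<omega> w))" unfolding qS(2) .
    then show "witt_map S.S w = qS (tensor_deform N (\<omega> w))" by (simp only: quotient_coeff_ring_def coeff_ring.simps)
  qed
qed (rule deform_add deform_mult deform_one deform_cong that, assumption?)+

text \<open>The matrices of a lift are represented by polynomial matrices \<open>V\<close>,
  multiplicative only modulo \<open>Q\<close>. Their left and right copies are the two
  representations fed to \<open>averaged_conjugation\<close>; the conjugating matrix
  \<open>1 + Y\<close> reduces to the identity because \<open>Y\<close> has entries in the diagonal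
  ideal.\<close>

lemma deform_strict_equivalence:
  assumes G: "group G" "finite (carrier G)" and r: "r \<in> lifts k G n \<rho>bar T.S"
    and F: "\<And>x. F (qT x) = qS (tensor_right x)"
    and F': "\<And>x. F' (qT x) = qS (tensor_deform (card (carrier G)) x)"
  shows "(\<lambda>g\<in>carrier G. map_mat F (r g), \<lambda>g\<in>carrier G. map_mat F' (r g)) \<in> strict_equivalence k G n \<rho>bar S.S"
proof -
  interpret G: group G by (rule G(1))
  interpret TR: residue_presentation T.S qT k \<rho> by (rule T_residue)
  interpret SR: residue_presentation S.S qS k "\<lambda>F. \<rho> (tensor_mult F)" by (rule S_residue)
  interpret fmat_ideal first_order_ideal n by (rule fmat_ideal.intro) (rule s_subspace)
  have lift: "(\<lambda>g\<in>carrier G. map_mat F (r g)) \<in> lifts k G n \<rho>bar S.S"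
    by (rule lifts_map[OF T_residue S_residue _ _ _ _ _ G(1) r, where f = "tensor_deform 0"])
      (simp_all only: F tensor_deform_0 deform_add[of 0, unfolded tensor_deform_0]
        deform_mult[of 0, unfolded tensor_deform_0] deform_one[of 0, unfolded tensor_deform_0] tensor_mult_simps)
  have lift': "(\<lambda>g\<in>carrier G. map_mat F' (r g)) \<in> lifts k G n \<rho>bar S.S"
    by (rule lifts_map[OF T_residue S_residue _ _ _ _ _ G(1) r, where f = "tensor_deform (card (carrier G))"])
      (rule F' deform_add deform_mult deform_one deform_residue)+
  have rc: "r g \<in> carrier (GL n T.S)" if "g \<in> carrier G" for g
    using r that by (auto simp: lifts_def hom_def)
  have rm: "r (g \<otimes>\<^bsub>G\<^esub> h) = r g \<otimes>\<^bsub>GL n T.S\<^esub> r h" if "g \<in> carrier G" "h \<in> carrier G" for g h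
    using r that by (auto simp: lifts_def hom_def)
  have "\<forall>g. \<exists>V. g \<in> carrier G \<longrightarrow> r g = T.S.qmat n V" using T.S.obtain_GL rc by metis
  from choice[OF this] obtain V where V: "\<And>g. g \<in> carrier G \<Longrightarrow> r g = T.S.qmat n (V g)" by blast
  have V_mult: "V (g \<otimes>\<^bsub>G\<^esub> h) a b - (\<Sum>l<n. V g a l * V h l b) \<in> Q"
    if "g \<in> carrier G" "h \<in> carrier G" "a < n" "b < n" for g h a b
  proof -
    have "T.S.qmat n (V (g \<otimes>\<^bsub>G\<^esub> h)) = T.S.qmat n (fmat_mult n (V g) (V h))"
      using rm[OF that(1,2)] that by (simp only: V[symmetric] G.m_closed T.S.GL_simps(2)[symmetric])
    then show ?thesis using that(3,4) by (simp only: T.S.qmat_eq_iff qT(2) fmat_mult_def)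
  qed
  define a1 where "a1 g i j = tensor_left (V g i j)" for g i j
  define a2 where "a2 g i j = tensor_right (V g i j)" for g i j
  have lsum: "tensor_left (sum h A) = (\<Sum>x\<in>A. tensor_left (h x))" and rsum: "tensor_right (sum h A) = (\<Sum>x\<in>A. tensor_right (h x))"
    for h :: "nat \<Rightarrow> 'v int_poly" and A
    by (induction A rule: infinite_finite_induct) simp_all
  have a1: "fcong (a1 (g \<otimes>\<^bsub>G\<^esub> h)) (fmat_mult n (a1 g) (a1 h))" if "g \<in> carrier G" "h \<in> carrier G" for g h
    unfolding fcong_def fmat_mult_def a1_def using left_Q[OF V_mult[OF that]] by (simp add: lsum)
  have a2: "fcong (a2 (g \<otimes>\<^bsub>G\<^esub> h)) (fmat_mult n (a2 g) (a2 h))" if "g \<in> carrier G" "h \<in> carrier G" for g h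
    unfolding fcong_def fmat_mult_def a2_def using right_Q[OF V_mult[OF that]] by (simp add: rsum)
  have "r \<in> hom G (GL n T.S)" using r by (simp add: lifts_def)
  then have "r \<one>\<^bsub>G\<^esub> = \<one>\<^bsub>GL n T.S\<^esub>" by (rule hom_one[OF _ G(1) T.S.GL_group])
  then have "T.S.qmat n (V \<one>\<^bsub>G\<^esub>) = T.S.qmat n fmat_one" by (simp only: V[OF G.one_closed] T.S.GL_simps(1))
  then have V_one: "V \<one>\<^bsub>G\<^esub> a b - fmat_one a b \<in> Q" if "a < n" "b < n" for a b
    using that by (simp only: T.S.qmat_eq_iff qT(2))
  have a2_one: "fcong (a2 \<one>\<^bsub>G\<^esub>) fmat_one"
    unfolding fcong_def a2_def
  proof (intro allI impI)
    fix a b assume "a < n" "b < n"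
    from right_Q[OF V_one[OF this]] show "tensor_right (V \<one>\<^bsub>G\<^esub> a b) - fmat_one a b \<in> first_order_ideal"
      by (simp add: fmat_one_def split: if_splits)
  qed
  have D_I: "a1 g i j - a2 g i j \<in> diagonal_ideal" for g i j
    unfolding a1_def a2_def tensor_diff_def[symmetric] by (rule tensor_diff_in_diagonal)
  define Y where "Y = fmat_sum (\<lambda>h. fmat_mult n (fmat_diff (a1 h) (a2 h)) (a2 (inv\<^bsub>G\<^esub> h))) (carrier G)"
  have conj: "Y i j \<in> diagonal_ideal"
    "fcong (fmat_mult n (fmat_add fmat_one Y) (fmat_diff fmat_one Y)) fmat_one"
    "fcong (fmat_mult n (fmat_diff fmat_one Y) (fmat_add fmat_one Y)) fmat_one"
    "g \<in> carrier G \<Longrightarrow> fcong (fmat_mult n (fmat_mult n (fmat_add fmat_one Y) (a2 g)) (fmat_diff fmat_one Y))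
      (\<lambda>i j. a2 g i j + of_nat (card (carrier G)) * (a1 g i j - a2 g i j))" for i j g
    unfolding Y_def
    by (rule averaged_conjugation(1)[of G a1 a2 diagonal_ideal] averaged_conjugation(2)[of G a1 a2 diagonal_ideal]
        averaged_conjugation(3)[of G a1 a2 diagonal_ideal] averaged_conjugation(4)[of G a1 a2 diagonal_ideal],
        (assumption | rule G a1 a2 a2_one diagonal_ideal_subspace I_square D_I)+)+
  define C where "C = S.S.qmat n (fmat_add fmat_one Y)"
  define C' where "C' = S.S.qmat n (fmat_diff fmat_one Y)"
  have q_cong: "S.S.qmat n U = S.S.qmat n U'" if "fcong U U'" for U U'
    using that unfolding fcong_def S.S.qmat_eq_iff qS(2) .
  have CC: "S.S.qmat n (fmat_mult n (fmat_add fmat_one Y) (fmat_diff fmat_one Y)) = S.S.qmat n fmat_one"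
    "S.S.qmat n (fmat_mult n (fmat_diff fmat_one Y) (fmat_add fmat_one Y)) = S.S.qmat n fmat_one"
    by (intro q_cong conj)+
  have C: "C \<in> carrier (GL n S.S)" "inv\<^bsub>GL n S.S\<^esub> C = C'"
    unfolding C_def C'_def using S.S.qmat_in_GL[OF CC] by blast+
  have "map_mat (residue S.S) C = \<one>\<^bsub>GL n k\<^esub>"
    unfolding C_def SR.map_mat_residue SR.res.GL_simps SR.res.qmat_eq_iff
    by (simp add: fmat_add_def tensor_mult_diagonal conj(1))
  then have "C \<in> kernel (GL n S.S) (GL n k) (map_mat (residue S.S))" using C(1) by (simp add: SR.kernel_eq)
  moreover have "map_mat F' (r g) = C \<otimes>\<^bsub>GL n S.S\<^esub> map_mat F (r g) \<otimes>\<^bsub>GL n S.S\<^esub> inv\<^bsub>GL n S.S\<^esub> C"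
    if g: "g \<in> carrier G" for g
  proof -
    have "map_mat F (r g) = S.S.qmat n (a2 g)"
      unfolding V[OF g] S.S.qmat_def a2_def by (rule T.S.map_mat_qmat) (rule F)
    moreover have "map_mat F' (r g) = S.S.qmat n (\<lambda>i j. a2 g i j + of_nat (card (carrier G)) * (a1 g i j - a2 g i j))"
      unfolding V[OF g] S.S.qmat_def a2_def a1_def tensor_diff_def[symmetric] tensor_deform_def[symmetric]
      by (rule T.S.map_mat_qmat) (rule F')
    ultimately show ?thesis
      unfolding C(2) using q_cong[OF conj(4)[OF g]] by (simp only: C_def C'_def S.S.GL_simps(2))
  qed
  ultimately show ?thesis
    unfolding strict_equivalence_def using lift lift' by (auto intro!: bexI[of _ C])
qed

text \<open>Strictly equivalent images have the same class, so naturality and injectivity of the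
  universal bijection make the two composites from \<open>R\<close> equal. Their difference is the
  asserted multiple of the differential.\<close>

lemma card_mult_diff_in_first_order_ideal:
  fixes G :: "'g monoid"
  assumes G: "group G" "finite (carrier G)" and univ: "universal_deformation_ring p k G n \<rho>bar R"
  shows "of_nat (card (carrier G)) * tensor_diff x \<in> first_order_ideal"
proof -
  obtain \<eta> :: "(nat set, 'k) coeff_ring \<Rightarrow> ('a \<Rightarrow> nat set) \<Rightarrow> ('g \<Rightarrow> nat set mat) set"
    where bij: "\<And>A. A \<in> coeff_category p k \<Longrightarrow> bij_betw (\<eta> A) (coeff_hom p k R A) (Def k G n \<rho>bar A)"
    and natural: "\<And>A B f \<phi>. A \<in> coeff_category p k \<Longrightarrow> B \<in> coeff_category p k \<Longrightarrow> f \<in> coeff_hom p k A B \<Longrightarrow>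
      \<phi> \<in> coeff_hom p k R A \<Longrightarrow> \<eta> B (compose (carrier R) f \<phi>) = Def_map k G n \<rho>bar B f (\<eta> A \<phi>)"
    using univ unfolding universal_deformation_ring_def by blast
  obtain \<phi> where \<phi>: "\<phi> \<in> coeff_hom p k R T.S" "\<And>x. \<phi> (\<pi> x) = qT x" using quotient_hom by metis
  obtain F where F: "F \<in> coeff_hom p k T.S S.S" "\<And>x. F (qT x) = qS (tensor_right x)"
    using deform_hom[of 0] unfolding tensor_deform_0 by metis
  obtain F' where F': "F' \<in> coeff_hom p k T.S S.S" "\<And>x. F' (qT x) = qS (tensor_deform (card (carrier G)) x)"
    using deform_hom by metis
  have equiv: "equiv (lifts k G n \<rho>bar S.S) (strict_equivalence k G n \<rho>bar S.S)"
    by (rule residue_presentation.strict_equivalence_equiv[OF S_residue G(1)])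
  have "\<eta> T.S \<phi> \<in> Def k G n \<rho>bar T.S"
    using bij_betwE[OF bij[OF T.S_in_category]] \<phi>(1) by blast
  then have cls: "\<eta> T.S \<phi> \<subseteq> lifts k G n \<rho>bar T.S"
    unfolding Def_def using Union_quotient[OF residue_presentation.strict_equivalence_equiv[OF T_residue G(1)]] by blast
  have eq: "(\<lambda>g\<in>carrier G. map_mat F (r g), \<lambda>g\<in>carrier G. map_mat F' (r g)) \<in> strict_equivalence k G n \<rho>bar S.S"
    if "r \<in> \<eta> T.S \<phi>" for r
    using deform_strict_equivalence[OF G _ F(2) F'(2)] that cls by blast
  have "Def_map k G n \<rho>bar S.S F (\<eta> T.S \<phi>) = Def_map k G n \<rho>bar S.S F' (\<eta> T.S \<phi>)"
  proof -
    let ?E = "strict_equivalence k G n \<rho>bar S.S"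
    have "sym ?E" "trans ?E" using equiv by (auto simp: equiv_def)
    then have "(\<lambda>g\<in>carrier G. map_mat F (r g), r') \<in> ?E \<longleftrightarrow> (\<lambda>g\<in>carrier G. map_mat F' (r g), r') \<in> ?E"
      if "r \<in> \<eta> T.S \<phi>" for r r'
      using eq[OF that] by (meson symD transD)
    then show ?thesis unfolding Def_map_def by blast
  qed
  then have "\<eta> S.S (compose (carrier R) F \<phi>) = \<eta> S.S (compose (carrier R) F' \<phi>)"
    using natural[OF T.S_in_category S.S_in_category _ \<phi>(1)] F(1) F'(1) by simp
  moreover have "compose (carrier R) F \<phi> \<in> coeff_hom p k R S.S" "compose (carrier R) F' \<phi> \<in> coeff_hom p k R S.S"
    by (rule coeff_hom_compose[OF \<phi>(1) F(1) is_cring max_ideal_carrier] coeff_hom_compose[OF \<phi>(1) F'(1) is_cring max_ideal_carrier],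
        erule witt_closed)+
  ultimately have "compose (carrier R) F \<phi> = compose (carrier R) F' \<phi>"
    using bij_betw_imp_inj_on[OF bij[OF S.S_in_category]] by (auto dest: inj_onD)
  then have "F (\<phi> (\<pi> x)) = F' (\<phi> (\<pi> x))" by (metis compose_eq q_closed)
  then have "qS (tensor_deform (card (carrier G)) x) = qS (tensor_right x)" by (simp only: \<phi>(2) F(2) F'(2))
  then show ?thesis unfolding qS(2) by (simp add: tensor_deform_def)
qed

end

section \<open>The Casimir elements of a universal deformation ring\<close>

locale presented_polynomial = presented_object R \<pi> p k
  for R :: "('a, 'k) coeff_ring" (structure) and \<pi> :: "'v int_poly \<Rightarrow> 'a" and p k
begin

text \<open>\<open>N\<close> is the order of \<open>G\<close> raised to the number of topological
  generators. That number is fixed before \<open>Q\<close> and \<open>i\<close> are chosen, and the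
  differentials of the generators generate the diagonal ideal up to \<open>tensor_kernel\<close> in
  each case.\<close>

lemma casimir_of_universal:
  fixes G :: "'g monoid"
  assumes G: "group G" "finite (carrier G)" and univ: "universal_deformation_ring p k G n \<rho>bar R"
  shows "\<exists>N>0. \<forall>Q i. cr.subspace Q \<longrightarrow> M i \<subseteq> Q \<longrightarrow> Q \<subseteq> M 1 \<longrightarrow> (\<exists>T a. casimir_family Q N T a)"
proof -
  obtain A where A: "finite A"
    and dense: "\<And>i B. A \<subseteq> B \<Longrightarrow> (\<And>x y. x \<in> B \<Longrightarrow> y \<in> B \<Longrightarrow> x + y \<in> B \<and> x * y \<in> B) \<Longrightarrow> M i \<subseteq> B \<Longrightarrow> B = UNIV"
    using finite_topological_generators by (auto simp: Ball_def)
  obtain d and g :: "nat \<Rightarrow> 'v int_poly" where g: "A = g ` {..<d}"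
    using A unfolding finite_conv_nat_seg_image lessThan_def by blast
  have "\<exists>T a. casimir_family Q (card (carrier G) ^ d) T a"
    if hQ: "cr.subspace Q" "M i \<subseteq> Q" "Q \<subseteq> M 1" for Q i
  proof -
    interpret tensor_square R \<pi> p k Q i by unfold_locales (fact hQ)+
    obtain F where F: "finite F" "\<And>x. \<exists>y\<in>F. x - y \<in> M i" using finite_quotient by blast
    have "\<forall>x. \<exists>y. y \<in> F \<and> x - y \<in> M i" using F(2) by blast
    from choice[OF this] obtain \<Theta> where \<Theta>: "\<And>x. \<Theta> x \<in> F" "\<And>x. x - \<Theta> x \<in> M i" by blast
    have fin: "finite (range \<Theta>)" using \<Theta>(1) F(1) by (meson finite_subset image_subsetI)
    have cls: "x - y \<in> Q" if "\<Theta> x = \<Theta> y" for x y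
      using M_diff[OF \<Theta>(2)[of x] \<Theta>(2)[of y]] hQ(2) by (auto simp: that)
    obtain qT :: "'v int_poly \<Rightarrow> nat set" where qT: "finite (range qT)" "\<And>x y. qT x = qT y \<longleftrightarrow> x - y \<in> Q"
      using obtain_code[OF hQ(1) fin cls] by metis
    obtain \<Theta>' :: "'v tensor \<Rightarrow> ('v int_poly \<Rightarrow> 'v int_poly) \<Rightarrow> 'v int_poly"
      where \<Theta>': "finite (range \<Theta>')" "\<And>F F'. \<Theta>' F = \<Theta>' F' \<Longrightarrow> F - F' \<in> tensor_kernel"
      using finite_tensor_quotient[OF qT] by metis
    obtain qS :: "'v tensor \<Rightarrow> nat set" where qS: "finite (range qS)" "\<And>F F'. qS F = qS F' \<longleftrightarrow> F - F' \<in> first_order_ideal"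
      using obtain_code[OF s_subspace \<Theta>'(1) kernel_le_s[OF \<Theta>'(2)]] by metis
    interpret tensor_square_codes R \<pi> p k Q i qT qS by unfold_locales (fact qT qS)+
    let ?S = "cr.span ((\<lambda>j. tensor_diff (g j)) ` {..<d} \<union> tensor_kernel)"
    \<comment> \<open>By the Leibniz rule these elements are closed under products as well as sums;
      they include the generators and \<open>M i\<close>, so density applies.\<close>
    have "{x. tensor_diff x \<in> ?S} = UNIV"
    proof (rule dense)
      show "A \<subseteq> {x. tensor_diff x \<in> ?S}" unfolding g by (auto intro!: cr.span_base)
      show "M i \<subseteq> {x. tensor_diff x \<in> ?S}"
      proof
        fix x assume "x \<in> M i"
        then have "tensor_diff x \<in> tensor_kernel"
          using hQ(2) unfolding tensor_diff_def
          by (intro cr.subspace_diff[OF tensor_kernel_subspace] tensor_left_kernel tensor_right_kernel) auto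
        then show "x \<in> {x. tensor_diff x \<in> ?S}" by (auto intro!: cr.span_base)
      qed
      fix x y assume "x \<in> {x. tensor_diff x \<in> ?S}" "y \<in> {x. tensor_diff x \<in> ?S}"
      then have xy: "tensor_diff x \<in> ?S" "tensor_diff y \<in> ?S" by auto
      have "tensor_diff (x + y) = tensor_diff x + tensor_diff y" by (simp add: tensor_diff_def)
      moreover have "tensor_diff x + tensor_diff y \<in> ?S" using xy by (rule cr.span_add)
      moreover have "tensor_diff (x * y) \<in> ?S"
        unfolding diff_mult using xy by (intro cr.span_add cr.span_scale)
      ultimately show "x + y \<in> {x. tensor_diff x \<in> ?S} \<and> x * y \<in> {x. tensor_diff x \<in> ?S}" by simp
    qed
    then show ?thesis
      by (intro casimir_if_unramified[of g d] card_mult_diff_in_first_order_ideal[OF G univ]) blast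
  qed
  moreover have "card (carrier G) ^ d > 0"
    using G monoid.one_closed[OF group.is_monoid[OF G(1)]] by (auto simp: card_gt_0_iff)
  ultimately show ?thesis by blast
qed

end

section \<open>Prime ideals of the torsion-free quotient\<close>

text \<open>A limit of the partial sums of the geometric series is an inverse modulo every
  \<open>M n\<close>, hence modulo \<open>K\<close>.\<close>

lemma (in adic_ring) one_minus_invertible:
  assumes m: "m \<in> M 1" shows "\<exists>y. (1 - m) * y - 1 \<in> K"
proof -
  have pow: "m ^ n \<in> M n" for n using M_mult[OF m] by (induction n) (simp_all add: M_0)
  have "\<exists>y. \<forall>n. y - (\<Sum>j<n. m ^ j) \<in> M n" by (rule complete) (simp add: pow)
  then obtain y where y: "\<And>n. y - (\<Sum>j<n. m ^ j) \<in> M n" by blast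
  have "(1 - m) * y - 1 \<in> M n" for n
  proof -
    have "(1 - m) * y - 1 = (1 - m) * (y - (\<Sum>j<n. m ^ j)) - m ^ n"
      by (simp only: right_diff_distrib one_diff_power_eq[of m n, symmetric]) simp
    then show ?thesis using M_diff[OF subspace_mult_left[OF M_ideal y] pow] by metis
  qed
  then show ?thesis unfolding K_eq by blast
qed

context presentation
begin

lemma mem_image_iff:
  assumes "cr.subspace I" "q -` {\<zero>} \<subseteq> I" shows "q x \<in> q ` I \<longleftrightarrow> x \<in> I"
proof
  assume "q x \<in> q ` I"
  then obtain y where y: "q x = q y" "y \<in> I" by blast
  then have "x - y \<in> I" using assms(2) q_eq_iff by blast
  from cr.subspace_add[OF assms(1) this y(2)] show "x \<in> I" by simp
qed blast

lemma primeideal_image: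
  assumes I: "cr.subspace I" "q -` {\<zero>} \<subseteq> I" "1 \<notin> I" "\<And>x y. x * y \<in> I \<Longrightarrow> x \<in> I \<or> y \<in> I"
  shows "primeideal (q ` I) B"
proof (rule primeidealI)
  show "ideal (q ` I) B" by (rule ideal_image[OF I(1)])
  show "cring B" by (rule is_cring)
  show "carrier B \<noteq> q ` I" using mem_image_iff[OF I(1,2), of 1] I(3) q_closed[of 1] by metis
  fix a b assume ab: "a \<in> carrier B" "b \<in> carrier B" "a \<otimes> b \<in> q ` I"
  obtain x y where x: "q x = a" "q y = b" using obtain_preimage ab(1,2) by metis
  then have "x * y \<in> I" using ab(3) mem_image_iff[OF I(1,2)] by (metis q_mult)
  then show "a \<in> q ` I \<or> b \<in> q ` I" using I(4) x by blast
qed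

lemma primeideal_vimage:
  assumes "primeideal P B"
  shows "cr.subspace (q -` P)" "q -` {\<zero>} \<subseteq> q -` P" "1 \<notin> q -` P" "x * y \<in> q -` P \<Longrightarrow> x \<in> q -` P \<or> y \<in> q -` P"
    "q ` (q -` P) = P"
proof -
  interpret P: primeideal P B by fact
  show "cr.subspace (q -` P)" by (rule ideal_vimage) (rule P.ideal_axioms)
  show "q -` {\<zero>} \<subseteq> q -` P" by auto
  show "1 \<notin> q -` P" using P.one_imp_carrier P.I_notcarr by (auto simp: q_one)
  show "x * y \<in> q -` P \<Longrightarrow> x \<in> q -` P \<or> y \<in> q -` P" using P.I_prime by (simp add: q_mult)
  show "q ` (q -` P) = P" by (rule image_vimage) (rule P.a_subset)
qed

end

locale casimir_object = presented_object R \<pi> p k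
  for R :: "('a, 'k) coeff_ring" (structure) and \<pi> :: "'r::comm_ring_1 \<Rightarrow> 'a" and p k +
  fixes N :: nat
  assumes casimir_ring: "adic_ring_casimir M K p N"
begin

sublocale adic_ring_casimir M K p N by (rule casimir_ring)

lemma invertible:
  assumes "x \<notin> M 1" shows "\<exists>y. x * y - 1 \<in> torsion"
proof -
  obtain y where "1 - x * y \<in> M 1" using local_inverse[OF assms] by blast
  from one_minus_invertible[OF this] obtain z where "(1 - (1 - x * y)) * z - 1 \<in> K" by blast
  then have "x * (y * z) - 1 \<in> torsion" using K_le_torsion by (auto simp: mult.assoc)
  then show ?thesis by blast
qed

lemma M_1_prime: "x * y \<in> M 1 \<Longrightarrow> x \<in> M 1 \<or> y \<in> M 1"
  unfolding M_1 \<rho>.q_mult using domain.integral[OF field.axioms(1)[OF k]] \<rho>.q_closed by blast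

lemma one_notin_M_1: "1 \<notin> M 1"
  unfolding M_1 \<rho>.q_one using k by (metis domain.one_not_zero field.axioms(1))

lemma power_p_notin_torsion: "of_nat (p ^ r) \<notin> torsion"
proof
  assume "of_nat (p ^ r) \<in> torsion"
  then obtain s where "of_nat (p ^ s) * of_nat (p ^ r) \<in> K" by (auto simp: torsion_def)
  then have "of_nat (p ^ (s + r)) \<in> K" by (simp add: power_add)
  then show False using char_0 by blast
qed

lemma torsion_cancel: "of_nat (p ^ r) * x \<in> torsion \<Longrightarrow> x \<in> torsion"
  unfolding torsion_eq by (rule saturation_power)

lemma obtain_N: obtains s u where "N = p ^ s * u" "of_nat u \<notin> M 1"
proof -
  obtain s u where su: "N = p ^ s * u" "\<not> p dvd u"
    using multiplicity_decompose'[of N p] N p_prime by (metis not_prime_unit gr_implies_not0)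
  then have "of_nat u \<notin> M 1" using k_char unfolding M_1 \<rho>.q_of_nat by (simp add: has_char_def)
  then show thesis using su(1) that by blast
qed

text \<open>Regularity makes \<open>p ^ r * N * x\<close> a torsion element. Powers of
  \<open>p\<close> cancel modulo torsion, and the part of \<open>N\<close> prime to \<open>p\<close>
  is invertible there.\<close>

lemma semiprime:
  assumes "x * x \<in> torsion" shows "x \<in> torsion"
proof -
  obtain s u where su: "N = p ^ s * u" "of_nat u \<notin> M 1" by (rule obtain_N)
  obtain r c where rc: "of_nat (p ^ r * N) * x - c * x * x \<in> K" using von_neumann_regular by blast
  have 1: "of_nat (p ^ r * N) * x - c * x * x \<in> torsion" using rc K_le_torsion by blast
  have 2: "c * (x * x) \<in> torsion" using assms by (rule subspace_mult_left[OF torsion_subspace])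
  have "of_nat (p ^ r * N) * x \<in> torsion"
    using cr.subspace_add[OF torsion_subspace 1 2] by (simp add: mult.assoc)
  then have "of_nat (p ^ (r + s)) * (of_nat u * x) \<in> torsion" by (simp add: su(1) power_add mult_ac)
  then have ux: "of_nat u * x \<in> torsion" by (rule torsion_cancel)
  obtain y where y: "of_nat u * y - 1 \<in> torsion" using invertible[OF su(2)] by blast
  have "y * (of_nat u * x) - (of_nat u * y - 1) * x \<in> torsion"
    by (rule cr.subspace_diff[OF torsion_subspace subspace_mult_left[OF torsion_subspace ux] subspace_mult_right[OF torsion_subspace y]])
  then show ?thesis by (simp add: algebra_simps)
qed

lemma radical:
  assumes "x ^ n \<in> torsion" shows "x \<in> torsion"
proof -
  \<comment> \<open>The exponent is raised to a power of two, which \<open>semiprime\<close> then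
    halves repeatedly.\<close>
  have "x ^ (2 ^ n) = x ^ n * x ^ (2 ^ n - n)"
    unfolding power_add[symmetric] using less_exp[of n] by simp
  then have "x ^ (2 ^ n) \<in> torsion" using subspace_mult_right[OF torsion_subspace assms] by simp
  moreover have "x ^ (2 ^ j) \<in> torsion \<Longrightarrow> x \<in> torsion" for j
  proof (induction j)
    case (Suc j)
    have "x ^ (2 ^ Suc j) = x ^ (2 ^ j) * x ^ (2 ^ j)" by (simp add: mult_2 power_add)
    then have "x ^ (2 ^ j) * x ^ (2 ^ j) \<in> torsion" using Suc.prems by (simp only:)
    then show ?case using Suc.IH semiprime by blast
  qed simp
  ultimately show ?thesis by blast
qed

text \<open>These are the preimages of the prime ideals of the quotient by the torsion
  ideal.\<close>

definition prime_over_torsion :: "'r set \<Rightarrow> bool" where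
  "prime_over_torsion P \<longleftrightarrow> cr.subspace P \<and> torsion \<subseteq> P \<and> 1 \<notin> P \<and> (\<forall>x y. x * y \<in> P \<longrightarrow> x \<in> P \<or> y \<in> P)"

lemma prime_le_M_1:
  assumes "prime_over_torsion P" shows "P \<subseteq> M 1"
proof
  fix x assume x: "x \<in> P"
  have P: "cr.subspace P" "torsion \<subseteq> P" "1 \<notin> P" using assms by (auto simp: prime_over_torsion_def)
  show "x \<in> M 1"
  proof (rule ccontr)
    assume "x \<notin> M 1"
    then obtain y where "x * y - 1 \<in> P" using invertible P(2) by blast
    from cr.subspace_diff[OF P(1) subspace_mult_right[OF P(1) x, of y] this] show False using P(3) by simp
  qed
qed

lemma prime_containing_p:
  assumes "prime_over_torsion P" "of_nat p \<in> P" shows "P = M 1"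
proof
  have P: "cr.subspace P" "torsion \<subseteq> P" "1 \<notin> P" "\<And>x y. x * y \<in> P \<Longrightarrow> x \<in> P \<or> y \<in> P"
    using assms by (auto simp: prime_over_torsion_def)
  obtain J where "M J \<subseteq> ideal_sum torsion (cr.span {of_nat p})" using M_le_torsion_p by blast
  also have "\<dots> \<subseteq> P"
    using assms(2) by (intro ideal_sum_least[OF P(1) P(2)] cr.span_minimal P(1)) simp
  finally have J: "M J \<subseteq> P" .
  show "M 1 \<subseteq> P"
  proof
    fix x assume x: "x \<in> M 1"
    have "x ^ j \<in> M j" for j using M_mult[OF x] by (induction j) (simp_all add: M_0)
    then have "x ^ J \<in> P" using J by blast
    moreover have "x ^ j \<in> P \<Longrightarrow> x \<in> P" for j
      by (induction j) (use P(3,4) in auto)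
    ultimately show "x \<in> P" by blast
  qed
qed (rule prime_le_M_1[OF assms(1)])

text \<open>For \<open>x\<close> in \<open>P\<close>, regularity puts
  \<open>(p ^ r * N - c * x) * x\<close> into \<open>P0\<close>. If the first factor were in
  \<open>P0\<close>, then \<open>p ^ r * N\<close> would be in \<open>P\<close>; but
  \<open>P\<close> contains neither \<open>p\<close> nor the part of \<open>N\<close> prime to
  \<open>p\<close>.\<close>

lemma prime_minimal:
  assumes "prime_over_torsion P0" "prime_over_torsion P" "P0 \<subseteq> P" "of_nat p \<notin> P" shows "P0 = P"
proof
  have P0: "cr.subspace P0" "torsion \<subseteq> P0" "\<And>x y. x * y \<in> P0 \<Longrightarrow> x \<in> P0 \<or> y \<in> P0"
    using assms(1) by (auto simp: prime_over_torsion_def)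
  have P: "cr.subspace P" "1 \<notin> P" "\<And>x y. x * y \<in> P \<Longrightarrow> x \<in> P \<or> y \<in> P"
    using assms(2) by (auto simp: prime_over_torsion_def)
  have p_pow: "of_nat (p ^ r) \<notin> P" for r
    by (induction r) (use P(2,3) assms(4) in auto)
  obtain s u where su: "N = p ^ s * u" "of_nat u \<notin> M 1" by (rule obtain_N)
  have u: "of_nat u \<notin> P" using su(2) prime_le_M_1[OF assms(2)] by blast
  show "P \<subseteq> P0"
  proof
    fix x assume x: "x \<in> P"
    obtain r c where "of_nat (p ^ r * N) * x - c * x * x \<in> K" using von_neumann_regular by blast
    then have "(of_nat (p ^ r * N) - c * x) * x \<in> P0"
      using K_le_torsion P0(2) by (auto simp: algebra_simps)
    then consider "of_nat (p ^ r * N) - c * x \<in> P0" | "x \<in> P0" using P0(3) by blast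
    then show "x \<in> P0"
    proof cases
      case 1
      then have "of_nat (p ^ r * N) - c * x \<in> P" using assms(3) by blast
      from cr.subspace_add[OF P(1) this subspace_mult_left[OF P(1) x, of c]]
      have "of_nat (p ^ (r + s)) * of_nat u \<in> P" by (simp add: su(1) power_add mult_ac)
      then show ?thesis using P(3) p_pow u by blast
    qed
  qed
qed (rule assms(3))

text \<open>An ideal maximal among those avoiding a multiplicative set is prime. The set consists of
  the powers of \<open>p\<close>, and characteristic zero makes the torsion ideal a starting point
  for Zorn's lemma.\<close>

lemma ex_prime_not_containing_p: "\<exists>P. prime_over_torsion P \<and> of_nat p \<notin> P"
proof -
  define \<A> where "\<A> = {I. cr.subspace I \<and> torsion \<subseteq> I \<and> (\<forall>r. of_nat (p ^ r) \<notin> I)}"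
  have "\<exists>P\<in>\<A>. \<forall>I\<in>\<A>. P \<subseteq> I \<longrightarrow> I = P"
  proof (rule subset_Zorn_nonempty)
    show "\<A> \<noteq> {}" using torsion_subspace power_p_notin_torsion by (auto simp: \<A>_def simp del: of_nat_power)
    fix \<C> assume C: "\<C> \<noteq> {}" "subset.chain \<A> \<C>"
    have CA: "\<And>I. I \<in> \<C> \<Longrightarrow> I \<in> \<A>" and lin: "\<And>I J. I \<in> \<C> \<Longrightarrow> J \<in> \<C> \<Longrightarrow> I \<subseteq> J \<or> J \<subseteq> I"
      using C(2) by (auto simp: subset_chain_def)
    have "cr.subspace (\<Union>\<C>)"
    proof (rule cr.subspaceI)
      show "0 \<in> \<Union>\<C>" using C(1) CA by (auto simp: \<A>_def cr.subspace_0)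
      show "c * x \<in> \<Union>\<C>" if "x \<in> \<Union>\<C>" for c x
        using that CA subspace_mult_left by (fastforce simp: \<A>_def)
      fix x y assume "x \<in> \<Union>\<C>" "y \<in> \<Union>\<C>"
      then obtain I J where "x \<in> I" "y \<in> J" "I \<in> \<C>" "J \<in> \<C>" by blast
      then obtain L where L: "L \<in> \<C>" "x \<in> L" "y \<in> L" using lin by blast
      then have "cr.subspace L" using CA by (simp add: \<A>_def)
      from cr.subspace_add[OF this L(2,3)] show "x + y \<in> \<Union>\<C>" using L(1) by blast
    qed
    moreover have "torsion \<subseteq> \<Union>\<C>" using C(1) CA unfolding \<A>_def by blast
    moreover have "of_nat (p ^ r) \<notin> \<Union>\<C>" for r using CA unfolding \<A>_def by blast
    ultimately show "\<Union>\<C> \<in> \<A>" unfolding \<A>_def by blast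
  qed
  then obtain P where "P \<in> \<A>" and max: "\<And>I. I \<in> \<A> \<Longrightarrow> P \<subseteq> I \<Longrightarrow> I = P" by blast
  then have P: "cr.subspace P" "torsion \<subseteq> P" "\<And>r. of_nat (p ^ r) \<notin> P" by (auto simp: \<A>_def simp del: of_nat_power)
  have meets: "\<exists>r a. of_nat (p ^ r) - a * x \<in> P" if "x \<notin> P" for x
  proof -
    let ?I = "ideal_sum P (cr.span {x})"
    have I: "cr.subspace ?I" "P \<subseteq> ?I"
      by (rule ideal_sum_subspace[OF P(1) cr.subspace_span], rule ideal_sum_left[OF cr.subspace_span])
    have "x \<in> ?I" using ideal_sum_right[OF P(1), of "cr.span {x}"] by (auto intro: cr.span_base)
    then have "?I \<notin> \<A>" using max[OF _ I(2)] \<open>x \<notin> P\<close> by blast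
    then obtain r where "of_nat (p ^ r) \<in> ?I" using I P(2) unfolding \<A>_def by blast
    then obtain b where b: "b \<in> P" "of_nat (p ^ r) - b \<in> cr.span {x}" unfolding ideal_sum_def by blast
    then obtain a where "of_nat (p ^ r) - b = a * x" by (auto simp: cr.span_singleton simp del: of_nat_power)
    then have "of_nat (p ^ r) - a * x = b" by (simp add: algebra_simps)
    then show ?thesis using b(1) by metis
  qed
  have "x \<in> P \<or> y \<in> P" if xy: "x * y \<in> P" for x y
  proof (rule ccontr)
    assume "\<not> (x \<in> P \<or> y \<in> P)"
    then obtain r a s b where rs: "of_nat (p ^ r) - a * x \<in> P" "of_nat (p ^ s) - b * y \<in> P" using meets by metis
    have "of_nat (p ^ (r + s)) = (of_nat (p ^ r) - a * x) * of_nat (p ^ s) + (a * x) * (of_nat (p ^ s) - b * y) + (a * b) * (x * y)"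
      by (simp add: power_add algebra_simps)
    also have "\<dots> \<in> P"
      by (rule cr.subspace_add[OF P(1) cr.subspace_add[OF P(1) subspace_mult_right[OF P(1) rs(1)]
            subspace_mult_left[OF P(1) rs(2)]] subspace_mult_left[OF P(1) xy]])
    finally show False using P(3) by blast
  qed
  moreover have "1 \<notin> P" "of_nat p \<notin> P" using P(3)[of 0] P(3)[of 1] by simp_all
  ultimately show ?thesis using P(1,2) unfolding prime_over_torsion_def by blast
qed

text \<open>Exponents start at \<open>0\<close> on the left and at \<open>1\<close> on the right;
  one more factor \<open>p\<close> bridges the gap.\<close>

lemma torsion_vimage: "torsion = \<pi> -` p_power_torsion p R"
proof -
  have "(\<exists>r. of_nat (p ^ r) * x \<in> K) \<longleftrightarrow> (\<exists>r\<in>{1..}. of_nat (p ^ r) * x \<in> K)" for x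
  proof
    assume "\<exists>r. of_nat (p ^ r) * x \<in> K"
    then obtain r where "of_nat (p ^ r) * x \<in> K" by blast
    from subspace_mult_left[OF K_ideal this, of "of_nat p"] have "of_nat (p ^ Suc r) * x \<in> K"
      by (simp add: mult.assoc)
    then show "\<exists>r\<in>{1..}. of_nat (p ^ r) * x \<in> K" by (intro bexI[of _ "Suc r"]) auto
  qed blast
  then show ?thesis
    unfolding torsion_def p_power_torsion_def by (auto simp: K_def q_of_nat_mult simp del: of_nat_power)
qed

lemma quotient_presentation:
  defines "W \<equiv> R Quot p_power_torsion p R" and "\<tau> \<equiv> \<lambda>x. p_power_torsion p R +> \<pi> x"
  shows "presentation W \<tau>" "\<tau> -` {\<zero>\<^bsub>W\<^esub>} = torsion"
proof -
  have "p_power_torsion p R \<subseteq> carrier R" by (auto simp: p_power_torsion_def)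
  then have "\<pi> ` torsion = p_power_torsion p R" unfolding torsion_vimage by (rule image_vimage)
  then interpret t: ideal "p_power_torsion p R" R using ideal_image[OF torsion_subspace] by simp
  interpret W: cring W unfolding W_def by (rule t.quotient_is_cring[OF is_cring])
  note hom = t.rcos_ring_hom[folded W_def]
  show "presentation W \<tau>"
  proof
    have "carrier W = (\<lambda>a. p_power_torsion p R +> a) ` carrier R"
      by (auto simp: W_def FactRing_simps)
    then show "range \<tau> = carrier W" by (simp only: \<tau>_def q_range[symmetric] image_image)
  qed (simp_all add: \<tau>_def q_add q_mult q_one ring_hom_add[OF hom] ring_hom_mult[OF hom] ring_hom_one[OF hom])
  have "\<tau> x = p_power_torsion p R \<longleftrightarrow> \<pi> x \<in> p_power_torsion p R" for x
    unfolding \<tau>_def by (rule iffI, rule t.rcos_const_imp_mem[OF q_closed], assumption, rule t.a_rcos_const)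
  moreover have "\<zero>\<^bsub>W\<^esub> = p_power_torsion p R" by (simp add: W_def FactRing_def)
  ultimately show "\<tau> -` {\<zero>\<^bsub>W\<^esub>} = torsion" unfolding torsion_vimage vimage_def singleton_iff by simp
qed

theorem reduced_quotient: "reduced_ring (R Quot p_power_torsion p R)"
proof -
  let ?W = "R Quot p_power_torsion p R"
  interpret W: presentation ?W "\<lambda>x. p_power_torsion p R +> \<pi> x" by (rule quotient_presentation)
  note ker = quotient_presentation(2)
  show ?thesis
    unfolding reduced_ring_def
  proof (intro ballI impI)
    fix a assume "a \<in> carrier ?W" and "\<exists>n::nat. a [^]\<^bsub>?W\<^esub> n = \<zero>\<^bsub>?W\<^esub>"
    then obtain x and n :: nat where x: "p_power_torsion p R +> \<pi> x = a" and n: "a [^]\<^bsub>?W\<^esub> n = \<zero>\<^bsub>?W\<^esub>"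
      using W.obtain_preimage by metis
    have "x ^ n \<in> torsion" unfolding ker[symmetric] using n by (simp add: W.q_power x)
    then have "x \<in> torsion" by (rule radical)
    then show "a = \<zero>\<^bsub>?W\<^esub>" unfolding ker[symmetric] by (simp add: x)
  qed
qed

text \<open>In a chain of three primes the middle one contains \<open>p\<close>, hence is maximal,
  or omits \<open>p\<close>, hence is minimal; so the chain cannot be strict. A prime omitting
  \<open>p\<close>, below the maximal ideal, gives length one.\<close>

theorem krull_dim_quotient: "krull_dim (R Quot p_power_torsion p R) = 1"
proof -
  let ?W = "R Quot p_power_torsion p R" and ?\<tau> = "\<lambda>x. p_power_torsion p R +> \<pi> x"
  interpret W: presentation ?W ?\<tau> by (rule quotient_presentation)
  note ker = quotient_presentation(2)
  have vimage: "prime_over_torsion (?\<tau> -` P)" "?\<tau> ` (?\<tau> -` P) = P" if "primeideal P ?W" for P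
    using W.primeideal_vimage[OF that] unfolding prime_over_torsion_def ker by blast+
  have image: "primeideal (?\<tau> ` P) ?W" "?\<tau> x \<in> ?\<tau> ` P \<longleftrightarrow> x \<in> P" if "prime_over_torsion P" for P x
    using that W.primeideal_image[of P] W.mem_image_iff[of P x] unfolding prime_over_torsion_def ker by blast+
  let ?S = "{n. \<exists>P :: nat \<Rightarrow> 'a set set. (\<forall>i\<le>n. primeideal (P i) ?W) \<and> (\<forall>i<n. P i \<subset> P (Suc i))}"
  have "n \<le> 1" if "n \<in> ?S" for n
  proof (rule ccontr)
    assume "\<not> n \<le> 1"
    obtain P where P: "\<And>i. i \<le> n \<Longrightarrow> primeideal (P i) ?W" "\<And>i. i < n \<Longrightarrow> P i \<subset> P (Suc i)" using \<open>n \<in> ?S\<close> by blast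
    define P' where "P' i = ?\<tau> -` P i" for i
    have prime: "prime_over_torsion (P' i)" if "i \<le> n" for i unfolding P'_def using vimage(1)[OF P(1)[OF that]] .
    have strict: "P' i \<subset> P' (Suc i)" if "i < n" for i
    proof -
      have "?\<tau> ` P' i = P i" "?\<tau> ` P' (Suc i) = P (Suc i)"
        unfolding P'_def using that by (intro vimage(2) P(1); simp)+
      then have "P' i \<noteq> P' (Suc i)" using P(2)[OF that] by (metis less_irrefl)
      then show ?thesis using P(2)[OF that] unfolding P'_def by blast
    qed
    have 2: "P' 0 \<subset> P' 1" "P' 1 \<subset> P' 2" using strict[of 0] strict[of 1] \<open>\<not> n \<le> 1\<close> by (simp_all add: numeral_2_eq_2)
    have pr: "prime_over_torsion (P' 0)" "prime_over_torsion (P' 1)" "prime_over_torsion (P' 2)"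
      using prime \<open>\<not> n \<le> 1\<close> by simp_all
    show False
    proof (cases "of_nat p \<in> P' 1")
      case True
      then have "P' 1 = M 1" by (rule prime_containing_p[OF pr(2)])
      then show False using 2(2) prime_le_M_1[OF pr(3)] by blast
    next
      case False
      then show False using prime_minimal[OF pr(1,2)] 2(1) by blast
    qed
  qed
  moreover have "1 \<in> ?S"
  proof -
    obtain P where P: "prime_over_torsion P" "of_nat p \<notin> P" using ex_prime_not_containing_p by blast
    have M1: "prime_over_torsion (M 1)"
      unfolding prime_over_torsion_def using M_ideal torsion_le_M one_notin_M_1 M_1_prime by blast
    have "?\<tau> (of_nat p) \<in> ?\<tau> ` M 1" "?\<tau> (of_nat p) \<notin> ?\<tau> ` P"
      using image(2)[OF P(1)] P(2) p_in_M by blast+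
    then have "?\<tau> ` P \<subset> ?\<tau> ` M 1" using prime_le_M_1[OF P(1)] by blast
    then show ?thesis
      using image(1)[OF P(1)] image(1)[OF M1]
      by (intro CollectI exI[of _ "\<lambda>i. if i = 0 then ?\<tau> ` P else ?\<tau> ` M 1"]) auto
  qed
  ultimately show ?thesis
    unfolding krull_dim_def
    by (intro antisym SUP_least SUP_upper2[of 1]) (auto simp: one_enat_def)
qed

end

theorem theorem7p1:
  fixes p n :: nat
    and k :: "'k ring"
    and R :: "('a, 'k) coeff_ring"
    and G :: "'g monoid"
    and \<rho>bar :: "'g \<Rightarrow> 'k mat"
  assumes "field k" and "finite (carrier k)" and "has_char k p"
    and "R \<in> coeff_category p k" and "has_char R 0"
    and "group G" and "finite (carrier G)" and "n \<ge> 1"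
    and "\<rho>bar \<in> hom G (GL n k)"
    and "universal_deformation_ring p k G n \<rho>bar R"
  shows "reduced_ring (R Quot p_power_torsion p R)
       \<and> krull_dim (R Quot p_power_torsion p R) = 1"
proof -
  interpret cring R using assms(4) by (auto simp: coeff_category_def local_cring_def)
  \<comment> \<open>Every element of the carrier type becomes a variable; those outside the carrier
    of \<open>R\<close> are sent to zero, so that evaluation always stays in
    \<open>R\<close>.\<close>
  define c where "c a = (if a \<in> carrier R then a else \<zero>\<^bsub>R\<^esub>)" for a
  have c: "c a \<in> carrier R" for a by (simp add: c_def)
  have "presentation R (poly_eval R c)"
  proof
    have "a \<in> range (poly_eval R c)" if "a \<in> carrier R" for a
      using poly_eval_var[of c a] that c by (auto simp: c_def image_iff intro!: exI[of _ "poly_var a"])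
    then show "range (poly_eval R c) = carrier R" using poly_eval_closed[of c] c by auto
  qed (simp_all add: poly_eval_add poly_eval_mult poly_eval_one c)
  then interpret presented_polynomial R "poly_eval R c" p k
    by (intro presented_polynomial.intro presented_object.intro presented_object_axioms.intro assms(1-4))
  obtain N where N: "N > 0" "\<And>Q i. cr.subspace Q \<Longrightarrow> M i \<subseteq> Q \<Longrightarrow> Q \<subseteq> M 1 \<Longrightarrow> \<exists>T a. casimir_family Q N T a"
    using casimir_of_universal[OF assms(6,7,10)] by blast
  have "adic_ring_casimir M K p N"
    by (rule adic_ring_casimir.intro[OF adic_ring_prime_axioms], rule adic_ring_casimir_axioms.intro)
      (assumption | rule N char_0[OF assms(5)] local_inverse)+
  then interpret casimir_object R "poly_eval R c" p k N
    by (intro casimir_object.intro presented_object_axioms casimir_object_axioms.intro)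
  show ?thesis using reduced_quotient krull_dim_quotient by blast
qed

end
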